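(* Let $\widehat\Gamma=\left\langle\begin{pmatrix}1&4\\0&1\end{pmatrix},\begin{pmatrix}0&1\\-1&0\end{pmatrix}\right\rangle<\mathrm{PSL}(2,\mathbb{R})$, with limit set $\mathcal{L}(\widehat\Gamma)$ and critical exponent $\delta_{\widehat\Gamma}$. Let $(-2,2)^*=(-2,2)\setminus\{0\}$, let $T$ be the Gauss map $[0;a_1,a_2,a_3,\dots]\mapsto[0;a_2,a_3,\dots]$ on $\mathcal{L}(\widehat\Gamma)\cap(-2,2)^*$, and let $m^0$ be the measure $$m^0(E)=C_0\int_E\int_{-2}^{2}\frac{d\mu^{PS}(x)}{|xy-1|^{2\delta_{\widehat\Gamma}}}\,d\mu^{PS}(y)$$ for Borel sets $E\subset\mathcal{L}(\widehat\Gamma)\cap(-2,2)$, where $C_0$ is the constant making $m^0$ a probability measure. Then on $(-2,2)^*$ the measure $m^0$ is $T$-invariant and ergodic for $T$.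
   Context: Continued fractions: $[a_0;a_1,a_2,\dots]=a_0+\cfrac{1}{a_1+\cfrac{1}{a_2+\cdots}}$. Points of $\mathcal{L}(\widehat\Gamma)\cap(-2,2)^*$ have (finite or infinite) expansions $[0;a_1,a_2,\dots]$ with all $a_i\in4\mathbb{Z}\setminus\{0\}$; the countable set of points with finite expansions is $m^0$-null, so $T$ is defined $m^0$-almost everywhere on all iterates. The inverse image of $[0;a_1,a_2,\dots]$ is $\{[0;k,a_1,a_2,\dots]:k\in4\mathbb{Z}\setminus\{0\}\}$. $\beta_\xi(x,y)=\lim_{t\to\infty}d(x,\xi_t)-d(y,\xi_t)$ for a geodesic $\xi_t\to\xi\in\partial\mathbb{H}$ in the upper half plane $\mathbb{H}$. $\{\nu_x\}_{x\in\mathbb{H}}$ is the Patterson–Sullivan density of $\widehat\Gamma$: finite Borel measures on $\partial\mathbb{H}$ supported on $\mathcal{L}(\widehat\Gamma)$ with $\gamma_*\nu_x=\nu_{\gamma x}$ for $\gamma\in\widehat\Gamma$ and $\frac{d\nu_x}{d\nu_y}(\xi)=e^{\delta_{\widehat\Gamma}\beta_\xi(y,x)}$. $d\mu^{PS}(x)=e^{\delta_{\widehat\Gamma}\beta_x(i,i+x)}d\nu_i(x)$ on $\mathbb{R}$. *)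

theory Defs
  imports "HOL-Probability.Probability" "HOL-Algebra.Generated_Groups" "HOL-Algebra.Coset"
begin

section \<open>The group\<close>

definition SL2R :: "(real^2^2) monoid" where
  "SL2R = \<lparr>carrier = {A. det A = 1}, mult = (**), one = mat 1\<rparr>"

text \<open>An element of \<open>PSL2R\<close> is a coset \<open>{A, - A}\<close>.\<close>

definition PSL2R :: "(real^2^2) set monoid" where
  "PSL2R = SL2R Mod {mat 1, - mat 1}"

definition psl :: "real^2^2 \<Rightarrow> (real^2^2) set" where
  "psl A = {mat 1, - mat 1} #>\<^bsub>SL2R\<^esub> A"

definition Gamma_hat :: "(real^2^2) set set" where
  "Gamma_hat = generate PSL2R
     {psl (vector [vector [1, 4], vector [0, 1]]),
      psl (vector [vector [0, 1], vector [-1, 0]])}"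


section \<open>Hyperbolic plane and its boundary\<close>

definition UHP :: "complex set" where
  "UHP = {z. 0 < Im z}"

definition hdist :: "complex \<Rightarrow> complex \<Rightarrow> real" where
  "hdist z w = arcosh (1 + (cmod (z - w))\<^sup>2 / (2 * Im z * Im w))"

text \<open>
  The boundary of the upper half plane is the one-point compactification of the real line,
  with \<open>None\<close> as the point at infinity. It sits in the Riemann sphere
  (the one-point compactification of the complex plane) via \<open>map_option complex_of_real\<close>,
  and convergence of points of the upper half plane to the boundary is convergence in that sphere.
\<close>

abbreviation riemann_sphere :: "complex option topology" where
  "riemann_sphere \<equiv> Alexandroff_compactification euclidean"

abbreviation boundary_top :: "real option topology" where
  "boundary_top \<equiv> Alexandroff_compactification euclidean"

definition boundary_borel :: "real option measure" where
  "boundary_borel = sigma UNIV {U. openin boundary_top U}"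

definition moebius :: "real^2^2 \<Rightarrow> complex \<Rightarrow> complex" where
  "moebius A z = (of_real (A$1$1) * z + of_real (A$1$2)) / (of_real (A$2$1) * z + of_real (A$2$2))"

fun moebius_boundary :: "real^2^2 \<Rightarrow> real option \<Rightarrow> real option" where
  "moebius_boundary A None = (if A$2$1 = 0 then None else Some (A$1$1 / A$2$1))"
| "moebius_boundary A (Some x) =
     (if A$2$1 * x + A$2$2 = 0 then None else Some ((A$1$1 * x + A$1$2) / (A$2$1 * x + A$2$2)))"

text \<open>\<open>A\<close> and \<open>- A\<close> act identically, so both actions descend to cosets.\<close>

definition psl_act :: "(real^2^2) set \<Rightarrow> complex \<Rightarrow> complex" where
  "psl_act g z = (THE w. \<exists>A\<in>g. w = moebius A z)"

definition psl_act_boundary :: "(real^2^2) set \<Rightarrow> real option \<Rightarrow> real option" where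
  "psl_act_boundary g \<xi> = (THE \<eta>. \<exists>A\<in>g. \<eta> = moebius_boundary A \<xi>)"

definition limit_set :: "(real^2^2) set set \<Rightarrow> real option set" where
  "limit_set G = {\<xi>. map_option complex_of_real \<xi> \<in>
     riemann_sphere derived_set_of ((\<lambda>g. Some (psl_act g \<i>)) ` G)}"

definition real_limit_set :: "(real^2^2) set set \<Rightarrow> real set" where
  "real_limit_set G = {x. Some x \<in> limit_set G}"

text \<open>The exponent of convergence of the Poincare series.\<close>

definition critical_exponent :: "(real^2^2) set set \<Rightarrow> real" where
  "critical_exponent G = Inf {s. 0 \<le> s \<and> (\<lambda>g. exp (- s * hdist \<i> (psl_act g \<i>))) summable_on G}"

definition geodesic_ray_to :: "(real \<Rightarrow> complex) \<Rightarrow> real option \<Rightarrow> bool" where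
  "geodesic_ray_to c \<xi> \<longleftrightarrow>
     (\<forall>t\<ge>0. c t \<in> UHP) \<and>
     (\<forall>s\<ge>0. \<forall>t\<ge>0. hdist (c s) (c t) = \<bar>s - t\<bar>) \<and>
     limitin riemann_sphere (\<lambda>t. Some (c t)) (map_option complex_of_real \<xi>) at_top"

definition busemann :: "real option \<Rightarrow> complex \<Rightarrow> complex \<Rightarrow> real" where
  "busemann \<xi> x y = (THE b. \<exists>c. geodesic_ray_to c \<xi> \<and>
     ((\<lambda>t. hdist x (c t) - hdist y (c t)) \<longlongrightarrow> b) at_top)"


section \<open>Patterson-Sullivan density and measure\<close>

text \<open>
  Only the values \<open>\<nu> x\<close> with \<open>x\<close> in the upper half plane matter. The density is required to be
  nonzero, and is thereby unique up to a scalar for the group considered here.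
\<close>

definition patterson_sullivan_density ::
    "(real^2^2) set set \<Rightarrow> (complex \<Rightarrow> real option measure) \<Rightarrow> bool" where
  "patterson_sullivan_density G \<nu> \<longleftrightarrow>
     (\<forall>x\<in>UHP. finite_measure (\<nu> x) \<and> sets (\<nu> x) = sets boundary_borel \<and>
        emeasure (\<nu> x) (space (\<nu> x)) \<noteq> 0 \<and> (AE \<xi> in \<nu> x. \<xi> \<in> limit_set G)) \<and>
     (\<forall>g\<in>G. \<forall>x\<in>UHP. distr (\<nu> x) boundary_borel (psl_act_boundary g) = \<nu> (psl_act g x)) \<and>
     (\<forall>x\<in>UHP. \<forall>y\<in>UHP.
        \<nu> x = density (\<nu> y) (\<lambda>\<xi>. ennreal (exp (critical_exponent G * busemann \<xi> y x))))"

text \<open>The restriction of \<open>\<nu> \<i>\<close> to the real line is transported from \<open>range Some\<close> to the reals.\<close>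

definition mu_PS ::
    "(real^2^2) set set \<Rightarrow> (complex \<Rightarrow> real option measure) \<Rightarrow> real measure" where
  "mu_PS G \<nu> = density (distr (restrict_space (\<nu> \<i>) (range Some)) borel the)
     (\<lambda>x. ennreal (exp (critical_exponent G * busemann (Some x) \<i> (\<i> + complex_of_real x))))"

definition m0_unnormalized ::
    "(real^2^2) set set \<Rightarrow> (complex \<Rightarrow> real option measure) \<Rightarrow> real measure" where
  "m0_unnormalized G \<nu> =
     density (restrict_space (mu_PS G \<nu>) (real_limit_set G \<inter> {-2<..<2}))
       (\<lambda>y. \<integral>\<^sup>+x\<in>{-2..2}. 1 / ennreal (\<bar>x * y - 1\<bar> powr (2 * critical_exponent G)) \<partial>mu_PS G \<nu>)"

text \<open>
  The normalising constant is the inverse of the total mass. That this does produce a probability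
  measure, i.e. that the mass is positive and finite, is not built in.
\<close>

definition m0 ::
    "(real^2^2) set set \<Rightarrow> (complex \<Rightarrow> real option measure) \<Rightarrow> real measure" where
  "m0 G \<nu> = scale_measure
     (1 / emeasure (m0_unnormalized G \<nu>) (space (m0_unnormalized G \<nu>))) (m0_unnormalized G \<nu>)"

definition m0_star ::
    "(real^2^2) set set \<Rightarrow> (complex \<Rightarrow> real option measure) \<Rightarrow> real measure" where
  "m0_star G \<nu> = restrict_space (m0 G \<nu>) ({-2<..<2} - {0})"


section \<open>Continued fractions and the Gauss map\<close>

text \<open>\<open>cfrac a\<^sub>0 [a\<^sub>1, \<dots>, a\<^sub>n]\<close> is the finite continued fraction \<open>[a\<^sub>0; a\<^sub>1, \<dots>, a\<^sub>n]\<close>.\<close>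

fun cfrac :: "int \<Rightarrow> int list \<Rightarrow> real" where
  "cfrac a [] = of_int a"
| "cfrac a (b # bs) = of_int a + 1 / cfrac b bs"

text \<open>
  An infinite expansion \<open>[0; a 0, a 1, \<dots>]\<close> (so the digit usually called \<open>a\<^sub>1\<close> is \<open>a 0\<close>)
  is the limit of its convergents.
\<close>

definition cfrac_converges :: "(nat \<Rightarrow> int) \<Rightarrow> real \<Rightarrow> bool" where
  "cfrac_converges a x \<longleftrightarrow> (\<lambda>n. cfrac 0 (map a [0..<n])) \<longlonglongrightarrow> x"

definition digits :: "int set" where
  "digits = {k. 4 dvd k} - {0}"

definition gauss_rel :: "real \<Rightarrow> real \<Rightarrow> bool" where
  "gauss_rel x y \<longleftrightarrow>
     (\<exists>a as. set (a # as) \<subseteq> digits \<and> x = cfrac 0 (a # as) \<and> y = cfrac 0 as) \<or>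
     (\<exists>a. range a \<subseteq> digits \<and> cfrac_converges a x \<and> cfrac_converges (\<lambda>n. a (Suc n)) y)"

text \<open>
  Used only on the nonzero points of the limit set in \<open>(-2, 2)\<close>. The points \<open>[0; a\<^sub>1]\<close> are sent to
  the empty expansion \<open>0\<close>, which lies outside this domain.
\<close>

definition gauss_map :: "real \<Rightarrow> real" where
  "gauss_map x = (THE y. gauss_rel x y)"


section \<open>Invariance and ergodicity\<close>

text \<open>
  Here \<open>T\<close> need not map \<open>space M\<close> into itself: points leaving it belong to no preimage,
  as for a map that is defined only almost everywhere. The measurability of
  \<open>T\<close> is part of invariance, and invariant sets are invariant modulo null sets.
\<close>

definition invariant_measure :: "'a measure \<Rightarrow> ('a \<Rightarrow> 'a) \<Rightarrow> bool" where
  "invariant_measure M T \<longleftrightarrow>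
     (\<forall>E\<in>sets M. T -` E \<inter> space M \<in> sets M \<and> emeasure M (T -` E \<inter> space M) = emeasure M E)"

definition ergodic_measure :: "'a measure \<Rightarrow> ('a \<Rightarrow> 'a) \<Rightarrow> bool" where
  "ergodic_measure M T \<longleftrightarrow>
     (\<forall>E\<in>sets M. sym_diff (T -` E \<inter> space M) E \<in> null_sets M \<longrightarrow>
        E \<in> null_sets M \<or> space M - E \<in> null_sets M)"

end

theory Submission
  imports Defs
begin

text \<open>
  In Euclidean coordinates the Patterson-Sullivan measure becomes a measure on the real line that is
  invariant under \<open>x \<mapsto> x + 4\<close> and scales by \<open>\<bar>x\<bar> powr (- 2 * \<delta>)\<close> under \<open>x \<mapsto> - 1 / x\<close>. The limit set
  inside \<open>[-2, 2]\<close> lies in \<open>[-1/3, 1/3]\<close>, so the restriction \<open>M\<close> to \<open>[-2, 2]\<close> satisfies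
  \<open>\<integral> u dM = c * u 0 + \<integral> T u dM\<close>, where \<open>c\<close> is the mass of the point at infinity and \<open>T\<close> is the transfer
  operator of the contractions \<open>x \<mapsto> - 1 / (k + x)\<close>. If \<open>c > 0\<close>, the iterates of \<open>T\<close> have finite sum at
  \<open>\<delta>\<close>, hence also at some exponent below \<open>\<delta>\<close>, where the Poincare series would then converge; so \<open>c = 0\<close>.

  The transfer operator contracts logarithmic Lipschitz constants. Hence any two conformal measures are
  comparable, with a constant independent of the measures, and this gives both uniqueness of the
  conformal measure of given mass and ergodicity (compare \<open>M\<close> with its restriction to an invariant
  set). By uniqueness \<open>M\<close> is invariant under \<open>x \<mapsto> - x\<close>, hence conformal for the branches
  \<open>x \<mapsto> 1 / (k + x)\<close> of the Gauss map, and \<open>y \<mapsto> \<integral> \<bar>x * y - 1\<bar> powr (- 2 * \<delta>) dM(x)\<close> is fixed by their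
  transfer operator because its kernel is symmetric.
\<close>

section \<open>Transfer operators and conformal measures\<close>

text \<open>The obstacle is the cusp: a density for this group may a priori charge the point at
  infinity, and then also 0 and every finite expansion, so that \<open>M\<close> would not be
  conformal and the comparison argument could not start. The Poincare series enters only to exclude
  this. It is evaluated along the orbit of i, whereas the atoms sit on the real line; the transfer
  operator is therefore set up over any normed field, and the logarithmic Lipschitz bound carries
  estimates from 0 to i inside the complex unit ball. All constants come from the digits having
  absolute value at least 4: on the unit ball |k + x| is at least 3, the branches contract by 1/9,
  and 3/4 * s is the fixed point of a -> 2 * s / 3 + a / 9. The parameter \<open>e\<close> keeps two
  families of branches apart: \<open>e = - 1\<close> belongs to the group, \<open>e = 1\<close> to
  the Gauss map. Functions take values in \<open>ennreal\<close>, so divergent sums need no separate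
  treatment; divergence is even used, to obtain \<delta> > 1/2.\<close>

lemma digits_abs_ge: "k \<in> digits \<Longrightarrow> 4 \<le> \<bar>k\<bar>"
  by (auto simp: digits_def)

lemma uminus_digits_iff [simp]: "- k \<in> digits \<longleftrightarrow> k \<in> digits"
  by (auto simp: digits_def)

lemma countable_digits: "countable digits"
  by (rule countableI_type)

lemma norm_digit_plus_ge:
  fixes x :: "'a::real_normed_field"
  assumes "k \<in> digits" "norm x \<le> 1"
  shows "real_of_int \<bar>k\<bar> - 1 \<le> norm (of_int k + x)" "3 \<le> norm (of_int k + x)"
proof -
  have "real_of_int \<bar>k\<bar> = norm (of_int k :: 'a)"
    by simp
  also have "\<dots> = norm (of_int k + x - x)"
    by simp
  also have "\<dots> \<le> norm (of_int k + x) + norm x"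
    by (rule norm_triangle_ineq4)
  finally show 1: "real_of_int \<bar>k\<bar> - 1 \<le> norm (of_int k + x)"
    using assms by simp
  have "4 \<le> real_of_int \<bar>k\<bar>"
    using digits_abs_ge[OF assms(1)] by linarith
  with 1 show "3 \<le> norm (of_int k + x)"
    by linarith
qed

lemma norm_branch_le:
  fixes x :: "'a::real_normed_field"
  assumes "k \<in> digits" "norm x \<le> 1" "norm e = 1"
  shows "norm (e / (of_int k + x)) \<le> 1 / 3"
proof -
  have "1 / norm (of_int k + x) \<le> 1 / 3"
    using norm_digit_plus_ge(2)[OF assms(1,2)] by (intro divide_left_mono) auto
  then show ?thesis
    by (simp add: norm_divide assms(3))
qed

text \<open>The weight is the s-th power of the modulus of the derivative of the branch x -> e / (k
  + x) when \<open>norm e = 1\<close>. Over the reals the operator acts on test functions for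
  measures; over the complex numbers its iterates at i dominate the sums over group
  elements.\<close>

definition transfer :: "real \<Rightarrow> 'a::real_normed_field \<Rightarrow> ('a \<Rightarrow> ennreal) \<Rightarrow> 'a \<Rightarrow> ennreal" where
  "transfer s e u x =
     (\<integral>\<^sup>+k. ennreal (norm (of_int k + x) powr (- 2 * s)) * u (e / (of_int k + x)) \<partial>count_space digits)"

text \<open>Lipschitz continuity of ln u in multiplicative form, which also admits the values 0 and
  infinity: such a value at one point of the ball is then taken on the whole ball. The ball is the
  domain because every branch maps it into itself.\<close>

definition log_lip :: "real \<Rightarrow> ('a::real_normed_field \<Rightarrow> ennreal) \<Rightarrow> bool" where
  "log_lip a u \<longleftrightarrow>
     (\<forall>x\<in>cball 0 1. \<forall>y\<in>cball 0 1. u x \<le> ennreal (exp (a * norm (x - y))) * u y)"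

lemma log_lipD:
  "log_lip a u \<Longrightarrow> norm x \<le> 1 \<Longrightarrow> norm y \<le> 1 \<Longrightarrow> u x \<le> ennreal (exp (a * norm (x - y))) * u y"
  by (auto simp: log_lip_def)

lemma log_lip_mono: "log_lip a u \<Longrightarrow> a \<le> b \<Longrightarrow> log_lip b u"
  unfolding log_lip_def
  by (meson ennreal_leI exp_le_cancel_iff mult_right_mono norm_ge_zero order_trans zero_le)

lemma log_lip_const: "0 \<le> a \<Longrightarrow> log_lip a (\<lambda>_. c)"
  unfolding log_lip_def
proof (intro ballI)
  fix x y :: 'a assume "0 \<le> a"
  then have "1 \<le> ennreal (exp (a * norm (x - y)))"
    by (simp add: ennreal_ge_1)
  then show "c \<le> ennreal (exp (a * norm (x - y))) * c"
    by (metis mult_1 mult_right_mono zero_le)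
qed

lemma norm_digit_plus_ratio:
  fixes x y :: "'a::real_normed_field"
  assumes "k \<in> digits" "norm x \<le> 1" "norm y \<le> 1"
  shows "norm (of_int k + y) \<le> exp (norm (x - y) / 3) * norm (of_int k + x)"
proof -
  let ?X = "norm (of_int k + x)"
  have X: "3 \<le> ?X"
    using norm_digit_plus_ge(2)[OF assms(1,2)] .
  have "norm (of_int k + y) = norm ((of_int k + x) - (x - y))"
    by simp
  also have "\<dots> \<le> ?X + norm (x - y)"
    by (rule norm_triangle_ineq4)
  also have "\<dots> \<le> ?X + norm (x - y) / 3 * ?X"
    using mult_left_mono[OF X, of "norm (x - y) / 3"] by simp
  also have "\<dots> = (1 + norm (x - y) / 3) * ?X"
    by (simp add: algebra_simps)
  also have "\<dots> \<le> exp (norm (x - y) / 3) * ?X"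
    by (intro mult_right_mono exp_ge_add_one_self) auto
  finally show ?thesis .
qed

lemma weight_ratio:
  fixes x y :: "'a::real_normed_field"
  assumes "k \<in> digits" "norm x \<le> 1" "norm y \<le> 1" "0 \<le> s"
  shows "norm (of_int k + x) powr (- 2 * s)
     \<le> exp (2 * s / 3 * norm (x - y)) * norm (of_int k + y) powr (- 2 * s)"
proof -
  let ?X = "norm (of_int k + x)" and ?Y = "norm (of_int k + y)"
  have X: "3 \<le> ?X" and Y: "3 \<le> ?Y"
    using norm_digit_plus_ge(2) assms by blast+
  have "?Y powr (2 * s) \<le> (exp (norm (x - y) / 3) * ?X) powr (2 * s)"
    using norm_digit_plus_ratio[OF assms(1-3)] assms(4) by (intro powr_mono2) auto
  also have "\<dots> = exp (2 * s / 3 * norm (x - y)) * ?X powr (2 * s)"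
    by (simp add: powr_mult exp_powr_real mult_ac)
  finally have "?Y powr (2 * s) \<le> exp (2 * s / 3 * norm (x - y)) * ?X powr (2 * s)" .
  moreover have "0 < ?X powr (2 * s)" "0 < ?Y powr (2 * s)"
    using X Y by auto
  ultimately have "inverse (?X powr (2 * s)) \<le> exp (2 * s / 3 * norm (x - y)) * inverse (?Y powr (2 * s))"
    by (simp only: inverse_eq_divide divide_le_eq le_divide_eq times_divide_eq_right
        times_divide_eq_left mult_1_left mult_1_right if_True if_False)
  then show ?thesis
    by (simp add: powr_minus)
qed

lemma branch_dist_le:
  fixes x y :: "'a::real_normed_field"
  assumes "k \<in> digits" "norm x \<le> 1" "norm y \<le> 1" "norm e = 1"
  shows "norm (e / (of_int k + x) - e / (of_int k + y)) \<le> norm (x - y) / 9"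
proof -
  let ?X = "of_int k + x" and ?Y = "of_int k + y"
  have X: "3 \<le> norm ?X" and Y: "3 \<le> norm ?Y"
    using norm_digit_plus_ge(2) assms by blast+
  then have nz: "?X \<noteq> 0" "?Y \<noteq> 0"
    by auto
  have "e / ?X - e / ?Y = e * (y - x) / (?X * ?Y)"
    using nz by (simp add: divide_simps) (simp add: algebra_simps)
  then have "norm (e / ?X - e / ?Y) = norm (x - y) / (norm ?X * norm ?Y)"
    by (simp add: norm_divide norm_mult assms norm_minus_commute)
  also have "\<dots> \<le> norm (x - y) / 9"
    using mult_mono[OF X Y] by (intro divide_left_mono) auto
  finally show ?thesis .
qed

text \<open>Each summand is a weight with constant 2 * s / 3 times u composed with a
  1/9-contraction; a sum of terms sharing a logarithmic Lipschitz constant keeps it.\<close>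

lemma transfer_log_lip:
  fixes u :: "'a::real_normed_field \<Rightarrow> ennreal"
  assumes e: "norm e = 1" and s: "0 \<le> s" and a: "0 \<le> a" and u: "log_lip a u"
  shows "log_lip (2 * s / 3 + a / 9) (transfer s e u)"
  unfolding log_lip_def
proof (intro ballI)
  fix x y :: 'a assume "x \<in> cball 0 1" "y \<in> cball 0 1"
  then have x: "norm x \<le> 1" and y: "norm y \<le> 1"
    by auto
  let ?w = "\<lambda>k x. norm (of_int k + x) powr (- 2 * s)"
  let ?c = "exp ((2 * s / 3 + a / 9) * norm (x - y))"
  have "ennreal (?w k x) * u (e / (of_int k + x))
      \<le> ennreal ?c * (ennreal (?w k y) * u (e / (of_int k + y)))" if k: "k \<in> digits" for k
  proof -
    let ?p = "e / (of_int k + x)" and ?q = "e / (of_int k + y)"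
    have pq: "norm ?p \<le> 1" "norm ?q \<le> 1"
      using norm_branch_le[OF k x e] norm_branch_le[OF k y e] by linarith+
    have "u ?p \<le> ennreal (exp (a * norm (?p - ?q))) * u ?q"
      by (rule log_lipD[OF u pq])
    also have "\<dots> \<le> ennreal (exp (a / 9 * norm (x - y))) * u ?q"
      using mult_left_mono[OF branch_dist_le[OF k x y e] a]
      by (intro mult_right_mono ennreal_leI) (auto simp: field_simps)
    finally have "ennreal (?w k x) * u ?p
       \<le> ennreal (exp (2 * s / 3 * norm (x - y)) * ?w k y) * (ennreal (exp (a / 9 * norm (x - y))) * u ?q)"
      using weight_ratio[OF k x y s] by (intro mult_mono ennreal_leI) auto
    also have "\<dots> = ennreal (exp (2 * s / 3 * norm (x - y)) * exp (a / 9 * norm (x - y)))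
        * (ennreal (?w k y) * u ?q)"
      by (simp add: ennreal_mult mult_ac)
    also have "exp (2 * s / 3 * norm (x - y)) * exp (a / 9 * norm (x - y)) = ?c"
      by (simp add: distrib_right flip: exp_add)
    finally show ?thesis .
  qed
  then have "transfer s e u x
     \<le> (\<integral>\<^sup>+k. ennreal ?c * (ennreal (?w k y) * u (e / (of_int k + y))) \<partial>count_space digits)"
    unfolding transfer_def by (intro nn_integral_mono) auto
  also have "\<dots> = ennreal ?c * transfer s e u y"
    unfolding transfer_def by (rule nn_integral_cmult) simp
  finally show "transfer s e u x \<le> ennreal ?c * transfer s e u y" .
qed

text \<open>Since 3/4 * s is fixed by a -> 2 * s / 3 + a / 9, only the excess depends on the initial
  function, and it shrinks by the factor 9 at each step.\<close>

lemma transfer_pow_log_lip: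
  fixes u :: "'a::real_normed_field \<Rightarrow> ennreal"
  assumes e: "norm e = 1" and s: "0 \<le> s" and a: "0 \<le> a" and u: "log_lip a u"
  shows "log_lip (3 / 4 * s + a / 9 ^ n) ((transfer s e ^^ n) u)"
proof (induction n)
  case 0
  show ?case
    using s log_lip_mono[OF u] by simp
next
  case (Suc n)
  have "log_lip (2 * s / 3 + (3 / 4 * s + a / 9 ^ n) / 9) (transfer s e ((transfer s e ^^ n) u))"
    using s a by (intro transfer_log_lip e Suc) auto
  moreover have "2 * s / 3 + (3 / 4 * s + a / 9 ^ n) / 9 = 3 / 4 * s + a / 9 ^ Suc n"
    by (simp add: field_simps)
  ultimately show ?case
    by simp
qed

lemma transfer_mono:
  fixes u v :: "'a::real_normed_field \<Rightarrow> ennreal"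
  assumes "norm e = 1" "norm x \<le> 1" "\<And>x. norm x \<le> 1 \<Longrightarrow> u x \<le> v x"
  shows "transfer s e u x \<le> transfer s e v x"
  unfolding transfer_def
proof (intro nn_integral_mono mult_left_mono)
  fix k assume "k \<in> space (count_space digits)"
  then have "norm (e / (of_int k + x)) \<le> 1 / 3"
    by (intro norm_branch_le assms) auto
  then show "u (e / (of_int k + x)) \<le> v (e / (of_int k + x))"
    by (intro assms(3)) linarith
qed simp

lemma transfer_pow_mono:
  fixes u v :: "'a::real_normed_field \<Rightarrow> ennreal"
  assumes "norm e = 1" "norm x \<le> 1" "\<And>x. norm x \<le> 1 \<Longrightarrow> u x \<le> v x"
  shows "(transfer s e ^^ n) u x \<le> (transfer s e ^^ n) v x"
  using assms(2)
proof (induction n arbitrary: x)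
  case (Suc n)
  then show ?case
    by (auto intro!: transfer_mono assms(1))
qed (simp add: assms)

lemma transfer_cmult: "transfer s e (\<lambda>x. c * u x) x = c * transfer s e u x"
proof -
  have "transfer s e (\<lambda>x. c * u x) x
    = (\<integral>\<^sup>+k. c * (ennreal (norm (of_int k + x) powr (- 2 * s)) * u (e / (of_int k + x))) \<partial>count_space digits)"
    unfolding transfer_def by (simp add: mult_ac)
  also have "\<dots> = c * transfer s e u x"
    unfolding transfer_def by (rule nn_integral_cmult) simp
  finally show ?thesis .
qed

lemma transfer_pow_cmult: "(transfer s e ^^ n) (\<lambda>x. c * u x) x = c * (transfer s e ^^ n) u x"
proof (induction n arbitrary: x)
  case (Suc n)
  then have "(transfer s e ^^ n) (\<lambda>x. c * u x) = (\<lambda>x. c * (transfer s e ^^ n) u x)"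
    by auto
  then show ?case
    by (simp add: transfer_cmult)
qed simp

lemma transfer_borel:
  fixes u :: "real \<Rightarrow> ennreal"
  assumes [measurable]: "u \<in> borel_measurable borel"
  shows "transfer s e u \<in> borel_measurable borel"
proof -
  interpret sigma_finite_measure "count_space digits"
    by (rule sigma_finite_measure_count_space_countable[OF countable_digits])
  have "(\<lambda>p. ennreal (norm (of_int (fst p) + snd p) powr (- 2 * s)) * u (e / (of_int (fst p) + snd p)))
      \<in> borel_measurable (count_space digits \<Otimes>\<^sub>M borel)"
    by (rule measurable_pair_measure_countable1[OF countable_digits]) (simp; measurable)
  then have "(\<lambda>p. ennreal (norm (of_int (snd p) + fst p) powr (- 2 * s)) * u (e / (of_int (snd p) + fst p)))
      \<in> borel_measurable (borel \<Otimes>\<^sub>M count_space digits)"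
    by (subst measurable_pair_swap_iff) (simp add: split_beta')
  then have "(\<lambda>x. \<integral>\<^sup>+k. ennreal (norm (of_int k + x) powr (- 2 * s)) * u (e / (of_int k + x)) \<partial>count_space digits)
      \<in> borel_measurable borel"
    by (intro borel_measurable_nn_integral) (simp add: split_beta')
  then show ?thesis
    unfolding transfer_def[abs_def] .
qed

lemma transfer_pow_borel:
  fixes u :: "real \<Rightarrow> ennreal"
  assumes "u \<in> borel_measurable borel"
  shows "(transfer s e ^^ n) u \<in> borel_measurable borel"
  by (induction n) (auto intro: transfer_borel assms)

section \<open>Conformal measures: comparison, uniqueness, ergodicity\<close>

text \<open>\<open>M\<close> is fixed by the dual of the transfer operator: it is the sum over the
  branches of the images of \<open>M\<close> weighted by the powers of the derivatives.\<close>

definition conformal :: "real \<Rightarrow> real \<Rightarrow> real measure \<Rightarrow> bool" where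
  "conformal s e M \<longleftrightarrow>
     (\<forall>u\<in>borel_measurable borel. (\<integral>\<^sup>+x. u x \<partial>M) = (\<integral>\<^sup>+x. transfer s e u x \<partial>M))"

lemma conformalD:
  "conformal s e M \<Longrightarrow> u \<in> borel_measurable borel \<Longrightarrow>
    (\<integral>\<^sup>+x. u x \<partial>M) = (\<integral>\<^sup>+x. transfer s e u x \<partial>M)"
  by (auto simp: conformal_def)

lemma conformal_pow:
  assumes "conformal s e M" "u \<in> borel_measurable borel"
  shows "(\<integral>\<^sup>+x. u x \<partial>M) = (\<integral>\<^sup>+x. (transfer s e ^^ n) u x \<partial>M)"
proof (induction n)
  case (Suc n)
  then show ?case
    using conformalD[OF assms(1) transfer_pow_borel[OF assms(2), of n s e]] by simp
qed simp

lemma nn_integral_mono_setwise: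
  assumes sets: "sets A = sets B" and le: "\<And>S. S \<in> sets B \<Longrightarrow> ennreal t * emeasure B S \<le> emeasure A S"
    and u: "u \<in> borel_measurable B"
  shows "ennreal t * (\<integral>\<^sup>+x. u x \<partial>B) \<le> (\<integral>\<^sup>+x. u x \<partial>A)"
proof -
  have "scale_measure (ennreal t) B \<le> A"
    using sets le by (subst le_measure) auto
  then have "(\<integral>\<^sup>+x. u x \<partial>scale_measure (ennreal t) B) \<le> (\<integral>\<^sup>+x. u x \<partial>A)"
    by (intro nn_integral_mono_measure) (auto simp: sets)
  then show ?thesis
    using u by (simp add: nn_integral_scale_measure)
qed

text \<open>For compact K the functions exp (- n * dist(x, K)) have logarithmic Lipschitz constant n
  and decrease to the indicator of K; inner regularity then passes from compact sets to Borel
  sets.\<close>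

lemma setwise_le_of_log_lip:
  fixes A B :: "real measure"
  assumes A: "finite_measure A" "sets A = sets borel"
    and B: "finite_measure B" "sets B = sets borel"
    and le: "\<And>u a. 0 \<le> a \<Longrightarrow> log_lip a u \<Longrightarrow> u \<in> borel_measurable borel \<Longrightarrow> (\<And>x. u x \<le> 1) \<Longrightarrow>
       ennreal t * (\<integral>\<^sup>+x. u x \<partial>B) \<le> (\<integral>\<^sup>+x. u x \<partial>A)"
    and S: "S \<in> sets borel"
  shows "ennreal t * emeasure B S \<le> emeasure A S"
proof -
  interpret A: finite_measure A by fact
  interpret B: finite_measure B by fact
  have K: "ennreal t * emeasure B K \<le> emeasure A K" if "compact K" for K
  proof (cases "K = {}")
    case False
    define u where "u n x = ennreal (exp (- real n * infdist x K))" for n x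
    have cl: "closed K"
      using that by (rule compact_imp_closed)
    have u_borel [measurable]: "u n \<in> borel_measurable borel" for n
      unfolding u_def[abs_def]
      by (intro borel_measurable_continuous_onI continuous_intros measurable_compose[OF _ measurable_ennreal])
    have lip: "log_lip (real n) (u n)" for n
      unfolding log_lip_def u_def
    proof (intro ballI)
      fix x y :: real
      have "infdist y K \<le> infdist x K + dist y x"
        by (rule infdist_triangle)
      then have "real n * infdist y K \<le> real n * (infdist x K + norm (x - y))"
        by (intro mult_left_mono) (auto simp: dist_norm norm_minus_commute)
      then have "- real n * infdist x K \<le> real n * norm (x - y) + (- real n * infdist y K)"
        by (simp add: algebra_simps)
      then have "exp (- real n * infdist x K) \<le> exp (real n * norm (x - y) + (- real n * infdist y K))"
        by (simp only: exp_le_cancel_iff)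
      then show "ennreal (exp (- real n * infdist x K))
          \<le> ennreal (exp (real n * norm (x - y))) * ennreal (exp (- real n * infdist y K))"
        unfolding ennreal_mult[symmetric, OF exp_ge_zero exp_ge_zero] exp_add[symmetric]
        by (rule ennreal_leI)
    qed
    have dec: "decseq u"
    proof (rule decseq_SucI, rule le_funI)
      fix n x
      show "u (Suc n) x \<le> u n x"
        unfolding u_def by (intro ennreal_leI) (simp add: algebra_simps infdist_nonneg)
    qed
    have inf: "(INF n. u n x) = indicator K x" for x
    proof (rule LIMSEQ_unique)
      show "(\<lambda>n. u n x) \<longlonglongrightarrow> (INF n. u n x)"
        by (intro LIMSEQ_INF decseq_SucI le_funD[OF decseq_SucD[OF dec]])
      show "(\<lambda>n. u n x) \<longlonglongrightarrow> indicator K x"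
      proof (cases "x \<in> K")
        case True
        then show ?thesis
          by (simp add: u_def)
      next
        case x: False
        then have pos: "0 < infdist x K"
          using in_closed_iff_infdist_zero[OF cl False] infdist_nonneg[of x K] by force
        have "(\<lambda>n. exp (- infdist x K) ^ n) \<longlonglongrightarrow> 0"
          using pos by (intro LIMSEQ_realpow_zero) auto
        then have "(\<lambda>n. ennreal (exp (- real n * infdist x K))) \<longlonglongrightarrow> ennreal 0"
          by (intro tendsto_ennrealI) (simp add: mult.commute flip: exp_of_nat_mult)
        then show ?thesis
          using x by (simp add: u_def)
      qed
    qed
    have u1: "u n x \<le> 1" for n x
      by (simp add: u_def infdist_nonneg)
    have fin: "(\<integral>\<^sup>+x. u n x \<partial>N) < \<infinity>" if "finite_measure N" for n N
    proof -
      have "(\<integral>\<^sup>+x. u n x \<partial>N) \<le> (\<integral>\<^sup>+x. 1 \<partial>N)"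
        by (intro nn_integral_mono u1)
      also have "\<dots> < \<infinity>"
        using finite_measure.emeasure_finite[OF that, of "space N"] by (simp add: top.not_eq_extremum)
      finally show ?thesis .
    qed
    have lim: "(\<lambda>n. \<integral>\<^sup>+x. u n x \<partial>N) \<longlonglongrightarrow> emeasure N K"
      if N: "finite_measure N" "sets N = sets borel" for N
    proof -
      have [measurable]: "u n \<in> borel_measurable N" for n
        using u_borel N(2) by (simp cong: measurable_cong_sets)
      have "(\<integral>\<^sup>+x. (INF n. u n x) \<partial>N) = (INF n. \<integral>\<^sup>+x. u n x \<partial>N)"
        by (rule nn_integral_monotone_convergence_INF_decseq[OF dec, where i = 0])
          (use fin[OF N(1)] in auto)
      then have "emeasure N K = (INF n. \<integral>\<^sup>+x. u n x \<partial>N)"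
        using N(2) cl by (simp add: inf)
      moreover have "decseq (\<lambda>n. \<integral>\<^sup>+x. u n x \<partial>N)"
        by (intro decseq_SucI nn_integral_mono le_funD[OF decseq_SucD[OF dec]])
      ultimately show ?thesis
        using LIMSEQ_INF by metis
    qed
    have "(\<lambda>n. ennreal t * (\<integral>\<^sup>+x. u n x \<partial>B)) \<longlonglongrightarrow> ennreal t * emeasure B K"
      using lim[OF B] by (intro tendsto_mult_ennreal tendsto_const) (auto simp: B.emeasure_finite)
    then show ?thesis
      by (rule LIMSEQ_le[OF _ lim[OF A]]) (use le[OF of_nat_0_le_iff lip u_borel u1] in auto)
  qed simp
  have "emeasure B S = (SUP K\<in>{K. K \<subseteq> S \<and> compact K}. emeasure B K)"
    using B S by (intro inner_regular) auto
  then have "ennreal t * emeasure B S = (SUP K\<in>{K. K \<subseteq> S \<and> compact K}. ennreal t * emeasure B K)"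
    by (simp add: SUP_mult_left_ennreal)
  also have "\<dots> \<le> emeasure A S"
    using A(2) S by (intro SUP_least) (auto intro: order_trans[OF K emeasure_mono])
  finally show ?thesis .
qed

text \<open>
  Iterating the transfer operator drives the logarithmic Lipschitz constant of any test function
  below \<open>3 / 4 * s + 1\<close>, whence a constant \<open>C\<close> that does not depend on the test function.
\<close>

lemma conformal_comparison:
  assumes A: "finite_measure A" "sets A = sets borel" "AE x in A. \<bar>x\<bar> \<le> 1" "conformal s e A"
    and B: "finite_measure B" "sets B = sets borel" "AE x in B. \<bar>x\<bar> \<le> 1" "conformal s e B"
    and s: "0 \<le> s" and e: "\<bar>e\<bar> = 1" and t: "0 \<le> t"
    and le: "\<And>S. S \<in> sets borel \<Longrightarrow> ennreal t * emeasure B S \<le> emeasure A S"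
    and S: "S \<in> sets borel"
    and C: "C = exp (2 * (3 / 4 * s + 1))"
  shows "ennreal (t + (measure A UNIV - t * measure B UNIV) / (C * measure B UNIV)) * emeasure B S
    \<le> emeasure A S"
proof (cases "measure B UNIV = 0")
  case True
  then show ?thesis
    using le[OF S] by simp
next
  case False
  interpret A: finite_measure A by fact
  interpret B: finite_measure B by fact
  have Bpos: "0 < measure B UNIV"
    using False by (simp add: less_le)
  have Cpos: "0 < C"
    by (simp add: C)
  have spA: "space A = UNIV" and spB: "space B = UNIV"
    using A(2) B(2) by (auto dest: sets_eq_imp_space_eq)
  have tBA: "t * measure B UNIV \<le> measure A UNIV"
    using le[of UNIV] t by (simp add: A.emeasure_eq_measure B.emeasure_eq_measure flip: ennreal_mult)
  let ?d = "(measure A UNIV - t * measure B UNIV) / (C * measure B UNIV)"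
  show ?thesis
  proof (rule setwise_le_of_log_lip[OF A(1,2) B(1,2) _ S])
    fix u :: "real \<Rightarrow> ennreal" and a :: real
    assume a: "0 \<le> a" and lip: "log_lip a u" and u [measurable]: "u \<in> borel_measurable borel"
      and u1: "\<And>x. u x \<le> 1"
    have "(\<lambda>n. (1 / 9) ^ n * a) \<longlonglongrightarrow> 0 * a"
      by (intro tendsto_mult tendsto_const LIMSEQ_realpow_zero) auto
    then have "eventually (\<lambda>n. (1 / 9) ^ n * a < 1) sequentially"
      by (rule order_tendstoD) simp
    then obtain n where "(1 / 9) ^ n * a < 1"
      by (auto simp: eventually_sequentially)
    then have n: "a / 9 ^ n \<le> 1"
      by (simp add: power_one_over field_simps)
    define v where "v = (transfer s e ^^ n) u"
    have v [measurable]: "v \<in> borel_measurable borel"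
      unfolding v_def by (rule transfer_pow_borel[OF u])
    have vA [measurable]: "v \<in> borel_measurable A" and vB [measurable]: "v \<in> borel_measurable B"
      using v A(2) B(2) by (simp_all cong: measurable_cong_sets)
    have "log_lip (3 / 4 * s + 1) v"
      unfolding v_def using n e by (intro log_lip_mono[OF transfer_pow_log_lip[OF _ s a lip]]) auto
    then have vC: "v x \<le> ennreal C * v y" if "\<bar>x\<bar> \<le> 1" "\<bar>y\<bar> \<le> 1" for x y
    proof -
      have "v x \<le> ennreal (exp ((3 / 4 * s + 1) * norm (x - y))) * v y"
        using that \<open>log_lip _ v\<close> by (intro log_lipD) auto
      also have "\<dots> \<le> ennreal C * v y"
      proof (intro mult_right_mono ennreal_leI)
        have "(3 / 4 * s + 1) * norm (x - y) \<le> (3 / 4 * s + 1) * 2"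
          using that s by (intro mult_left_mono) auto
        then show "exp ((3 / 4 * s + 1) * norm (x - y)) \<le> C"
          by (simp add: C mult.commute)
      qed simp
      finally show ?thesis .
    qed
    \<comment> \<open>On the ball v varies by at most the factor C (2 is the diameter of the ball).
      The constant part m sees only the total masses, where A exceeds t * B by a known amount; the
      remainder v - m is estimated by the given inequality with factor t.\<close>
    define m where "m = (INF x\<in>{-1..1}. v x)"
    have mle: "m \<le> v x" if "\<bar>x\<bar> \<le> 1" for x
      unfolding m_def using that by (intro INF_lower) auto
    have vm: "v x \<le> ennreal C * m" if "\<bar>x\<bar> \<le> 1" for x
    proof -
      have "v x / ennreal C \<le> m"
        unfolding m_def using Cpos vC[OF that]
        by (intro INF_greatest divide_le_posI_ennreal) (auto simp: mult.commute)
      then have "ennreal C * (v x / ennreal C) \<le> ennreal C * m"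
        by (rule mult_left_mono) simp
      moreover have "ennreal C * (v x / ennreal C) = v x"
        using Cpos by (subst ennreal_times_divide, subst mult.commute) (simp add: ennreal_mult_divide_eq)
      ultimately show ?thesis
        by simp
    qed
    have JA: "(\<integral>\<^sup>+x. u x \<partial>A) = (\<integral>\<^sup>+x. v x \<partial>A)" and JB: "(\<integral>\<^sup>+x. u x \<partial>B) = (\<integral>\<^sup>+x. v x \<partial>B)"
      unfolding v_def by (intro conformal_pow A B u)+
    define I where "I = (\<integral>\<^sup>+x. v x - m \<partial>B)"
    have split: "(\<integral>\<^sup>+x. v x \<partial>N) = m * emeasure N UNIV + (\<integral>\<^sup>+x. v x - m \<partial>N)"
      if N: "sets N = sets borel" "AE x in N. \<bar>x\<bar> \<le> 1" for N
    proof -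
      have [measurable]: "v \<in> borel_measurable N"
        using v N(1) by (simp cong: measurable_cong_sets)
      have "space N = UNIV"
        using N(1) by (auto dest: sets_eq_imp_space_eq)
      have "(\<integral>\<^sup>+x. v x \<partial>N) = (\<integral>\<^sup>+x. m + (v x - m) \<partial>N)"
        using N(2) by (intro nn_integral_cong_AE) (auto simp: add_diff_inverse_ennreal mle)
      also have "\<dots> = m * emeasure N UNIV + (\<integral>\<^sup>+x. v x - m \<partial>N)"
        using \<open>space N = UNIV\<close> by (subst nn_integral_add) auto
      finally show ?thesis .
    qed
    have "(\<integral>\<^sup>+x. u x \<partial>B) \<le> (\<integral>\<^sup>+x. 1 \<partial>B)"
      by (intro nn_integral_mono u1)
    also have "\<dots> < \<infinity>"
      by (simp add: spB B.emeasure_eq_measure)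
    finally have Bfin: "(\<integral>\<^sup>+x. v x \<partial>B) < \<infinity>"
      by (simp add: JB)
    then have "m * emeasure B UNIV < \<infinity>" and Ifin: "I < \<infinity>"
      unfolding split[OF B(2,3)] I_def[symmetric] by (auto simp: less_top)
    then have "m \<noteq> \<infinity>"
      using Bpos by (auto simp: B.emeasure_eq_measure ennreal_top_mult split: if_splits)
    then obtain m' where m': "m = ennreal m'" "0 \<le> m'"
      by (cases m) auto
    obtain I' where I': "I = ennreal I'" "0 \<le> I'"
      using Ifin by (cases I) auto
    have "(\<integral>\<^sup>+x. v x \<partial>B) \<le> (\<integral>\<^sup>+x. ennreal C * m \<partial>B)"
      using B(3) by (intro nn_integral_mono_AE) (auto dest: vm)
    then have "m * emeasure B UNIV + I \<le> ennreal C * m * emeasure B UNIV"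
      by (simp add: split[OF B(2,3)] I_def spB)
    then have J: "m' * measure B UNIV + I' \<le> C * m' * measure B UNIV"
      using m' I' Cpos by (simp add: B.emeasure_eq_measure flip: ennreal_mult ennreal_plus)
    have "ennreal t * I \<le> (\<integral>\<^sup>+x. v x - m \<partial>A)"
      unfolding I_def by (rule nn_integral_mono_setwise) (use A(2) B(2) le in auto)
    then have "m * emeasure A UNIV + ennreal t * I \<le> (\<integral>\<^sup>+x. v x \<partial>A)"
      unfolding split[OF A(2,3)] by (rule add_left_mono)
    moreover have "ennreal (t + ?d) * (m * emeasure B UNIV + I) \<le> m * emeasure A UNIV + ennreal t * I"
    proof -
      \<comment> \<open>The increment \<open>?d\<close> is chosen so that
        \<open>?d * C * m' * measure B UNIV\<close> is exactly the surplus m' * (mass A - t * mass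
        B) gained on the constant part.\<close>
      have "?d * (m' * measure B UNIV + I') \<le> ?d * (C * m' * measure B UNIV)"
        using tBA Cpos Bpos by (intro mult_left_mono J) auto
      also have "\<dots> = m' * (measure A UNIV - t * measure B UNIV)"
        using Cpos Bpos by (simp add: field_simps)
      finally have "(t + ?d) * (m' * measure B UNIV + I') \<le> m' * measure A UNIV + t * I'"
        by (simp add: algebra_simps)
      then show ?thesis
        using m' I' t tBA Cpos Bpos
        by (simp add: A.emeasure_eq_measure B.emeasure_eq_measure flip: ennreal_mult ennreal_plus)
    qed
    ultimately show "ennreal (t + ?d) * (\<integral>\<^sup>+x. u x \<partial>B) \<le> (\<integral>\<^sup>+x. u x \<partial>A)"
      unfolding JA JB using split[OF B(2,3)] by (auto simp: I_def)
  qed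
qed

text \<open>For equal masses one comparison replaces the deficit 1 - t by (1 - 1 / C) * (1 - t). As
  C does not depend on t, iteration from t = 0 drives t to 1.\<close>

lemma conformal_le:
  assumes A: "finite_measure A" "sets A = sets borel" "AE x in A. \<bar>x\<bar> \<le> 1" "conformal s e A"
    and B: "finite_measure B" "sets B = sets borel" "AE x in B. \<bar>x\<bar> \<le> 1" "conformal s e B"
    and s: "0 \<le> s" and e: "\<bar>e\<bar> = 1"
    and mass: "measure A UNIV = measure B UNIV" and S: "S \<in> sets borel"
  shows "emeasure B S \<le> emeasure A S"
proof (cases "measure B UNIV = 0")
  case True
  interpret B: finite_measure B by fact
  have "emeasure B S \<le> emeasure B UNIV"
    using B(2) by (intro emeasure_mono) auto
  then show ?thesis
    using True by (simp add: B.emeasure_eq_measure)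
next
  case False
  interpret A: finite_measure A by fact
  interpret B: finite_measure B by fact
  define C where "C = exp (2 * (3 / 4 * s + 1))"
  define q where "q = 1 - 1 / C"
  have C: "1 < C"
    using s by (simp add: C_def)
  then have q: "0 \<le> q" "q < 1"
    by (simp_all add: q_def)
  have "ennreal (1 - q ^ n) * emeasure B S \<le> emeasure A S" if "S \<in> sets borel" for n S
    using that
  proof (induction n arbitrary: S)
    case (Suc n)
    have "q ^ n \<le> 1"
      using q by (intro power_le_one) auto
    then have "ennreal (1 - q ^ n + (measure A UNIV - (1 - q ^ n) * measure B UNIV) / (C * measure B UNIV))
        * emeasure B S \<le> emeasure A S"
      by (intro conformal_comparison[OF A B s e _ Suc.IH Suc.prems C_def]) auto
    moreover have "1 - q ^ n + (measure A UNIV - (1 - q ^ n) * measure B UNIV) / (C * measure B UNIV)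
        = 1 - q ^ Suc n"
      using False C by (simp add: mass q_def field_simps)
    ultimately show ?case
      by simp
  qed simp
  then have le: "ennreal (1 - q ^ n) * emeasure B S \<le> emeasure A S" for n
    using S by blast
  have "(\<lambda>n. ennreal (1 - q ^ n) * emeasure B S) \<longlonglongrightarrow> ennreal (1 - 0) * emeasure B S"
    using q by (intro tendsto_mult_ennreal tendsto_ennrealI tendsto_intros LIMSEQ_realpow_zero) auto
  then show ?thesis
    using le by (intro LIMSEQ_le_const2[of _ "emeasure B S"]) auto
qed

lemma conformal_unique:
  assumes A: "finite_measure A" "sets A = sets borel" "AE x in A. \<bar>x\<bar> \<le> 1" "conformal s e A"
    and B: "finite_measure B" "sets B = sets borel" "AE x in B. \<bar>x\<bar> \<le> 1" "conformal s e B"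
    and s: "0 \<le> s" and e: "\<bar>e\<bar> = 1"
    and mass: "measure A UNIV = measure B UNIV"
  shows "A = B"
  using A(2) B(2) conformal_le[OF A B s e mass] conformal_le[OF B A s e mass[symmetric]]
  by (intro measure_eqI antisym) auto

lemma conformal_ergodic:
  assumes M: "finite_measure M" "sets M = sets borel" "AE x in M. \<bar>x\<bar> \<le> 1" "conformal s e M"
    and s: "0 \<le> s" and e: "\<bar>e\<bar> = 1" and E: "E \<in> sets borel"
    and inv: "AE x in M. \<forall>k\<in>digits. e / (of_int k + x) \<in> E \<longleftrightarrow> x \<in> E"
  shows "emeasure M E = 0 \<or> emeasure M (- E) = 0"
proof (cases "measure M UNIV = 0")
  case True
  interpret finite_measure M by fact
  have "emeasure M E \<le> emeasure M UNIV"
    using M(2) by (intro emeasure_mono) auto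
  then show ?thesis
    using True by (simp add: emeasure_eq_measure)
next
  case False
  interpret finite_measure M by fact
  have sp: "space M = UNIV"
    using M(2) by (auto dest: sets_eq_imp_space_eq)
  have [measurable]: "E \<in> sets M"
    using E M(2) by simp
  have borel: "u \<in> borel_measurable M" if "u \<in> borel_measurable borel" for u :: "real \<Rightarrow> ennreal"
    using that M(2) by (simp cong: measurable_cong_sets)
  define A where "A = density M (indicator E)"
  have mass: "emeasure A UNIV = emeasure M E"
    unfolding A_def using M(2) by (subst emeasure_density) auto
  have A: "finite_measure A" "sets A = sets borel" "AE x in A. \<bar>x\<bar> \<le> 1"
  proof -
    have "emeasure A (space A) = emeasure M E"
      using mass by (simp add: A_def sp)
    then show "finite_measure A"
      by (intro finite_measureI) simp
    show "sets A = sets borel"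
      by (simp add: A_def M(2))
    show "AE x in A. \<bar>x\<bar> \<le> 1"
      unfolding A_def using M(3) by (subst AE_density) auto
  qed
  have cA: "conformal s e A"
    unfolding conformal_def
  proof
    fix u :: "real \<Rightarrow> ennreal" assume u: "u \<in> borel_measurable borel"
    have "(\<integral>\<^sup>+x. u x \<partial>A) = (\<integral>\<^sup>+x. indicator E x * u x \<partial>M)"
      unfolding A_def by (rule nn_integral_density) (auto intro: borel u)
    also have "\<dots> = (\<integral>\<^sup>+x. transfer s e (\<lambda>x. indicator E x * u x) x \<partial>M)"
      by (rule conformalD[OF M(4)]) (use u E in measurable)
    also have "\<dots> = (\<integral>\<^sup>+x. indicator E x * transfer s e u x \<partial>M)"
    proof (rule nn_integral_cong_AE, use inv in eventually_elim)
      fix x assume x: "\<forall>k\<in>digits. e / (of_int k + x) \<in> E \<longleftrightarrow> x \<in> E"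
      \<comment> \<open>By invariance, membership in E can be read at the base point x instead of
        its image under the branch, so the indicator is a constant factor of the sum over the
        digits.\<close>
      have "transfer s e (\<lambda>x. indicator E x * u x) x = transfer s e (\<lambda>y. indicator E x * u y) x"
        unfolding transfer_def using x by (intro nn_integral_cong) (auto simp: indicator_def)
      then show "transfer s e (\<lambda>x. indicator E x * u x) x = indicator E x * transfer s e u x"
        by (simp add: transfer_cmult)
    qed
    also have "\<dots> = (\<integral>\<^sup>+x. transfer s e u x \<partial>A)"
      unfolding A_def by (rule nn_integral_density[symmetric]) (auto intro: borel transfer_borel u)
    finally show "(\<integral>\<^sup>+x. u x \<partial>A) = (\<integral>\<^sup>+x. transfer s e u x \<partial>A)" .
  qed
  \<comment> \<open>Starting at t = 0 suffices: a multiple of the mass of \<open>- E\<close> is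
    bounded by the mass that A gives to \<open>- E\<close>, which is 0, and the multiple is positive
    unless E is null.\<close>
  have "ennreal (0 + (measure A UNIV - 0 * measure M UNIV) / (exp (2 * (3 / 4 * s + 1)) * measure M UNIV))
      * emeasure M (- E) \<le> emeasure A (- E)"
    using E by (intro conformal_comparison[OF A cA M s e]) auto
  also have "emeasure A (- E) = 0"
  proof -
    have "emeasure A (- E) = (\<integral>\<^sup>+x. indicator E x * indicator (- E) x \<partial>M)"
      unfolding A_def using E M(2) by (intro emeasure_density) auto
    also have "\<dots> = (\<integral>\<^sup>+x. 0 \<partial>M)"
      by (intro nn_integral_cong) (auto simp: indicator_def)
    finally show ?thesis
      by simp
  qed
  finally have "measure A UNIV = 0 \<or> emeasure M (- E) = 0"
    using False by (auto simp: less_le)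
  then show ?thesis
    using mass finite_measure.emeasure_eq_measure[OF A(1), of UNIV] by auto
qed

section \<open>The group and its limit set\<close>

definition mat2 :: "real \<Rightarrow> real \<Rightarrow> real \<Rightarrow> real \<Rightarrow> real^2^2" where
  "mat2 a b c d = vector [vector [a, b], vector [c, d]]"

lemma mat2_nth [simp]:
  "mat2 a b c d $ 1 $ 1 = a" "mat2 a b c d $ 1 $ 2 = b"
  "mat2 a b c d $ 2 $ 1 = c" "mat2 a b c d $ 2 $ 2 = d"
  by (simp_all add: mat2_def)

lemma matrix2_eq_iff:
  fixes A B :: "real^2^2"
  shows "A = B \<longleftrightarrow> A$1$1 = B$1$1 \<and> A$1$2 = B$1$2 \<and> A$2$1 = B$2$1 \<and> A$2$2 = B$2$2"
  by (auto simp: vec_eq_iff forall_2)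

lemma matrix2_mult_nth:
  fixes A B :: "real^2^2"
  shows "(A ** B) $ i $ j = A $ i $ 1 * B $ 1 $ j + A $ i $ 2 * B $ 2 $ j"
  by (simp add: matrix_matrix_mult_def sum_2)

lemma mat1_nth [simp]:
  "(mat 1 :: real^2^2) $ 1 $ 1 = 1" "(mat 1 :: real^2^2) $ 1 $ 2 = 0"
  "(mat 1 :: real^2^2) $ 2 $ 1 = 0" "(mat 1 :: real^2^2) $ 2 $ 2 = 1"
  by (simp_all add: mat_def)

lemma matrix2_mult_minus [simp]:
  fixes A B :: "real^2^2"
  shows "(- A) ** B = - (A ** B)" "A ** (- B) = - (A ** B)"
  by (simp_all add: matrix2_eq_iff matrix2_mult_nth)

lemma det_minus_matrix2 [simp]: "det (- A :: real^2^2) = det A"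
  by (simp add: det_2)

definition shear :: "real \<Rightarrow> real^2^2" where
  "shear t = mat2 1 t 0 1"

definition inversion :: "real^2^2" where
  "inversion = mat2 0 1 (-1) 0"

lemma det_shear [simp]: "det (shear t) = 1" and det_inversion [simp]: "det inversion = 1"
  by (simp_all add: det_2 shear_def inversion_def)

lemma shear_0 [simp]: "shear 0 = mat 1"
  by (simp add: matrix2_eq_iff shear_def)

lemma shear_mult: "shear s ** shear t = shear (s + t)"
  by (simp add: matrix2_eq_iff matrix2_mult_nth shear_def)

lemma shear_shear_mult: "shear s ** (shear t ** A) = shear (s + t) ** A"
  by (simp add: matrix_mul_assoc shear_mult)

lemma inversion_inversion: "inversion ** inversion = - mat 1"
  by (simp add: matrix2_eq_iff matrix2_mult_nth inversion_def)

lemma inversion_inversion_mult: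
  fixes A :: "real^2^2"
  shows "inversion ** (inversion ** A) = - A"
  by (simp add: matrix_mul_assoc inversion_inversion)

lemma psl_eq: "psl A = {A, - A}"
  by (auto simp: psl_def r_coset_def SL2R_def)

lemma psl_minus [simp]: "psl (- A) = psl A"
  by (auto simp: psl_eq)

lemma one_PSL2R: "\<one>\<^bsub>PSL2R\<^esub> = psl (mat 1)"
  by (simp add: PSL2R_def psl_eq)

lemma mult_PSL2R: "psl A \<otimes>\<^bsub>PSL2R\<^esub> psl B = psl (A ** B)"
  by (auto simp: PSL2R_def psl_eq set_mult_def SL2R_def)

lemma psl_in_carrier: "det A = 1 \<Longrightarrow> psl A \<in> carrier PSL2R"
  by (auto simp: PSL2R_def FactGroup_def RCOSETS_def psl_def SL2R_def)

lemma carrier_PSL2R_E: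
  assumes "g \<in> carrier PSL2R"
  obtains A where "det A = 1" "g = psl A"
  using assms by (auto simp: PSL2R_def FactGroup_def RCOSETS_def psl_def SL2R_def)

lemma inv_PSL2R:
  assumes "det A = 1" "det B = 1" "A ** B = mat 1" "B ** A = mat 1"
  shows "inv\<^bsub>PSL2R\<^esub> (psl A) = psl B"
  unfolding m_inv_def
proof (rule the_equality)
  show "psl B \<in> carrier PSL2R \<and> psl A \<otimes>\<^bsub>PSL2R\<^esub> psl B = \<one>\<^bsub>PSL2R\<^esub> \<and> psl B \<otimes>\<^bsub>PSL2R\<^esub> psl A = \<one>\<^bsub>PSL2R\<^esub>"
    by (simp add: assms psl_in_carrier mult_PSL2R one_PSL2R)
next
  fix y assume y: "y \<in> carrier PSL2R \<and> psl A \<otimes>\<^bsub>PSL2R\<^esub> y = \<one>\<^bsub>PSL2R\<^esub> \<and> y \<otimes>\<^bsub>PSL2R\<^esub> psl A = \<one>\<^bsub>PSL2R\<^esub>"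
  then obtain C where C: "y = psl C"
    by (blast elim: carrier_PSL2R_E)
  then have "psl (A ** C) = psl (mat 1)"
    using y by (simp add: mult_PSL2R one_PSL2R)
  then have "A ** C = mat 1 \<or> A ** C = - mat 1"
    by (auto simp: psl_eq doubleton_eq_iff)
  then have "B ** (A ** C) = B \<or> B ** (A ** C) = - B"
    by auto
  then have "C = B \<or> C = - B"
    by (simp add: matrix_mul_assoc assms)
  then show "y = psl B"
    using C by auto
qed

text \<open>Words grow by left multiplication, so an induction sees the map applied last. The
  inversion is its own inverse up to sign, hence these words are closed under inverses modulo
  sign.\<close>

inductive_set Gamma_mat :: "(real^2^2) set" where
  one: "mat 1 \<in> Gamma_mat"
| shear: "A \<in> Gamma_mat \<Longrightarrow> t \<in> {4, -4} \<Longrightarrow> shear t ** A \<in> Gamma_mat"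
| inversion: "A \<in> Gamma_mat \<Longrightarrow> inversion ** A \<in> Gamma_mat"

lemma det_Gamma_mat: "A \<in> Gamma_mat \<Longrightarrow> det A = 1"
  by (induction rule: Gamma_mat.induct) (auto simp: det_mul)

lemma Gamma_mat_mult: "A \<in> Gamma_mat \<Longrightarrow> B \<in> Gamma_mat \<Longrightarrow> A ** B \<in> Gamma_mat"
  by (induction rule: Gamma_mat.induct)
    (auto intro: Gamma_mat.intros simp flip: matrix_mul_assoc)

lemma Gamma_hat_eq: "Gamma_hat = psl ` Gamma_mat"
proof (intro equalityI subsetI)
  have gens: "{psl (vector [vector [1, 4], vector [0, 1]]), psl (vector [vector [0, 1], vector [-1, 0]])}
      = {psl (shear 4), psl inversion}"
    by (simp add: shear_def inversion_def mat2_def)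
  have mem: "shear t \<in> Gamma_mat" if "t \<in> {4, -4}" for t
    using Gamma_mat.shear[OF Gamma_mat.one that] by simp
  have memi: "inversion \<in> Gamma_mat"
    using Gamma_mat.inversion[OF Gamma_mat.one] by simp
  have inv1: "inv\<^bsub>PSL2R\<^esub> (psl (shear 4)) = psl (shear (-4))"
    by (rule inv_PSL2R) (simp_all add: shear_mult)
  have inv2: "inv\<^bsub>PSL2R\<^esub> (psl inversion) = psl (- inversion)"
    by (rule inv_PSL2R) (simp_all add: inversion_inversion)
  fix g
  {
    assume "g \<in> Gamma_hat"
    then show "g \<in> psl ` Gamma_mat"
      unfolding Gamma_hat_def gens
    proof (induction rule: generate.induct)
      case one
      then show ?case
        by (auto simp: one_PSL2R intro: Gamma_mat.one)
    next
      case (incl h)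
      then show ?case
        using mem memi by auto
    next
      case (inv h)
      then show ?case
        using mem memi inv1 inv2 by auto
    next
      case (eng g h)
      then show ?case
        by (auto simp: mult_PSL2R intro: Gamma_mat_mult)
    qed
  next
    assume "g \<in> psl ` Gamma_mat"
    then obtain A where A: "A \<in> Gamma_mat" "g = psl A"
      by auto
    let ?H = "generate PSL2R {psl (shear 4), psl inversion}"
    have "psl A \<in> ?H"
      using A(1)
    proof (induction rule: Gamma_mat.induct)
      case one
      then show ?case
        using generate.one[of PSL2R] by (simp add: one_PSL2R)
    next
      case (shear A t)
      have "psl (shear t) \<in> ?H"
        using shear(2) generate.incl[of "psl (shear 4)" "{psl (shear 4), psl inversion}" PSL2R]
          generate.inv[of "psl (shear 4)" "{psl (shear 4), psl inversion}" PSL2R]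
        by (auto simp: inv1)
      from generate.eng[OF this shear.IH] show ?case
        by (simp add: mult_PSL2R)
    next
      case (inversion A)
      have "psl inversion \<in> ?H"
        by (rule generate.incl) simp
      from generate.eng[OF this inversion.IH] show ?case
        by (simp add: mult_PSL2R)
    qed
    then show "g \<in> Gamma_hat"
      by (simp add: Gamma_hat_def gens A(2))
  }
qed

section \<open>The Moebius action and the orbit of i\<close>

lemma moebius_minus: "moebius (- A) z = moebius A z"
proof -
  have "moebius (- A) z = (- (of_real (A$1$1) * z + of_real (A$1$2))) / (- (of_real (A$2$1) * z + of_real (A$2$2)))"
    by (simp add: moebius_def)
  also have "\<dots> = moebius A z"
    unfolding minus_divide_divide moebius_def ..
  finally show ?thesis .
qed

lemma moebius_boundary_minus: "moebius_boundary (- A) \<xi> = moebius_boundary A \<xi>"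
proof (cases \<xi>)
  case (Some x)
  have "(- (A$1$1 * x + A$1$2)) / (- (A$2$1 * x + A$2$2)) = (A$1$1 * x + A$1$2) / (A$2$1 * x + A$2$2)"
    by (rule minus_divide_divide)
  moreover have "- (A$2$1 * x) - A$2$2 = 0 \<longleftrightarrow> A$2$1 * x + A$2$2 = 0"
    by linarith
  ultimately show ?thesis
    using Some by simp
qed simp

lemma psl_act_psl [simp]: "psl_act (psl A) z = moebius A z"
  by (auto simp: psl_act_def psl_eq moebius_minus)

lemma psl_act_boundary_psl: "psl_act_boundary (psl A) = moebius_boundary A"
  by (auto simp: psl_act_boundary_def psl_eq moebius_boundary_minus)

lemma moebius_denom_nz:
  fixes A :: "real^2^2"
  assumes "det A = 1" "z \<in> UHP"
  shows "of_real (A$2$1) * z + of_real (A$2$2) \<noteq> 0"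
proof
  assume 0: "of_real (A$2$1) * z + of_real (A$2$2) = 0"
  then have "Im (of_real (A$2$1) * z + of_real (A$2$2)) = 0" "Re (of_real (A$2$1) * z + of_real (A$2$2)) = 0"
    by simp_all
  then have "A$2$1 = 0" "A$2$2 = 0"
    using assms(2) by (auto simp: UHP_def)
  then show False
    using assms(1) by (simp add: det_2)
qed

lemma moebius_mult:
  assumes "det B = 1" "z \<in> UHP"
  shows "moebius (A ** B) z = moebius A (moebius B z)"
proof -
  let ?d = "of_real (B$2$1) * z + of_real (B$2$2)" and ?n = "of_real (B$1$1) * z + of_real (B$1$2) :: complex"
  have d: "?d \<noteq> 0"
    using moebius_denom_nz[OF assms] .
  have frac: "a * (n / ?d) + b = (a * n + b * ?d) / ?d" for a b n
    using d by (simp add: field_simps)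
  have "moebius A (moebius B z) = (of_real (A$1$1) * (?n / ?d) + of_real (A$1$2)) / (of_real (A$2$1) * (?n / ?d) + of_real (A$2$2))"
    by (simp add: moebius_def)
  also have "\<dots> = ((of_real (A$1$1) * ?n + of_real (A$1$2) * ?d) / ?d) / ((of_real (A$2$1) * ?n + of_real (A$2$2) * ?d) / ?d)"
    by (simp only: frac)
  also have "\<dots> = (of_real (A$1$1) * ?n + of_real (A$1$2) * ?d) / (of_real (A$2$1) * ?n + of_real (A$2$2) * ?d)"
    using d by simp
  also have "\<dots> = moebius (A ** B) z"
    by (simp add: moebius_def matrix2_mult_nth algebra_simps)
  finally show ?thesis ..
qed

lemma moebius_shear: "moebius (shear t) z = z + of_real t"
  by (simp add: moebius_def shear_def)

lemma moebius_inversion: "moebius inversion z = - 1 / z"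
  by (simp add: moebius_def inversion_def)

lemma moebius_mat_1: "moebius (mat 1) z = z"
  by (simp add: moebius_def)

lemma \<i>_in_UHP [simp]: "\<i> \<in> UHP"
  by (simp add: UHP_def)

lemma Im_neg_inverse: "Im (- 1 / z) = Im z / (cmod z)\<^sup>2"
  by (simp add: Im_divide cmod_power2)

lemma moebius_Gamma_mat_UHP:
  assumes "A \<in> Gamma_mat"
  shows "moebius A \<i> \<in> UHP"
  using assms
proof (induction rule: Gamma_mat.induct)
  case one
  then show ?case
    by (simp add: moebius_mat_1)
next
  case (shear A t)
  then show ?case
    using det_Gamma_mat[OF shear(1)] by (auto simp: moebius_mult moebius_shear UHP_def)
next
  case (inversion A)
  then show ?case
    using det_Gamma_mat[OF inversion(1)] Im_neg_inverse[of "moebius A \<i>"]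
    by (cases "moebius A \<i> = 0") (auto simp: moebius_mult moebius_inversion UHP_def)
qed

definition orbit :: "complex set" where
  "orbit = (\<lambda>A. moebius A \<i>) ` Gamma_mat"

lemma orbit_UHP: "z \<in> orbit \<Longrightarrow> 0 < Im z"
  using moebius_Gamma_mat_UHP by (auto simp: orbit_def UHP_def)

lemma orbit_i: "\<i> \<in> orbit"
  by (auto simp: orbit_def moebius_mat_1 intro!: image_eqI[OF _ Gamma_mat.one])

lemma orbit_shift:
  assumes "z \<in> orbit" "t \<in> {4, -4}"
  shows "z + of_real t \<in> orbit"
proof -
  obtain A where A: "A \<in> Gamma_mat" "z = moebius A \<i>"
    using assms by (auto simp: orbit_def)
  then have "z + of_real t = moebius (shear t ** A) \<i>"
    using det_Gamma_mat[OF A(1)] by (simp add: moebius_mult moebius_shear)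
  then show ?thesis
    using Gamma_mat.shear[OF A(1) assms(2)] by (auto simp: orbit_def)
qed

lemma orbit_inversion:
  assumes "z \<in> orbit"
  shows "- 1 / z \<in> orbit"
proof -
  obtain A where A: "A \<in> Gamma_mat" "z = moebius A \<i>"
    using assms by (auto simp: orbit_def)
  then have "- 1 / z = moebius (inversion ** A) \<i>"
    using det_Gamma_mat[OF A(1)] by (simp add: moebius_mult moebius_inversion)
  then show ?thesis
    using Gamma_mat.inversion[OF A(1)] by (auto simp: orbit_def)
qed

text \<open>The reflection z -> - cnj z fixes i, turns translation by t into translation by -t and
  commutes with z -> -1 / z. It is the source of the symmetry of the limit set under x -> - x,
  without which the Gauss branches would not preserve it.\<close>

lemma orbit_reflect:
  assumes "z \<in> orbit"
  shows "- cnj z \<in> orbit"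
proof -
  have "- cnj (moebius A \<i>) \<in> orbit" if "A \<in> Gamma_mat" for A
    using that
  proof (induction rule: Gamma_mat.induct)
    case one
    then show ?case
      by (simp add: moebius_mat_1 orbit_i)
  next
    case (shear A t)
    then have "- cnj (moebius A \<i>) + of_real (- t) \<in> orbit"
      by (intro orbit_shift) auto
    then show ?case
      using det_Gamma_mat[OF shear(1)] by (simp add: moebius_mult moebius_shear)
  next
    case (inversion A)
    then have "- 1 / (- cnj (moebius A \<i>)) \<in> orbit"
      by (intro orbit_inversion)
    then show ?case
      using det_Gamma_mat[OF inversion(1)] by (simp add: moebius_mult moebius_inversion)
  qed
  then show ?thesis
    using assms by (auto simp: orbit_def)
qed

text \<open>Compositions of n branches z -> -1 / (k + z) with nonzero digits. The innermost factor
  is the identity or the inversion, the two elements that fix i.\<close>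

fun reduced_mat :: "nat \<Rightarrow> (real^2^2) set" where
  "reduced_mat 0 = {mat 1, inversion}"
| "reduced_mat (Suc n) =
     (\<lambda>(k, A). inversion ** (shear (of_int k) ** A)) ` (digits \<times> reduced_mat n)"

text \<open>The shape survives left multiplication by a generator: a translation is absorbed into k;
  an inversion opens a new digit if k is nonzero, and otherwise cancels the leading inversion of the
  reduced word.\<close>

lemma Gamma_mat_normal_form:
  assumes "A \<in> Gamma_mat"
  shows "\<exists>k n B. 4 dvd (k::int) \<and> B \<in> reduced_mat n \<and> psl A = psl (shear (of_int k) ** B)"
  using assms
proof (induction rule: Gamma_mat.induct)
  case one
  have "psl (mat 1) = psl (shear (of_int 0) ** mat 1)"
    by simp
  then show ?case
    by (intro exI[of _ 0] exI[of _ "mat 1"]) auto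
next
  case (shear A t)
  then obtain k n B where k: "4 dvd (k::int)" and B: "B \<in> reduced_mat n" and eq: "psl A = psl (shear (of_int k) ** B)"
    by blast
  obtain j :: int where j: "t = of_int j" "4 dvd j"
    using shear(2) by (auto intro: that[of 4] that[of "-4"])
  have "psl (shear t ** A) = psl (shear t) \<otimes>\<^bsub>PSL2R\<^esub> psl A"
    by (simp add: mult_PSL2R)
  also have "\<dots> = psl (shear (of_int (j + k)) ** B)"
    by (simp add: eq mult_PSL2R shear_shear_mult j)
  finally show ?case
    using k B j(2) by (intro exI[of _ "j + k"] exI[of _ n] exI[of _ B] conjI) simp_all
next
  case (inversion A)
  then obtain k n B where k: "4 dvd (k::int)" and B: "B \<in> reduced_mat n" and eq: "psl A = psl (shear (of_int k) ** B)"
    by blast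
  have eq': "psl (inversion ** A) = psl (inversion ** (shear (of_int k) ** B))"
    using eq by (simp flip: mult_PSL2R)
  show ?case
  proof (cases "k = 0")
    case False
    then have "inversion ** (shear (of_int k) ** B) \<in> reduced_mat (Suc n)"
      using k B by (auto simp: digits_def)
    moreover have "psl (inversion ** A) = psl (shear (of_int 0) ** (inversion ** (shear (of_int k) ** B)))"
      by (simp add: eq')
    ultimately show ?thesis
      by (intro exI[of _ 0] exI[of _ "Suc n"] exI[of _ "inversion ** (shear (of_int k) ** B)"] conjI) simp_all
  next
    case k0: True
    show ?thesis
    proof (cases n)
      case 0
      then have "psl (inversion ** A) = psl (shear (of_int 0) ** inversion) \<or>
          psl (inversion ** A) = psl (shear (of_int 0) ** mat 1)"
        using B by (auto simp: eq' k0 inversion_inversion)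
      moreover have "inversion \<in> reduced_mat 0" "mat 1 \<in> reduced_mat 0"
        by auto
      ultimately show ?thesis
        by (metis dvd_0_right)
    next
      case (Suc m)
      then obtain j C where j: "j \<in> digits" and C: "C \<in> reduced_mat m"
        and B': "B = inversion ** (shear (of_int j) ** C)"
        using B by auto
      then have "psl (inversion ** A) = psl (shear (of_int j) ** C)"
        by (simp add: eq' k0 inversion_inversion_mult)
      then show ?thesis
        using j C by (intro exI[of _ j] exI[of _ m] exI[of _ C]) (auto simp: digits_def)
    qed
  qed
qed

text \<open>The starting point i lies in the closed unit ball, and one branch already maps this ball
  into the ball of radius 1/3.\<close>

lemma reduced_mat_props:
  assumes "B \<in> reduced_mat n"
  shows "det B = 1" "moebius B \<i> \<in> UHP" "moebius B \<i> = \<i> \<or> cmod (moebius B \<i>) \<le> 1 / 3"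
proof -
  have "det B = 1 \<and> moebius B \<i> \<in> UHP \<and> (moebius B \<i> = \<i> \<or> cmod (moebius B \<i>) \<le> 1 / 3)"
    using assms
  proof (induction n arbitrary: B)
    case 0
    then show ?case
      by (auto simp: moebius_mat_1 moebius_inversion)
  next
    case (Suc n)
    then obtain k C where k: "k \<in> digits" and C: "C \<in> reduced_mat n"
      and B: "B = inversion ** (shear (of_int k) ** C)"
      by auto
    let ?w = "moebius C \<i>"
    have det: "det C = 1" and w: "?w \<in> UHP" and le: "cmod ?w \<le> 1"
      using Suc.IH[OF C] by auto
    have eq: "moebius B \<i> = - 1 / (of_int k + ?w)"
      by (simp add: B moebius_mult det det_mul moebius_shear moebius_inversion add.commute)
    moreover have "0 < Im (- 1 / (of_int k + ?w))"
      unfolding Im_neg_inverse using w norm_digit_plus_ge(2)[OF k le]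
      by (intro divide_pos_pos) (auto simp: UHP_def)
    moreover have "cmod (- 1 / (of_int k + ?w)) \<le> 1 / 3"
      using norm_branch_le[OF k le, of "-1"] by simp
    ultimately show ?case
      by (auto simp: B det det_mul UHP_def)
  qed
  then show "det B = 1" "moebius B \<i> \<in> UHP" "moebius B \<i> = \<i> \<or> cmod (moebius B \<i>) \<le> 1 / 3"
    by auto
qed

lemma orbit_cases:
  assumes "z \<in> orbit"
  obtains k w where "4 dvd (k::int)" "z = of_int k + w" "w = \<i> \<or> cmod w \<le> 1 / 3"
proof -
  obtain A where A: "A \<in> Gamma_mat" "z = moebius A \<i>"
    using assms by (auto simp: orbit_def)
  obtain k n B where k: "4 dvd (k::int)" and B: "B \<in> reduced_mat n" and eq: "psl A = psl (shear (of_int k) ** B)"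
    using Gamma_mat_normal_form[OF A(1)] by blast
  have "z = psl_act (psl A) \<i>"
    by (simp add: A)
  also have "\<dots> = of_int k + moebius B \<i>"
    by (simp add: eq moebius_mult moebius_shear reduced_mat_props[OF B])
  finally show ?thesis
    using that k reduced_mat_props(3)[OF B] by blast
qed

section \<open>Symmetries and gaps of the limit set\<close>

lemma open_vimage_Some:
  assumes "openin (Alexandroff_compactification (euclidean :: 'a::t2_space topology)) U"
  shows "open (Some -` U)"
  using assms by (auto simp: openin_Alexandroff_compactification inj_vimage_image_eq vimage_def
      Compl_eq_Diff_UNIV[symmetric] image_iff Collect_neg_eq open_Compl compact_imp_closed)

lemma real_limit_set_iff: "x \<in> real_limit_set Gamma_hat \<longleftrightarrow> complex_of_real x islimpt orbit"
proof -
  have im: "(\<lambda>g. Some (psl_act g \<i>)) ` Gamma_hat = Some ` orbit"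
    by (auto simp: Gamma_hat_eq orbit_def image_image)
  have "x \<in> real_limit_set Gamma_hat \<longleftrightarrow>
     (\<forall>T. Some (complex_of_real x) \<in> T \<and> openin riemann_sphere T \<longrightarrow>
        (\<exists>y\<noteq>Some (complex_of_real x). y \<in> Some ` orbit \<and> y \<in> T))"
    unfolding real_limit_set_def limit_set_def im derived_set_of_def by auto
  also have "\<dots> \<longleftrightarrow> complex_of_real x islimpt orbit"
  proof
    assume L: "\<forall>T. Some (complex_of_real x) \<in> T \<and> openin riemann_sphere T \<longrightarrow>
        (\<exists>y\<noteq>Some (complex_of_real x). y \<in> Some ` orbit \<and> y \<in> T)"
    show "complex_of_real x islimpt orbit"
      unfolding islimpt_def
    proof (intro allI impI)
      fix T assume "complex_of_real x \<in> T" "open T"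
      then have "Some (complex_of_real x) \<in> Some ` T \<and> openin riemann_sphere (Some ` T)"
        by simp
      with L show "\<exists>y\<in>orbit. y \<in> T \<and> y \<noteq> complex_of_real x"
        by blast
    qed
  next
    assume L: "complex_of_real x islimpt orbit"
    show "\<forall>T. Some (complex_of_real x) \<in> T \<and> openin riemann_sphere T \<longrightarrow>
        (\<exists>y\<noteq>Some (complex_of_real x). y \<in> Some ` orbit \<and> y \<in> T)"
    proof (intro allI impI)
      fix T assume T: "Some (complex_of_real x) \<in> T \<and> openin riemann_sphere T"
      have "open (Some -` T)"
        using T by (intro open_vimage_Some) auto
      then have "\<exists>y\<in>orbit. y \<in> Some -` T \<and> y \<noteq> complex_of_real x"
        using L T unfolding islimpt_def by blast
      then show "\<exists>y\<noteq>Some (complex_of_real x). y \<in> Some ` orbit \<and> y \<in> T"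
        by blast
    qed
  qed
  finally show ?thesis .
qed

lemma closed_real_limit_set: "closed (real_limit_set Gamma_hat)"
proof -
  have "real_limit_set Gamma_hat = complex_of_real -` {z. z islimpt orbit}"
    by (auto simp: real_limit_set_iff)
  moreover have "closed (complex_of_real -` {z. z islimpt orbit})"
    by (intro closed_vimage closed_limpts continuous_intros)
  ultimately show ?thesis
    by simp
qed

text \<open>The image sequence stays in the open upper half plane and so never meets the real limit
  point; this takes the place of injectivity of f.\<close>

lemma islimpt_orbit_map:
  assumes x: "complex_of_real x islimpt orbit" and f: "isCont f (complex_of_real x)"
    and map: "\<And>z. z \<in> orbit \<Longrightarrow> f z \<in> orbit" and real: "f (complex_of_real x) = complex_of_real y"
  shows "complex_of_real y islimpt orbit"
proof -
  obtain g where g: "\<And>n. g n \<in> orbit - {complex_of_real x}" "g \<longlonglongrightarrow> complex_of_real x"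
    using x unfolding islimpt_sequential by blast
  have "(\<lambda>n. f (g n)) \<longlonglongrightarrow> complex_of_real y"
    using isCont_tendsto_compose[OF f g(2)] by (simp add: real)
  moreover have "f (g n) \<in> orbit - {complex_of_real y}" for n
    using orbit_UHP[OF map, of "g n"] map g(1)[of n] by auto
  ultimately show ?thesis
    unfolding islimpt_sequential by (intro exI[of _ "\<lambda>n. f (g n)"]) auto
qed

lemma limit_set_shift4:
  assumes "x \<in> real_limit_set Gamma_hat" "t \<in> {4, -4}"
  shows "x + t \<in> real_limit_set Gamma_hat"
  unfolding real_limit_set_iff
proof (rule islimpt_orbit_map)
  show "complex_of_real x islimpt orbit"
    using assms(1) unfolding real_limit_set_iff .
  show "isCont (\<lambda>z. z + of_real t) (complex_of_real x)"
    by (intro continuous_intros)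
qed (use assms(2) orbit_shift in auto)

lemma limit_set_shift:
  assumes "x \<in> real_limit_set Gamma_hat" "4 dvd k"
  shows "x + of_int k \<in> real_limit_set Gamma_hat"
proof -
  have "x + of_int (4 * j) \<in> real_limit_set Gamma_hat" for j
  proof (induction j rule: int_induct[where k = 0])
    case base
    then show ?case
      using assms by simp
  next
    case (step1 i)
    then show ?case
      using limit_set_shift4[of "x + of_int (4 * i)" 4] by (simp add: algebra_simps)
  next
    case (step2 i)
    then show ?case
      using limit_set_shift4[of "x + of_int (4 * i)" "-4"] by (simp add: algebra_simps)
  qed
  then show ?thesis
    using assms(2) by (auto elim!: dvdE)
qed

lemma limit_set_inversion:
  assumes "x \<in> real_limit_set Gamma_hat" "x \<noteq> 0"
  shows "- 1 / x \<in> real_limit_set Gamma_hat"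
  unfolding real_limit_set_iff
proof (rule islimpt_orbit_map)
  show "complex_of_real x islimpt orbit"
    using assms(1) unfolding real_limit_set_iff .
  show "isCont (\<lambda>z. - 1 / z) (complex_of_real x)"
    using assms(2) by (intro continuous_intros) auto
qed (auto dest: orbit_inversion)

lemma limit_set_uminus:
  assumes "x \<in> real_limit_set Gamma_hat"
  shows "- x \<in> real_limit_set Gamma_hat"
  unfolding real_limit_set_iff
proof (rule islimpt_orbit_map)
  show "complex_of_real x islimpt orbit"
    using assms(1) unfolding real_limit_set_iff .
  show "isCont (\<lambda>z. - cnj z) (complex_of_real x)"
    by (intro continuous_intros)
qed (auto dest: orbit_reflect)

text \<open>By the normal form the orbit consists of the points i + k, at height 1, and of points in
  discs of radius 1/3 about multiples k of 4. Only the disc about 0 can accumulate in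
  [-2, 2].\<close>

lemma limit_set_gap:
  assumes x: "x \<in> real_limit_set Gamma_hat" and "\<bar>x\<bar> \<le> 2"
  shows "\<bar>x\<bar> \<le> 1 / 3"
proof (rule field_le_epsilon)
  fix d :: real assume "0 < d"
  \<comment> \<open>The bound 1 excludes the points i + k and forces k = 0; the bound d is the
    approximation wanted.\<close>
  then have "0 < min d 1"
    by simp
  moreover have "\<forall>e>0. \<exists>z\<in>orbit. z \<noteq> of_real x \<and> dist z (of_real x) < e"
    using x by (simp only: real_limit_set_iff islimpt_approachable)
  ultimately have "\<exists>z\<in>orbit. z \<noteq> of_real x \<and> dist z (of_real x) < min d 1"
    by (simp only:)
  then obtain z where z: "z \<in> orbit" "dist z (of_real x) < min d 1"
    by (elim bexE conjE)
  obtain k w where k: "4 dvd (k::int)" "z = of_int k + w" "w = \<i> \<or> cmod w \<le> 1 / 3"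
    by (rule orbit_cases[OF z(1)])
  have Re: "\<bar>Re z - x\<bar> < 1" and Im: "\<bar>Im z\<bar> < 1"
    using z(2) abs_Re_le_cmod[of "z - of_real x"] abs_Im_le_cmod[of "z - of_real x"] by (auto simp: dist_norm)
  have "w \<noteq> \<i>"
    using Im k(2) by auto
  then have w: "cmod w \<le> 1 / 3"
    using k(3) by auto
  have "Re z = of_int k + Re w"
    using k(2) by simp
  then have "\<bar>real_of_int k\<bar> < 4"
    using Re w abs_Re_le_cmod[of w] assms(2) by linarith
  then have "\<bar>k\<bar> < 4"
    by linarith
  then have "k = 0"
    using k(1) by presburger
  then have "\<bar>Re z\<bar> \<le> 1 / 3"
    using w abs_Re_le_cmod[of w] k(2) by auto
  moreover have "\<bar>Re z - x\<bar> < d"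
    using z(2) abs_Re_le_cmod[of "z - of_real x"] by (auto simp: dist_norm)
  ultimately show "\<bar>x\<bar> \<le> 1 / 3 + d"
    by linarith
qed

section \<open>The Poincare series\<close>

lemma nn_integral_count_space_subset:
  assumes "A \<subseteq> B"
  shows "(\<integral>\<^sup>+x. h x \<partial>count_space A) \<le> (\<integral>\<^sup>+x. h x \<partial>count_space B)"
proof -
  have "(\<integral>\<^sup>+x. h x \<partial>count_space C) = (\<integral>\<^sup>+x. h x * indicator C x \<partial>count_space UNIV)" for C
    by (simp add: nn_integral_count_space_indicator)
  then show ?thesis
    using assms by (auto intro!: nn_integral_mono simp: indicator_def)
qed

text \<open>One preimage is chosen for every value, so collisions only make the left side smaller.
  Upper bounds are all that the Poincare series asks for, which spares a proof that normal forms are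
  unique.\<close>

lemma nn_integral_count_space_image_le:
  "(\<integral>\<^sup>+y. h y \<partial>count_space (f ` A)) \<le> (\<integral>\<^sup>+x. h (f x) \<partial>count_space A)"
proof -
  obtain B where B: "B \<subseteq> A" "inj_on f B" "f ` A = f ` B"
    using subset_image_inj[of "f ` A" f A] by auto
  have "(\<integral>\<^sup>+y. h y \<partial>count_space (f ` A)) = (\<integral>\<^sup>+x. h (f x) \<partial>count_space B)"
    unfolding B(3) using B(2) by (intro nn_integral_bij_count_space[symmetric] inj_on_imp_bij_betw)
  also have "\<dots> \<le> (\<integral>\<^sup>+x. h (f x) \<partial>count_space A)"
    by (rule nn_integral_count_space_subset[OF B(1)])
  finally show ?thesis .
qed

lemma nn_integral_count_space_UN_le:
  assumes "countable I"
  shows "(\<integral>\<^sup>+x. h x \<partial>count_space (\<Union>i\<in>I. B i)) \<le> (\<integral>\<^sup>+i. \<integral>\<^sup>+x. h x \<partial>count_space (B i) \<partial>count_space I)"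
proof -
  have "(\<integral>\<^sup>+x. h x \<partial>count_space (\<Union>i\<in>I. B i)) = (\<integral>\<^sup>+x. h x * indicator (\<Union>i\<in>I. B i) x \<partial>count_space UNIV)"
    by (simp add: nn_integral_count_space_indicator)
  also have "\<dots> \<le> (\<integral>\<^sup>+x. \<integral>\<^sup>+i. h x * indicator (B i) x \<partial>count_space I \<partial>count_space UNIV)"
  proof (intro nn_integral_mono)
    fix x
    show "h x * indicator (\<Union>i\<in>I. B i) x \<le> (\<integral>\<^sup>+i. h x * indicator (B i) x \<partial>count_space I)"
    proof (cases "x \<in> (\<Union>i\<in>I. B i)")
      case True
      then obtain i where i: "i \<in> I" "x \<in> B i"
        by auto
      have "h x = (\<integral>\<^sup>+j. h x * indicator (B j) x \<partial>count_space {i})"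
        using i by (simp add: nn_integral_count_space_finite)
      also have "\<dots> \<le> (\<integral>\<^sup>+j. h x * indicator (B j) x \<partial>count_space I)"
        using i by (intro nn_integral_count_space_subset) auto
      finally show ?thesis
        using True by simp
    qed simp
  qed
  also have "\<dots> = (\<integral>\<^sup>+i. \<integral>\<^sup>+x. h x * indicator (B i) x \<partial>count_space UNIV \<partial>count_space I)"
    using assms by (intro nn_integral_count_space_nn_integral) auto
  also have "\<dots> = (\<integral>\<^sup>+i. \<integral>\<^sup>+x. h x \<partial>count_space (B i) \<partial>count_space I)"
    by (simp add: nn_integral_count_space_indicator)
  finally show ?thesis .
qed

lemma sum_multiples_powr_finite:
  fixes c :: int
  assumes "1 / 2 < s" "\<bar>c\<bar> = 4"
  shows "(\<integral>\<^sup>+k. ennreal (real_of_int \<bar>k\<bar> powr (- 2 * s)) \<partial>count_space (range (\<lambda>n. c * int (Suc n)))) < \<infinity>"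
proof -
  have sm: "summable (\<lambda>n. real (Suc n) powr (- 2 * s))"
    using assms by (subst summable_Suc_iff) (simp add: summable_real_powr_iff)
  have "(\<integral>\<^sup>+k. ennreal (real_of_int \<bar>k\<bar> powr (- 2 * s)) \<partial>count_space (range (\<lambda>n. c * int (Suc n))))
      \<le> (\<integral>\<^sup>+n. ennreal (real_of_int \<bar>c * int (Suc n)\<bar> powr (- 2 * s)) \<partial>count_space UNIV)"
    by (rule nn_integral_count_space_image_le)
  also have "\<dots> \<le> (\<integral>\<^sup>+n. ennreal (real (Suc n) powr (- 2 * s)) \<partial>count_space UNIV)"
    using assms by (intro nn_integral_mono ennreal_leI powr_mono2') (auto simp: abs_mult)
  also have "\<dots> = (\<Sum>n. ennreal (real (Suc n) powr (- 2 * s)))"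
    by (rule nn_integral_count_space_nat)
  also have "\<dots> = ennreal (\<Sum>n. real (Suc n) powr (- 2 * s))"
    using sm by (intro suminf_ennreal2) auto
  also have "\<dots> < \<infinity>"
    by simp
  finally show ?thesis .
qed

lemma nn_integral_count_space_Un_le:
  "(\<integral>\<^sup>+x. h x \<partial>count_space (A \<union> B)) \<le> (\<integral>\<^sup>+x. h x \<partial>count_space A) + (\<integral>\<^sup>+x. h x \<partial>count_space B)"
proof -
  have "(\<integral>\<^sup>+x. h x \<partial>count_space (A \<union> B)) \<le> (\<integral>\<^sup>+x. h x * indicator A x + h x * indicator B x \<partial>count_space UNIV)"
    by (subst nn_integral_count_space_indicator) (auto intro!: nn_integral_mono simp: indicator_def)
  also have "\<dots> = (\<integral>\<^sup>+x. h x \<partial>count_space A) + (\<integral>\<^sup>+x. h x \<partial>count_space B)"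
    by (subst nn_integral_add) (simp_all add: nn_integral_count_space_indicator)
  finally show ?thesis .
qed

lemma sum_digits_powr_finite:
  assumes "1 / 2 < s"
  shows "(\<integral>\<^sup>+k. ennreal (real_of_int \<bar>k\<bar> powr (- 2 * s)) \<partial>count_space digits) < \<infinity>"
proof -
  have "digits \<subseteq> range (\<lambda>n. 4 * int (Suc n)) \<union> range (\<lambda>n. - 4 * int (Suc n))"
  proof
    fix k :: int assume "k \<in> digits"
    then obtain j where j: "k = 4 * j" "j \<noteq> 0"
      by (auto simp: digits_def)
    show "k \<in> range (\<lambda>n. 4 * int (Suc n)) \<union> range (\<lambda>n. - 4 * int (Suc n))"
    proof (cases "0 < j")
      case True
      then have "k = 4 * int (Suc (nat (j - 1)))"
        using j by simp
      then show ?thesis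
        by blast
    next
      case False
      then have "k = - 4 * int (Suc (nat (- j - 1)))"
        using j by simp
      then show ?thesis
        by blast
    qed
  qed
  then have "(\<integral>\<^sup>+k. ennreal (real_of_int \<bar>k\<bar> powr (- 2 * s)) \<partial>count_space digits)
    \<le> (\<integral>\<^sup>+k. ennreal (real_of_int \<bar>k\<bar> powr (- 2 * s)) \<partial>count_space (range (\<lambda>n. 4 * int (Suc n)) \<union> range (\<lambda>n. - 4 * int (Suc n))))"
    by (rule nn_integral_count_space_subset)
  also have "\<dots> \<le> (\<integral>\<^sup>+k. ennreal (real_of_int \<bar>k\<bar> powr (- 2 * s)) \<partial>count_space (range (\<lambda>n. 4 * int (Suc n))))
     + (\<integral>\<^sup>+k. ennreal (real_of_int \<bar>k\<bar> powr (- 2 * s)) \<partial>count_space (range (\<lambda>n. - 4 * int (Suc n))))"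
    by (rule nn_integral_count_space_Un_le)
  also have "\<dots> < \<infinity>"
    using sum_multiples_powr_finite[OF assms, of 4] sum_multiples_powr_finite[OF assms, of "-4"] by simp
  finally show ?thesis .
qed

lemma sum_digits_powr_infinite:
  assumes "s \<le> 1 / 2"
  shows "(\<integral>\<^sup>+k. ennreal (real_of_int \<bar>k\<bar> powr (- 2 * s)) \<partial>count_space digits) = \<infinity>"
proof (rule ccontr)
  assume fin: "\<not> ?thesis"
  have "(\<Sum>n. ennreal (real_of_int \<bar>4 * int (Suc n)\<bar> powr (- 2 * s)))
      = (\<integral>\<^sup>+n. ennreal (real_of_int \<bar>4 * int (Suc n)\<bar> powr (- 2 * s)) \<partial>count_space UNIV)"
    by (rule nn_integral_count_space_nat[symmetric])
  also have "\<dots> = (\<integral>\<^sup>+k. ennreal (real_of_int \<bar>k\<bar> powr (- 2 * s)) \<partial>count_space (range (\<lambda>n. 4 * int (Suc n))))"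
    by (rule nn_integral_bij_count_space) (auto simp: bij_betw_def inj_on_def)
  also have "\<dots> \<le> (\<integral>\<^sup>+k. ennreal (real_of_int \<bar>k\<bar> powr (- 2 * s)) \<partial>count_space digits)"
    by (rule nn_integral_count_space_subset) (auto simp: digits_def)
  finally have "(\<Sum>n. ennreal (real_of_int \<bar>4 * int (Suc n)\<bar> powr (- 2 * s))) \<noteq> \<infinity>"
    using fin by (auto simp: top_unique)
  then have "summable (\<lambda>n. real_of_int \<bar>4 * int (Suc n)\<bar> powr (- 2 * s))"
    by (intro summable_suminf_not_top) auto
  moreover have "real_of_int \<bar>4 * int (Suc n)\<bar> powr (- 2 * s) = 4 powr (- 2 * s) * real (Suc n) powr (- 2 * s)" for n
    by (simp flip: powr_mult)
  ultimately have "summable (\<lambda>n. 4 powr (- 2 * s) * real (Suc n) powr (- 2 * s))"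
    by simp
  then have "summable (\<lambda>n. real (Suc n) powr (- 2 * s))"
    by (subst (asm) summable_cmult_iff) simp
  then have "summable (\<lambda>n. real n powr (- 2 * s))"
    by (subst (asm) summable_Suc_iff)
  then show False
    using assms by (simp add: summable_real_powr_iff)
qed

section \<open>Finiteness and continuity of the iterates in the exponent\<close>

lemma transfer_one_0:
  "transfer s (e::'a::real_normed_field) (\<lambda>_. 1) 0
     = (\<integral>\<^sup>+k. ennreal (real_of_int \<bar>k\<bar> powr (- 2 * s)) \<partial>count_space digits)"
  by (simp add: transfer_def)

text \<open>The value at 0 is a convergent series over the digits, and the logarithmic Lipschitz
  bound spreads it over the ball. The normalisation 1 \<le> B makes the powers of B increasing, as
  \<open>geometric_decay\<close> needs.\<close>

lemma transfer_one_bounded: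
  assumes "1 / 2 < s" "norm (e::'a::real_normed_field) = 1"
  obtains B where "1 \<le> B" "\<And>x. norm x \<le> 1 \<Longrightarrow> transfer s e (\<lambda>_. 1) x \<le> ennreal B"
proof -
  have lip: "log_lip (2 * s / 3 + 0 / 9) (transfer s e (\<lambda>_. 1))"
    using assms by (intro transfer_log_lip log_lip_const) auto
  obtain b where b: "transfer s e (\<lambda>_. 1) 0 = ennreal b" "0 \<le> b"
    using sum_digits_powr_finite[OF assms(1)] unfolding transfer_one_0[symmetric, of s e]
    by (cases "transfer s e (\<lambda>_. 1) 0") auto
  have "transfer s e (\<lambda>_. 1) x \<le> ennreal (max 1 (exp (2 * s / 3) * b))" if x: "norm x \<le> 1" for x
  proof -
    have "transfer s e (\<lambda>_. 1) x \<le> ennreal (exp (2 * s / 3 * norm (x - 0))) * ennreal b"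
      using log_lipD[OF lip x, of 0] by (simp add: b)
    also have "\<dots> \<le> ennreal (exp (2 * s / 3) * b)"
      using x assms b by (simp add: flip: ennreal_mult) (intro mult_right_mono, auto simp: mult_left_le)
    also have "\<dots> \<le> ennreal (max 1 (exp (2 * s / 3) * b))"
      by (intro ennreal_leI) simp
    finally show ?thesis .
  qed
  then show ?thesis
    by (intro that[of "max 1 (exp (2 * s / 3) * b)"]) auto
qed

lemma transfer_antimono:
  assumes "s \<le> t" "norm (x::'a::real_normed_field) \<le> 1"
  shows "transfer t e u x \<le> transfer s e u x"
  unfolding transfer_def
proof (intro nn_integral_mono mult_right_mono ennreal_leI)
  fix k assume "k \<in> space (count_space digits)"
  then have "3 \<le> norm (of_int k + x)"
    using norm_digit_plus_ge(2)[of k x] assms(2) by simp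
  then show "norm (of_int k + x) powr (- 2 * t) \<le> norm (of_int k + x) powr (- 2 * s)"
    using assms by (intro powr_mono) auto
qed simp

lemma transfer_pow_one_bounded:
  fixes e :: "'a::real_normed_field"
  assumes "norm e = 1" and B: "\<And>x. norm x \<le> 1 \<Longrightarrow> transfer s e (\<lambda>_. 1) x \<le> ennreal B" "0 \<le> B"
    and "s \<le> t" "norm x \<le> 1"
  shows "(transfer t e ^^ n) (\<lambda>_. 1) x \<le> ennreal (B ^ n)"
  using assms(5)
proof (induction n arbitrary: x)
  case (Suc n)
  have "(transfer t e ^^ Suc n) (\<lambda>_. 1) x = transfer t e ((transfer t e ^^ n) (\<lambda>_. 1)) x"
    by simp
  also have "\<dots> \<le> transfer t e (\<lambda>_. ennreal (B ^ n) * 1) x"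
    using Suc by (intro transfer_mono assms(1)) auto
  also have "\<dots> = ennreal (B ^ n) * transfer t e (\<lambda>_. 1) x"
    by (rule transfer_cmult)
  also have "\<dots> \<le> ennreal (B ^ n) * ennreal B"
    using transfer_antimono[OF assms(4) Suc.prems, of e "\<lambda>_. 1"] B(1)[OF Suc.prems]
    by (intro mult_left_mono) auto
  also have "\<dots> = ennreal (B ^ Suc n)"
    using B(2) by (simp add: ennreal_mult mult.commute)
  finally show ?case .
qed simp

text \<open>Dominated convergence over the digits: the weights at the smallest exponent s0, which
  are summable because s0 > 1/2, times the uniform bound B ^ n form a majorant.\<close>

lemma transfer_pow_tendsto:
  fixes e :: "'a::real_normed_field"
  assumes e: "norm e = 1" and s0: "1 / 2 < s0" and s: "\<And>m. s0 \<le> s m" "s \<longlonglongrightarrow> t"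
    and x: "norm x \<le> 1"
  shows "(\<lambda>m. (transfer (s m) e ^^ n) (\<lambda>_. 1) x) \<longlonglongrightarrow> (transfer t e ^^ n) (\<lambda>_. 1) x"
  using x
proof (induction n arbitrary: x)
  case (Suc n)
  obtain B where B: "1 \<le> B" "\<And>x. norm x \<le> 1 \<Longrightarrow> transfer s0 e (\<lambda>_. 1) x \<le> ennreal B"
    using transfer_one_bounded[OF s0 e] by metis
  let ?u = "\<lambda>t n. (transfer t e ^^ n) (\<lambda>_. 1)"
  have bound: "?u t n y \<le> ennreal (B ^ n)" if "s0 \<le> t" "norm y \<le> 1" for t n y
    using that B by (intro transfer_pow_one_bounded[OF e, of s0]) auto
  have "(\<lambda>m. \<integral>\<^sup>+k. ennreal (norm (of_int k + x) powr (- 2 * s m)) * ?u (s m) n (e / (of_int k + x)) \<partial>count_space digits)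
      \<longlonglongrightarrow> (\<integral>\<^sup>+k. ennreal (norm (of_int k + x) powr (- 2 * t)) * ?u t n (e / (of_int k + x)) \<partial>count_space digits)"
  proof (rule nn_integral_dominated_convergence)
    let ?w = "\<lambda>k. ennreal (B ^ n) * (ennreal (norm (of_int k + x) powr (- 2 * s0)) * 1)"
    have "(\<integral>\<^sup>+k. ?w k \<partial>count_space digits) = ennreal (B ^ n) * transfer s0 e (\<lambda>_. 1) x"
      unfolding transfer_def by (rule nn_integral_cmult) simp
    also have "\<dots> \<le> ennreal (B ^ n) * ennreal B"
      by (intro mult_left_mono B Suc.prems) simp
    also have "\<dots> < \<infinity>"
      by (simp add: ennreal_mult_less_top)
    finally show "(\<integral>\<^sup>+k. ?w k \<partial>count_space digits) < \<infinity>" .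
    have y: "norm (e / (of_int k + x)) \<le> 1" and X: "3 \<le> norm (of_int k + x)" if "k \<in> digits" for k
      using norm_branch_le[OF that Suc.prems e] norm_digit_plus_ge(2)[OF that Suc.prems] by auto
    show "AE k in count_space digits.
        ennreal (norm (of_int k + x) powr (- 2 * s m)) * ?u (s m) n (e / (of_int k + x)) \<le> ?w k" for m
    proof (rule AE_I2)
      fix k assume "k \<in> space (count_space digits)"
      then have k: "k \<in> digits"
        by simp
      have "norm (of_int k + x) powr (- 2 * s m) \<le> norm (of_int k + x) powr (- 2 * s0)"
        using X[OF k] s(1)[of m] by (intro powr_mono) auto
      then show "ennreal (norm (of_int k + x) powr (- 2 * s m)) * ?u (s m) n (e / (of_int k + x)) \<le> ?w k"
        using bound[OF s(1) y[OF k], of n m] by (subst mult.commute) (auto intro!: mult_mono ennreal_leI)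
    qed
    show "AE k in count_space digits.
        (\<lambda>m. ennreal (norm (of_int k + x) powr (- 2 * s m)) * ?u (s m) n (e / (of_int k + x)))
          \<longlonglongrightarrow> ennreal (norm (of_int k + x) powr (- 2 * t)) * ?u t n (e / (of_int k + x))"
    proof (rule AE_I2)
      fix k assume "k \<in> space (count_space digits)"
      then have k: "k \<in> digits"
        by simp
      have "s0 \<le> t"
        using s by (intro LIMSEQ_le_const[OF s(2)]) auto
      then have "?u t n (e / (of_int k + x)) \<noteq> \<top>"
        using bound[of t "e / (of_int k + x)" n] y[OF k] by (auto simp: top_unique)
      then show "(\<lambda>m. ennreal (norm (of_int k + x) powr (- 2 * s m)) * ?u (s m) n (e / (of_int k + x)))
          \<longlonglongrightarrow> ennreal (norm (of_int k + x) powr (- 2 * t)) * ?u t n (e / (of_int k + x))"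
        using X[OF k] s(2)
        by (intro tendsto_mult_ennreal tendsto_ennrealI tendsto_intros Suc.IH y[OF k]) auto
    qed
  qed auto
  then show ?case
    unfolding funpow.simps o_def transfer_def[where u = "?u _ _"] .
qed simp

section \<open>Bounding the Poincare series by iterates\<close>

text \<open>From Im (-1 / (k + z)) = Im z / |k + z|^2 the s-th power of the imaginary part picks up
  exactly the transfer weight. The outermost digit is absorbed into u, which is why u is
  generalised; the factor 2 counts the two words of length 0, both fixing i.\<close>

lemma sum_reduced_mat_le:
  "(\<integral>\<^sup>+A. ennreal (Im (moebius A \<i>) powr s) * u (moebius A \<i>) \<partial>count_space (reduced_mat n))
     \<le> 2 * (transfer s (- 1) ^^ n) u \<i>"
proof (induction n arbitrary: u)
  case 0
  have "(\<integral>\<^sup>+A. ennreal (Im (moebius A \<i>) powr s) * u (moebius A \<i>) \<partial>count_space (reduced_mat 0))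
      = (\<Sum>A\<in>{mat 1, inversion}. ennreal (Im (moebius A \<i>) powr s) * u (moebius A \<i>))"
    by (simp add: nn_integral_count_space_finite)
  also have "\<dots> = u \<i> + u \<i>"
  proof -
    have "mat 1 \<noteq> inversion"
      by (simp add: matrix2_eq_iff inversion_def)
    then show ?thesis
      by (simp add: moebius_mat_1 moebius_inversion)
  qed
  finally show ?case
    by (simp add: mult_2)
next
  case (Suc n)
  let ?g = "\<lambda>k A. inversion ** (shear (of_int k) ** A)"
  let ?h = "\<lambda>A. ennreal (Im (moebius A \<i>) powr s) * u (moebius A \<i>)"
  have "reduced_mat (Suc n) = (\<Union>k\<in>digits. ?g k ` reduced_mat n)"
    by auto
  then have "(\<integral>\<^sup>+A. ?h A \<partial>count_space (reduced_mat (Suc n)))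
      \<le> (\<integral>\<^sup>+k. \<integral>\<^sup>+A. ?h A \<partial>count_space (?g k ` reduced_mat n) \<partial>count_space digits)"
    by (simp only: nn_integral_count_space_UN_le[OF countable_digits])
  also have "\<dots> \<le> (\<integral>\<^sup>+k. \<integral>\<^sup>+A. ?h (?g k A) \<partial>count_space (reduced_mat n) \<partial>count_space digits)"
    by (intro nn_integral_mono nn_integral_count_space_image_le)
  also have "\<dots> = (\<integral>\<^sup>+A. \<integral>\<^sup>+k. ?h (?g k A) \<partial>count_space digits \<partial>count_space (reduced_mat n))"
    by (intro nn_integral_count_space_nn_integral[symmetric] countable_digits) simp
  also have "\<dots> = (\<integral>\<^sup>+A. ennreal (Im (moebius A \<i>) powr s) * transfer s (- 1) u (moebius A \<i>) \<partial>count_space (reduced_mat n))"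
  proof (intro nn_integral_cong)
    fix A assume "A \<in> space (count_space (reduced_mat n))"
    then have A: "A \<in> reduced_mat n"
      by simp
    let ?z = "moebius A \<i>"
    have z: "0 < Im ?z" "cmod ?z \<le> 1"
      using reduced_mat_props[OF A] by (auto simp: UHP_def)
    have "?h (?g k A) = ennreal (Im ?z powr s) * (ennreal (cmod (of_int k + ?z) powr (- 2 * s)) * u (- 1 / (of_int k + ?z)))"
      if k: "k \<in> digits" for k
    proof -
      have m: "moebius (?g k A) \<i> = - 1 / (of_int k + ?z)"
        using reduced_mat_props[OF A]
        by (simp add: moebius_mult det_mul moebius_shear moebius_inversion add.commute)
      have pos: "0 < cmod (of_int k + ?z)"
        using norm_digit_plus_ge(2)[OF k z(2)] by linarith
      have "Im (moebius (?g k A) \<i>) powr s = (Im ?z / (cmod (of_int k + ?z))\<^sup>2) powr s"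
        unfolding m Im_neg_inverse by simp
      also have "\<dots> = Im ?z powr s * cmod (of_int k + ?z) powr (- 2 * s)"
        using pos z(1) by (simp add: powr_divide powr_minus_divide powr_powr flip: powr_numeral)
      finally show ?thesis
        unfolding m by (simp add: ennreal_mult mult.assoc)
    qed
    then have "(\<integral>\<^sup>+k. ?h (?g k A) \<partial>count_space digits)
       = (\<integral>\<^sup>+k. ennreal (Im ?z powr s) * (ennreal (cmod (of_int k + ?z) powr (- 2 * s)) * u (- 1 / (of_int k + ?z))) \<partial>count_space digits)"
      by (intro nn_integral_cong) auto
    also have "\<dots> = ennreal (Im ?z powr s) * transfer s (- 1) u ?z"
      unfolding transfer_def by (rule nn_integral_cmult) simp
    finally show "(\<integral>\<^sup>+k. ?h (?g k A) \<partial>count_space digits) = ennreal (Im ?z powr s) * transfer s (- 1) u ?z" .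
  qed
  also have "\<dots> \<le> 2 * (transfer s (- 1) ^^ n) (transfer s (- 1) u) \<i>"
    by (rule Suc.IH)
  finally show ?case
    by (simp add: funpow_swap1)
qed

text \<open>With z = k + w, the hyperbolic cosine of the distance from i to z is (|z|^2 + 1) / (2 *
  Im w), and the exponential of a distance is at least its hyperbolic cosine.\<close>

lemma exp_hdist_le:
  assumes k: "k \<in> insert 0 digits" and w: "0 < Im w" "cmod w \<le> 1" and s: "0 \<le> s"
  shows "exp (- s * hdist \<i> (of_int k + w))
     \<le> (2 powr s * (if k = 0 then 1 else 2 powr (2 * s) * real_of_int \<bar>k\<bar> powr (- 2 * s))) * Im w powr s"
proof -
  let ?z = "of_int k + w"
  define X where "X = 1 + (cmod (\<i> - ?z))\<^sup>2 / (2 * Im w)"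
  \<comment> \<open>Chosen so that c^2 is at most |k + w|^2 + 1: the summand 1 serves for k = 0, and
    |k + w| \<ge> |k| - 1 \<ge> |k| / 2 otherwise.\<close>
  define c where "c = (if k = 0 then 1 else real_of_int \<bar>k\<bar> / 2)"
  have X1: "1 \<le> X"
    using w by (simp add: X_def)
  have Xeq: "X = ((cmod ?z)\<^sup>2 + 1) / (2 * Im w)"
  proof -
    have "(cmod (\<i> - ?z))\<^sup>2 = (cmod ?z)\<^sup>2 + 1 - 2 * Im w"
      unfolding cmod_power2 by (simp add: power2_eq_square algebra_simps)
    then show ?thesis
      using w by (simp add: X_def field_simps)
  qed
  have c: "0 < c"
    using k by (auto simp: c_def digits_def)
  have "c\<^sup>2 \<le> (cmod ?z)\<^sup>2 + 1"
  proof (cases "k = 0")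
    case False
    then have "k \<in> digits"
      using k by auto
    then have "real_of_int \<bar>k\<bar> - 1 \<le> cmod ?z" "4 \<le> \<bar>k\<bar>"
      using norm_digit_plus_ge(1)[of k w] w digits_abs_ge by auto
    then have "c \<le> cmod ?z"
      using False by (auto simp: c_def)
    then show ?thesis
      using c power_mono[of c "cmod ?z" 2] by linarith
  qed (simp add: c_def)
  then have cX: "c\<^sup>2 / (2 * Im w) \<le> X"
    unfolding Xeq using w by (intro divide_right_mono) auto
  have "exp (arcosh X) = X + sqrt (X\<^sup>2 - 1)"
    using X1 by (simp add: arcosh_real_def add_pos_nonneg)
  then have expX: "X \<le> exp (arcosh X)"
    using X1 by simp
  have "hdist \<i> ?z = arcosh X"
    by (simp add: hdist_def X_def)
  then have "exp (- s * hdist \<i> ?z) = exp (arcosh X) powr (- s)"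
    by (simp add: exp_powr_real mult.commute)
  also have "\<dots> \<le> X powr (- s)"
    using expX X1 s by (intro powr_mono2') auto
  also have "\<dots> \<le> (c\<^sup>2 / (2 * Im w)) powr (- s)"
    using cX c w s by (intro powr_mono2') auto
  also have "\<dots> = (2 * Im w) powr s * (c\<^sup>2) powr (- s)"
    using c w by (simp add: powr_divide powr_minus field_simps)
  also have "\<dots> = 2 powr s * c powr (- 2 * s) * Im w powr s"
    using c w by (simp add: powr_mult powr_powr flip: powr_numeral)
  also have "c powr (- 2 * s) = (if k = 0 then 1 else 2 powr (2 * s) * real_of_int \<bar>k\<bar> powr (- 2 * s))"
    using k by (auto simp: c_def digits_def powr_divide powr_minus field_simps)
  finally show ?thesis .
qed

text \<open>By the normal form the series is bounded by a product: the translations contribute a sum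
  of |k| powr (- 2 * s), finite for s > 1/2, and the reduced words of length n contribute at most
  twice the n-th iterate at i.\<close>

lemma poincare_summable:
  assumes s: "1 / 2 < s" and fin: "(\<Sum>n. (transfer s (- 1) ^^ n) (\<lambda>_. 1) \<i>) < \<infinity>"
  shows "(\<lambda>g. exp (- s * hdist \<i> (psl_act g \<i>))) summable_on Gamma_hat"
proof -
  let ?f = "\<lambda>g. ennreal (exp (- s * hdist \<i> (psl_act g \<i>)))"
  let ?K = "insert 0 digits"
  let ?c = "\<lambda>k::int. 2 powr s * (if k = 0 then 1 else 2 powr (2 * s) * real_of_int \<bar>k\<bar> powr (- 2 * s))"
  let ?B = "\<lambda>k n. (\<lambda>A. psl (shear (of_int k) ** A)) ` reduced_mat n"
  let ?S = "\<Sum>n. (transfer s (- 1) ^^ n) (\<lambda>_. 1) \<i>"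
  have K: "countable ?K"
    by (rule countableI_type)
  have sub: "Gamma_hat \<subseteq> (\<Union>k\<in>?K. \<Union>n\<in>UNIV. ?B k n)"
  proof
    fix g assume "g \<in> Gamma_hat"
    then obtain A where A: "A \<in> Gamma_mat" "g = psl A"
      by (auto simp: Gamma_hat_eq)
    obtain k n B where B: "4 dvd (k::int)" "B \<in> reduced_mat n" "psl A = psl (shear (of_int k) ** B)"
      using Gamma_mat_normal_form[OF A(1)] by blast
    moreover have "k \<in> ?K"
      using B(1) by (auto simp: digits_def)
    ultimately show "g \<in> (\<Union>k\<in>?K. \<Union>n\<in>UNIV. ?B k n)"
      using A(2) by blast
  qed
  have "(\<integral>\<^sup>+g. ?f g \<partial>count_space Gamma_hat) \<le> (\<integral>\<^sup>+g. ?f g \<partial>count_space (\<Union>k\<in>?K. \<Union>n\<in>UNIV. ?B k n))"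
    by (rule nn_integral_count_space_subset[OF sub])
  also have "\<dots> \<le> (\<integral>\<^sup>+k. \<integral>\<^sup>+g. ?f g \<partial>count_space (\<Union>n\<in>UNIV. ?B k n) \<partial>count_space ?K)"
    by (rule nn_integral_count_space_UN_le[OF K])
  also have "\<dots> \<le> (\<integral>\<^sup>+k. \<integral>\<^sup>+n. \<integral>\<^sup>+g. ?f g \<partial>count_space (?B k n) \<partial>count_space UNIV \<partial>count_space ?K)"
    by (intro nn_integral_mono nn_integral_count_space_UN_le) simp
  also have "\<dots> \<le> (\<integral>\<^sup>+k. \<integral>\<^sup>+n. ennreal (?c k) * (2 * (transfer s (- 1) ^^ n) (\<lambda>_. 1) \<i>) \<partial>count_space UNIV \<partial>count_space ?K)"
  proof (intro nn_integral_mono)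
    fix k n assume "k \<in> space (count_space ?K)"
    then have k: "k \<in> ?K"
      by simp
    have "(\<integral>\<^sup>+g. ?f g \<partial>count_space (?B k n)) \<le> (\<integral>\<^sup>+A. ?f (psl (shear (of_int k) ** A)) \<partial>count_space (reduced_mat n))"
      by (rule nn_integral_count_space_image_le)
    also have "\<dots> \<le> (\<integral>\<^sup>+A. ennreal (?c k) * (ennreal (Im (moebius A \<i>) powr s) * 1) \<partial>count_space (reduced_mat n))"
    proof (intro nn_integral_mono)
      fix A assume "A \<in> space (count_space (reduced_mat n))"
      then have A: "A \<in> reduced_mat n"
        by simp
      have m: "moebius (shear (of_int k) ** A) \<i> = of_int k + moebius A \<i>"
        using reduced_mat_props[OF A] by (simp add: moebius_mult moebius_shear)
      have "exp (- s * hdist \<i> (of_int k + moebius A \<i>)) \<le> ?c k * Im (moebius A \<i>) powr s"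
        using reduced_mat_props[OF A] s by (intro exp_hdist_le k) (auto simp: UHP_def)
      then have "?f (psl (shear (of_int k) ** A)) \<le> ennreal (?c k * Im (moebius A \<i>) powr s)"
        by (simp add: m ennreal_leI)
      then show "?f (psl (shear (of_int k) ** A)) \<le> ennreal (?c k) * (ennreal (Im (moebius A \<i>) powr s) * 1)"
        by (simp add: ennreal_mult)
    qed
    also have "\<dots> = ennreal (?c k) * (\<integral>\<^sup>+A. ennreal (Im (moebius A \<i>) powr s) * 1 \<partial>count_space (reduced_mat n))"
      by (rule nn_integral_cmult) simp
    also have "\<dots> \<le> ennreal (?c k) * (2 * (transfer s (- 1) ^^ n) (\<lambda>_. 1) \<i>)"
      using sum_reduced_mat_le[where s = s and u = "\<lambda>_. 1"] by (intro mult_left_mono) auto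
    finally show "(\<integral>\<^sup>+g. ?f g \<partial>count_space (?B k n)) \<le> ennreal (?c k) * (2 * (transfer s (- 1) ^^ n) (\<lambda>_. 1) \<i>)" .
  qed
  also have "\<dots> = (\<integral>\<^sup>+k. ennreal (?c k) * (2 * ?S) \<partial>count_space ?K)"
    by (simp add: nn_integral_cmult nn_integral_count_space_nat)
  also have "\<dots> = (\<integral>\<^sup>+k. ennreal (?c k) \<partial>count_space ?K) * (2 * ?S)"
    by (rule nn_integral_multc) simp
  also have "\<dots> < \<infinity>"
  proof -
    have "(\<integral>\<^sup>+k. ennreal (?c k) \<partial>count_space ?K)
        \<le> (\<integral>\<^sup>+k. ennreal (?c k) \<partial>count_space {0}) + (\<integral>\<^sup>+k. ennreal (?c k) \<partial>count_space digits)"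
      using nn_integral_count_space_Un_le[of "{0}" digits "\<lambda>k. ennreal (?c k)"] by simp
    also have "(\<integral>\<^sup>+k. ennreal (?c k) \<partial>count_space {0}) = ennreal (2 powr s)"
      by (simp add: nn_integral_count_space_finite)
    also have "(\<integral>\<^sup>+k. ennreal (?c k) \<partial>count_space digits)
        = (\<integral>\<^sup>+k. ennreal (2 powr s * 2 powr (2 * s)) * ennreal (real_of_int \<bar>k\<bar> powr (- 2 * s)) \<partial>count_space digits)"
      by (intro nn_integral_cong) (auto simp: digits_def ennreal_mult mult.assoc)
    also have "\<dots> = ennreal (2 powr s * 2 powr (2 * s)) * (\<integral>\<^sup>+k. ennreal (real_of_int \<bar>k\<bar> powr (- 2 * s)) \<partial>count_space digits)"
      by (rule nn_integral_cmult) simp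
    also have "ennreal (2 powr s) + \<dots> < \<infinity>"
      using sum_digits_powr_finite[OF s] by (simp add: ennreal_mult_less_top)
    finally show ?thesis
      using fin by (simp add: ennreal_mult_less_top)
  qed
  finally have "integrable (count_space Gamma_hat) (\<lambda>g. exp (- s * hdist \<i> (psl_act g \<i>)))"
    by (intro integrableI_nonneg) auto
  then have "Infinite_Set_Sum.abs_summable_on (\<lambda>g. exp (- s * hdist \<i> (psl_act g \<i>))) Gamma_hat"
    unfolding abs_summable_on_def .
  then show ?thesis
    using abs_summable_summable abs_summable_equivalent by blast
qed

text \<open>Every block of n steps gains a factor 1/2 = r ^ n, and a remainder of fewer than n steps
  costs at most B ^ n. The 2 compensates r ^ m, which is at least 1/2 for m < n.\<close>

lemma geometric_decay:
  fixes e :: "'a::real_normed_field"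
  assumes e: "norm e = 1" and n: "0 < n" and half: "\<And>x. norm x \<le> 1 \<Longrightarrow> (transfer s e ^^ n) (\<lambda>_. 1) x \<le> ennreal (1 / 2)"
    and B: "\<And>x. norm x \<le> 1 \<Longrightarrow> transfer s e (\<lambda>_. 1) x \<le> ennreal B" "1 \<le> B"
    and r: "r = root n (1 / 2)" and x: "norm x \<le> 1"
  shows "(transfer s e ^^ m) (\<lambda>_. 1) x \<le> ennreal (2 * B ^ n * r ^ m)"
  using x
proof (induction m arbitrary: x rule: less_induct)
  case (less m)
  have r0: "0 < r" "r \<le> 1" and rn: "r ^ n = 1 / 2"
    using n by (auto simp: r)
  show ?case
  proof (cases "m < n")
    case True
    have "1 / 2 \<le> r ^ m"
      unfolding rn[symmetric] using r0 True by (intro power_decreasing) auto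
    moreover have "B ^ m \<le> B ^ n"
      using True B(2) by (intro power_increasing) auto
    ultimately have "1 * B ^ m \<le> (2 * r ^ m) * B ^ n"
      using B(2) by (intro mult_mono) auto
    then have "ennreal (B ^ m) \<le> ennreal (2 * B ^ n * r ^ m)"
      by (intro ennreal_leI) (simp add: mult_ac)
    with transfer_pow_one_bounded[OF e B(1) _ order_refl less.prems, of m] B(2) show ?thesis
      by (auto intro: order_trans)
  next
    case False
    then have m: "m = (m - n) + n"
      by simp
    have "(transfer s e ^^ m) (\<lambda>_. 1) x = (transfer s e ^^ (m - n)) ((transfer s e ^^ n) (\<lambda>_. 1)) x"
      by (subst m, subst funpow_add) simp
    also have "\<dots> \<le> (transfer s e ^^ (m - n)) (\<lambda>_. ennreal (1 / 2) * 1) x"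
      using half by (intro transfer_pow_mono e less.prems) auto
    also have "\<dots> = ennreal (1 / 2) * (transfer s e ^^ (m - n)) (\<lambda>_. 1) x"
      by (rule transfer_pow_cmult)
    also have "\<dots> \<le> ennreal (1 / 2) * ennreal (2 * B ^ n * r ^ (m - n))"
      using False n less.prems by (intro mult_left_mono less.IH) auto
    also have "\<dots> = ennreal (2 * B ^ n * (r ^ (m - n) * (1 / 2)))"
      using B(2) r0 by (subst ennreal_mult[symmetric]) auto
    also have "r ^ (m - n) * (1 / 2) = r ^ m"
      by (subst (2) m) (simp only: power_add rn)
    finally show ?thesis .
  qed
qed

text \<open>
  If the sum were finite, the \<open>n\<close>-th iterate of the transfer operator would be a contraction for some
  \<open>n\<close>; by continuity this persists for a slightly smaller exponent, at which the Poincare series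
  would then still converge.
\<close>

lemma transfer_sum_infinite:
  assumes half: "1 / 2 < critical_exponent Gamma_hat"
  shows "(\<Sum>n. (transfer (critical_exponent Gamma_hat) (- 1 :: complex) ^^ n) (\<lambda>_. 1) 0) = \<infinity>"
proof (rule ccontr)
  define d where "d = critical_exponent Gamma_hat"
  let ?u = "\<lambda>s n. (transfer s (- 1 :: complex) ^^ n) (\<lambda>_. 1)"
  have d: "1 / 2 < d"
    using half by (simp add: d_def)
  assume "\<not> ?thesis"
  then have fin: "(\<Sum>n. ?u d n 0) \<noteq> \<top>"
    by (simp add: d_def)
  have un: "?u d n 0 \<noteq> \<top>" for n
    using fin sum_le_suminf[of "\<lambda>n. ?u d n 0" "{n}"] by (auto simp: top_unique)
  have "summable (\<lambda>n. enn2real (?u d n 0))"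
    using fin un by (intro summable_suminf_not_top) (auto simp: less_top)
  then have "(\<lambda>n. enn2real (?u d n 0)) \<longlonglongrightarrow> 0"
    by (rule summable_LIMSEQ_zero)
  \<comment> \<open>Passing from 0 to an arbitrary point of the unit ball costs at most the factor
    exp (3/2 * d), also at exponents below d; this threshold therefore yields the bound 1/2 on the
    whole ball.\<close>
  then have "eventually (\<lambda>n. enn2real (?u d n 0) < exp (- 3 / 2 * d) / 2) sequentially"
    by (rule order_tendstoD) simp
  then have "eventually (\<lambda>n. 0 < n \<and> enn2real (?u d n 0) < exp (- 3 / 2 * d) / 2) sequentially"
    by (intro eventually_conj eventually_gt_at_top)
  then obtain n where n: "0 < n" and "enn2real (?u d n 0) < exp (- 3 / 2 * d) / 2"
    by (auto simp: eventually_sequentially)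
  then have small: "?u d n 0 < ennreal (exp (- 3 / 2 * d) / 2)"
    using un[of n] by (cases "?u d n 0") (auto simp: ennreal_less_iff)
  \<comment> \<open>Exponents below d that converge to d and stay above the midpoint d / 2 + 1 / 4
    of 1/2 and d, hence in the range where the sums over the digits converge uniformly.\<close>
  define s where "s m = d - (d - 1 / 2) / 2 * inverse (real (Suc m))" for m
  have "(\<lambda>m. d - (d - 1 / 2) / 2 * inverse (real (Suc m))) \<longlonglongrightarrow> d - (d - 1 / 2) / 2 * 0"
    by (intro tendsto_intros LIMSEQ_inverse_real_of_nat)
  then have lim: "s \<longlonglongrightarrow> d"
    by (simp add: s_def[abs_def])
  have ge: "d / 2 + 1 / 4 \<le> s m" and lt: "s m < d" for m
  proof -
    have "0 < inverse (real (Suc m))" "inverse (real (Suc m)) \<le> 1"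
      by (auto simp: inverse_eq_divide)
    then have "0 < (d - 1 / 2) / 2 * inverse (real (Suc m))"
      and "(d - 1 / 2) / 2 * inverse (real (Suc m)) \<le> (d - 1 / 2) / 2 * 1"
      using d by (intro mult_pos_pos mult_left_mono; simp)+
    then show "d / 2 + 1 / 4 \<le> s m" "s m < d"
      by (auto simp: s_def)
  qed
  have s0: "1 / 2 < d / 2 + 1 / 4"
    using d by simp
  have "(\<lambda>m. ?u (s m) n 0) \<longlonglongrightarrow> ?u d n 0"
    by (rule transfer_pow_tendsto[OF _ s0 ge lim]) auto
  then have "eventually (\<lambda>m. ?u (s m) n 0 < ennreal (exp (- 3 / 2 * d) / 2)) sequentially"
    using small by (rule order_tendstoD)
  then obtain m where m: "?u (s m) n 0 < ennreal (exp (- 3 / 2 * d) / 2)"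
    by (auto simp: eventually_sequentially)
  define t where "t = s m"
  have t: "1 / 2 < t" "t < d"
    using ge[of m] lt[of m] s0 by (auto simp: t_def)
  have le: "?u t n x \<le> ennreal (1 / 2)" if x: "cmod x \<le> 1" for x
  proof -
    have lip: "log_lip (3 / 4 * t + 0 / 9 ^ n) (?u t n)"
      using t by (intro transfer_pow_log_lip log_lip_const) auto
    have "?u t n x \<le> ennreal (exp (3 / 4 * t * cmod x)) * ?u t n 0"
      using log_lipD[OF lip x, of 0] by simp
    also have "\<dots> \<le> ennreal (exp (3 / 2 * d)) * ennreal (exp (- 3 / 2 * d) / 2)"
    proof (intro mult_mono ennreal_leI)
      have "t * cmod x \<le> d * 1"
        using t x by (intro mult_mono) auto
      then show "exp (3 / 4 * t * cmod x) \<le> exp (3 / 2 * d)"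
        using d by simp
    qed (use m in \<open>auto simp: t_def\<close>)
    also have "\<dots> = ennreal (1 / 2)"
      by (simp flip: ennreal_mult exp_add)
    finally show ?thesis .
  qed
  obtain B where B: "1 \<le> B" "\<And>x. cmod x \<le> 1 \<Longrightarrow> transfer t (- 1) (\<lambda>_. 1) x \<le> ennreal B"
    using transfer_one_bounded[OF t(1), of "-1 :: complex"] by auto
  define r where "r = root n (1 / 2)"
  have r: "0 \<le> r" "r < 1"
    using n by (auto simp: r_def)
  \<comment> \<open>The hypothesis concerned the point 0, but decay was obtained on the whole
    complex ball, so it may be evaluated at i, where the Poincare series lives.\<close>
  have "(\<Sum>m. ?u t m \<i>) \<le> (\<Sum>m. ennreal (2 * B ^ n * r ^ m))"
    using B by (intro suminf_le geometric_decay[OF _ n le _ _ r_def]) auto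
  also have "\<dots> = ennreal (\<Sum>m. 2 * B ^ n * r ^ m)"
    using B(1) r by (intro suminf_ennreal2 summable_mult summable_geometric) auto
  also have "\<dots> < \<infinity>"
    by simp
  finally have "(\<lambda>g. exp (- t * hdist \<i> (psl_act g \<i>))) summable_on Gamma_hat"
    by (rule poincare_summable[OF t(1)])
  then have "critical_exponent Gamma_hat \<le> t"
    unfolding critical_exponent_def using t by (intro cInf_lower bdd_belowI[of _ 0]) auto
  then show False
    using t by (simp add: d_def)
qed

section \<open>From the Patterson-Sullivan density to a conformal measure\<close>

lemma limitin_sphere_Some_iff:
  "limitin (Alexandroff_compactification (euclidean :: 'a::t2_space topology)) (\<lambda>t. Some (c t)) (Some z) F
     \<longleftrightarrow> (c \<longlongrightarrow> z) F"
proof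
  assume L: "limitin (Alexandroff_compactification euclidean) (\<lambda>t. Some (c t)) (Some z) F"
  show "(c \<longlongrightarrow> z) F"
  proof (rule topological_tendstoI)
    fix S :: "'a set" assume "open S" "z \<in> S"
    then have "openin (Alexandroff_compactification euclidean) (Some ` S) \<and> Some z \<in> Some ` S"
      by simp
    then have "eventually (\<lambda>t. Some (c t) \<in> Some ` S) F"
      using L unfolding limitin_def by blast
    then show "eventually (\<lambda>t. c t \<in> S) F"
      by eventually_elim auto
  qed
next
  assume L: "(c \<longlongrightarrow> z) F"
  show "limitin (Alexandroff_compactification euclidean) (\<lambda>t. Some (c t)) (Some z) F"
    unfolding limitin_def
  proof (intro conjI allI impI)
    fix U assume U: "openin (Alexandroff_compactification euclidean) U \<and> Some z \<in> U"
    then have "eventually (\<lambda>t. c t \<in> Some -` U) F"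
      using L open_vimage_Some[of U] by (intro topological_tendstoD[OF L]) auto
    then show "eventually (\<lambda>t. Some (c t) \<in> U) F"
      by eventually_elim auto
  qed simp
qed

lemma geodesic_ray_vertical:
  "geodesic_ray_to (\<lambda>t. Complex r (exp (- t))) (Some r)"
  unfolding geodesic_ray_to_def
proof (intro conjI allI impI)
  fix s t :: real
  have "1 + (cmod (Complex r (exp (- s)) - Complex r (exp (- t))))\<^sup>2 / (2 * exp (- s) * exp (- t)) = cosh (s - t)"
  proof -
    have "(cmod (Complex r (exp (- s)) - Complex r (exp (- t))))\<^sup>2 = (exp (- s) - exp (- t))\<^sup>2"
      by (simp add: cmod_power2)
    moreover have "1 + (exp (- s) - exp (- t))\<^sup>2 / (2 * exp (- s) * exp (- t)) = cosh (s - t)"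
      by (simp add: cosh_field_def exp_minus exp_diff field_simps power2_eq_square)
    ultimately show ?thesis
      by simp
  qed
  also have "cosh (s - t) = cosh \<bar>s - t\<bar>"
    by (simp add: abs_if)
  finally show "hdist (Complex r (exp (- s))) (Complex r (exp (- t))) = \<bar>s - t\<bar>"
    by (simp only: hdist_def complex.sel arcosh_cosh_real abs_ge_zero)
next
  have "((\<lambda>t::real. exp (- t)) \<longlongrightarrow> 0) at_top"
    by (intro filterlim_compose[OF exp_at_bot] filterlim_uminus_at_bot_at_top)
  then have "((\<lambda>t::real. Complex r (exp (- t))) \<longlongrightarrow> Complex r 0) at_top"
    by (intro tendsto_Complex tendsto_const)
  then show "limitin riemann_sphere (\<lambda>t. Some (Complex r (exp (- t)))) (map_option complex_of_real (Some r)) at_top"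
    by (simp add: limitin_sphere_Some_iff complex_of_real_def)
qed (simp add: UHP_def)

text \<open>In hdist x w = ln (Q x w) - ln (Im w) the second term cancels in the difference, and Q
  extends continuously to the real line. The limit exists for every approach to r, so the Busemann
  value is independent of the ray.\<close>

lemma hdist_diff_tendsto:
  fixes r :: real
  assumes x: "x \<in> UHP" and y: "y \<in> UHP" and c: "eventually (\<lambda>t. c t \<in> UHP) F" "(c \<longlongrightarrow> of_real r) F"
  shows "((\<lambda>t. hdist x (c t) - hdist y (c t)) \<longlongrightarrow>
     ln ((cmod (x - of_real r))\<^sup>2 / Im x) - ln ((cmod (y - of_real r))\<^sup>2 / Im y)) F"
proof -
  \<comment> \<open>P is Im w times the hyperbolic cosine of the distance from x to w, and Q is Im w
    times its exponential.\<close>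
  define P where "P x w = Im w + (cmod (x - w))\<^sup>2 / (2 * Im x)" for x w
  define Q where "Q x w = P x w + sqrt ((P x w)\<^sup>2 - (Im w)\<^sup>2)" for x w
  have Pge: "Im w \<le> P x w" if "x \<in> UHP" for x w
    using that by (simp add: P_def UHP_def)
  have hd: "hdist x w = ln (Q x w) - ln (Im w)" if x: "x \<in> UHP" and w: "w \<in> UHP" for x w
  proof -
    have Im: "0 < Im x" "0 < Im w"
      using x w by (auto simp: UHP_def)
    define X where "X = 1 + (cmod (x - w))\<^sup>2 / (2 * Im x * Im w)"
    have X: "X = P x w / Im w"
      using Im by (simp add: X_def P_def field_simps)
    have X1: "1 \<le> X"
      using Im by (simp add: X_def)
    have "X\<^sup>2 - 1 = ((P x w)\<^sup>2 - (Im w)\<^sup>2) / (Im w)\<^sup>2"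
      using Im by (simp add: X field_simps)
    then have "sqrt (X\<^sup>2 - 1) = sqrt ((P x w)\<^sup>2 - (Im w)\<^sup>2) / Im w"
      using Im by (simp add: real_sqrt_divide)
    then have "X + sqrt (X\<^sup>2 - 1) = Q x w / Im w"
      by (simp add: X Q_def add_divide_distrib)
    moreover have "hdist x w = ln (X + sqrt (X\<^sup>2 - 1))"
      using X1 by (simp add: hdist_def X_def[symmetric] arcosh_real_def)
    moreover have "0 < Q x w"
      using Pge[OF x, of w] Im(2) by (simp add: Q_def add_pos_nonneg power_mono)
    ultimately show ?thesis
      using Im by (simp add: ln_div)
  qed
  have Qlim: "((\<lambda>t. ln (Q x (c t))) \<longlongrightarrow> ln ((cmod (x - of_real r))\<^sup>2 / Im x)) F" if x: "x \<in> UHP" for x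
  proof -
    have Im: "0 < Im x"
      using x by (simp add: UHP_def)
    then have ne: "x \<noteq> of_real r"
      by auto
    let ?p = "(cmod (x - of_real r))\<^sup>2 / (2 * Im x)"
    have p: "0 < ?p"
      using Im ne by simp
    have "((\<lambda>t. P x (c t)) \<longlongrightarrow> Im (of_real r) + ?p) F"
      unfolding P_def using c(2) Im by (intro tendsto_intros) auto
    then have P: "((\<lambda>t. P x (c t)) \<longlongrightarrow> ?p) F"
      by simp
    have "((\<lambda>t. Q x (c t)) \<longlongrightarrow> ?p + sqrt (?p\<^sup>2 - (Im (of_real r))\<^sup>2)) F"
      unfolding Q_def by (intro tendsto_intros P c(2))
    moreover have "?p + sqrt (?p\<^sup>2 - (Im (of_real r))\<^sup>2) = (cmod (x - of_real r))\<^sup>2 / Im x"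
      using p Im by (simp del: power_divide add: real_sqrt_abs)
    ultimately show ?thesis
      using Im ne by (intro tendsto_ln) auto
  qed
  have "((\<lambda>t. ln (Q x (c t)) - ln (Q y (c t))) \<longlongrightarrow>
     ln ((cmod (x - of_real r))\<^sup>2 / Im x) - ln ((cmod (y - of_real r))\<^sup>2 / Im y)) F"
    by (intro tendsto_diff Qlim x y)
  moreover have "eventually (\<lambda>t. ln (Q x (c t)) - ln (Q y (c t)) = hdist x (c t) - hdist y (c t)) F"
    using c(1) by eventually_elim (simp add: hd x y)
  ultimately show ?thesis
    by (rule Lim_transform_eventually)
qed

lemma busemann_Some:
  assumes "x \<in> UHP" "y \<in> UHP"
  shows "busemann (Some r) x y = ln ((cmod (x - of_real r))\<^sup>2 / Im x) - ln ((cmod (y - of_real r))\<^sup>2 / Im y)"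
proof -
  have lim: "((\<lambda>t. hdist x (c t) - hdist y (c t)) \<longlongrightarrow>
      ln ((cmod (x - of_real r))\<^sup>2 / Im x) - ln ((cmod (y - of_real r))\<^sup>2 / Im y)) at_top"
    if "geodesic_ray_to c (Some r)" for c
    using that assms
    by (intro hdist_diff_tendsto) (auto simp: geodesic_ray_to_def limitin_sphere_Some_iff eventually_at_top_linorder)
  show ?thesis
    unfolding busemann_def
  proof (rule the_equality)
    show "\<exists>c. geodesic_ray_to c (Some r) \<and> ((\<lambda>t. hdist x (c t) - hdist y (c t)) \<longlongrightarrow>
      ln ((cmod (x - of_real r))\<^sup>2 / Im x) - ln ((cmod (y - of_real r))\<^sup>2 / Im y)) at_top"
      using geodesic_ray_vertical lim by blast
  next
    fix b assume "\<exists>c. geodesic_ray_to c (Some r) \<and> ((\<lambda>t. hdist x (c t) - hdist y (c t)) \<longlongrightarrow> b) at_top"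
    then show "b = ln ((cmod (x - of_real r))\<^sup>2 / Im x) - ln ((cmod (y - of_real r))\<^sup>2 / Im y)"
      using lim tendsto_unique[OF trivial_limit_at_top_linorder] by blast
  qed
qed

lemma exp_busemann:
  assumes "x \<in> UHP" "y \<in> UHP"
  shows "exp (d * busemann (Some r) x y) = (((cmod (x - of_real r))\<^sup>2 / Im x) / ((cmod (y - of_real r))\<^sup>2 / Im y)) powr d"
proof -
  define p where "p x = (cmod (x - of_real r))\<^sup>2 / Im x" for x
  have "0 < p x" if "x \<in> UHP" for x
    using that unfolding p_def by (auto simp: UHP_def intro!: divide_pos_pos)
  from this[OF assms(1)] this[OF assms(2)] have "exp (d * (ln (p x) - ln (p y))) = (p x / p y) powr d"
    by (simp add: powr_def ln_div)
  then show ?thesis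
    by (simp only: busemann_Some[OF assms] p_def)
qed

section \<open>The Borel structure of the boundary\<close>

lemma space_boundary_borel [simp]: "space boundary_borel = UNIV"
  by (simp add: boundary_borel_def)

lemma Some_measurable [measurable]: "Some \<in> borel \<rightarrow>\<^sub>M boundary_borel"
  unfolding boundary_borel_def
proof (rule measurable_measure_of)
  fix U assume "U \<in> {U. openin boundary_top U}"
  then show "Some -` U \<inter> space borel \<in> sets borel"
    using open_vimage_Some[of U] by auto
qed auto

lemma sets_boundary_open: "openin boundary_top U \<Longrightarrow> U \<in> sets boundary_borel"
  by (auto simp: boundary_borel_def)

lemma range_Some_sets [measurable]: "range Some \<in> sets boundary_borel"
  by (intro sets_boundary_open) simp

lemma None_sets [measurable]: "{None} \<in> sets boundary_borel"
proof -
  have "space boundary_borel - range Some \<in> sets boundary_borel"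
    by (rule sets.compl_sets[OF range_Some_sets])
  moreover have "space boundary_borel - range Some = {None}"
    by (auto simp: notin_range_Some)
  ultimately show ?thesis
    by (simp only:)
qed

lemma the_measurable: "the \<in> borel_measurable (restrict_space boundary_borel (range Some))"
proof (rule borel_measurableI)
  fix S :: "real set" assume "open S"
  then have "Some ` S \<in> sets boundary_borel"
    by (intro sets_boundary_open) simp
  moreover have "the -` S \<inter> space (restrict_space boundary_borel (range Some)) = range Some \<inter> Some ` S"
    by (auto simp: space_restrict_space)
  ultimately show "the -` S \<inter> space (restrict_space boundary_borel (range Some)) \<in> sets (restrict_space boundary_borel (range Some))"
    by (auto simp: sets_restrict_space)
qed

text \<open>The real line is open in the boundary, so its complement {None} is Borel, and
  measurability is decided on the real line alone.\<close>

lemma sets_boundary_iff: "A \<in> sets boundary_borel \<longleftrightarrow> Some -` A \<in> sets borel"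
proof
  assume "A \<in> sets boundary_borel"
  from measurable_sets[OF Some_measurable this] show "Some -` A \<in> sets borel"
    by simp
next
  assume "Some -` A \<in> sets borel"
  from measurable_sets[OF the_measurable this]
  have "the -` (Some -` A) \<inter> range Some \<in> sets (restrict_space boundary_borel (range Some))"
    by (simp add: space_restrict_space)
  then have "the -` (Some -` A) \<inter> range Some \<in> sets boundary_borel"
    by (simp add: sets_restrict_space_iff)
  moreover have "A - range Some \<in> sets boundary_borel"
  proof (cases "None \<in> A")
    case True
    then have "A - range Some = {None}"
      by (auto simp: notin_range_Some)
    then show ?thesis
      by simp
  next
    case False
    then have "x \<in> range Some" if "x \<in> A" for x
      using that by (cases x) auto
    then have "A - range Some = {}"
      by blast
    then show ?thesis
      by (simp only: sets.empty_sets)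
  qed
  ultimately have "(the -` (Some -` A) \<inter> range Some) \<union> (A - range Some) \<in> sets boundary_borel"
    by (rule sets.Un)
  moreover have "(the -` (Some -` A) \<inter> range Some) \<union> (A - range Some) = A"
    by auto
  ultimately show "A \<in> sets boundary_borel"
    by (simp only:)
qed

lemma measurable_boundaryI:
  assumes "(\<lambda>x. f (Some x)) \<in> borel \<rightarrow>\<^sub>M K" "f None \<in> space K"
  shows "f \<in> boundary_borel \<rightarrow>\<^sub>M K"
proof (rule measurableI)
  fix x show "f x \<in> space K"
    using measurable_space[OF assms(1)] assms(2) by (cases x) auto
next
  fix A assume "A \<in> sets K"
  from measurable_sets[OF assms(1) this]
  show "f -` A \<inter> space boundary_borel \<in> sets boundary_borel"
    by (simp add: sets_boundary_iff vimage_def)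
qed

lemma nn_integral_boundary:
  assumes N: "sets N = sets boundary_borel" and f: "f \<in> borel_measurable boundary_borel"
  shows "(\<integral>\<^sup>+\<xi>. f \<xi> \<partial>N) = (\<integral>\<^sup>+x. f (Some x) \<partial>distr (restrict_space N (range Some)) borel the) + f None * emeasure N {None}"
proof -
  have sp: "space N = UNIV"
    using sets_eq_imp_space_eq[OF N] by simp
  have [measurable]: "range Some \<in> sets N" "{None} \<in> sets N" "f \<in> borel_measurable N"
    using N f by (simp_all cong: measurable_cong_sets)
  have the: "the \<in> borel_measurable (restrict_space N (range Some))"
    using the_measurable N by (simp cong: measurable_cong_sets sets_restrict_space_cong)
  have fS: "(\<lambda>x. f (Some x)) \<in> borel_measurable borel"
    using measurable_compose[OF Some_measurable f] .
  have "(\<integral>\<^sup>+\<xi>. f \<xi> \<partial>N) = (\<integral>\<^sup>+\<xi>. f \<xi> * indicator (range Some) \<xi> + f None * indicator {None} \<xi> \<partial>N)"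
  proof (intro nn_integral_cong)
    fix \<xi> show "f \<xi> = f \<xi> * indicator (range Some) \<xi> + f None * indicator {None} \<xi>"
      by (cases \<xi>) auto
  qed
  also have "\<dots> = (\<integral>\<^sup>+\<xi>. f \<xi> * indicator (range Some) \<xi> \<partial>N) + (\<integral>\<^sup>+\<xi>. f None * indicator {None} \<xi> \<partial>N)"
    by (rule nn_integral_add) auto
  also have "(\<integral>\<^sup>+\<xi>. f None * indicator {None} \<xi> \<partial>N) = f None * emeasure N {None}"
    by (rule nn_integral_cmult_indicator) simp
  also have "(\<integral>\<^sup>+\<xi>. f \<xi> * indicator (range Some) \<xi> \<partial>N) = (\<integral>\<^sup>+\<xi>. f \<xi> \<partial>restrict_space N (range Some))"
    by (subst nn_integral_restrict_space) (auto simp: sp)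
  also have "\<dots> = (\<integral>\<^sup>+\<xi>. f (Some (the \<xi>)) \<partial>restrict_space N (range Some))"
    by (intro nn_integral_cong) (auto simp: space_restrict_space)
  also have "\<dots> = (\<integral>\<^sup>+x. f (Some x) \<partial>distr (restrict_space N (range Some)) borel the)"
    by (rule nn_integral_distr[symmetric, OF the]) (use fS in simp)
  finally show ?thesis .
qed

section \<open>The density in Euclidean coordinates\<close>

locale ps_density =
  fixes \<nu> :: "complex \<Rightarrow> real option measure"
  assumes ps: "patterson_sullivan_density Gamma_hat \<nu>"
begin

abbreviation \<delta> :: real where "\<delta> \<equiv> critical_exponent Gamma_hat"

definition rho :: "real measure" where
  "rho = distr (restrict_space (\<nu> \<i>) (range Some)) borel the"

definition atom :: ennreal where "atom = emeasure (\<nu> \<i>) {None}"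

abbreviation mu :: "real measure" where "mu \<equiv> mu_PS Gamma_hat \<nu>"

text \<open>The density of \<open>mu\<close> with respect to \<open>rho\<close>; 1 + x^2 is the
  squared distance of i from x, and the Busemann term at i + x contributes the factor 1.\<close>

definition wt :: "real \<Rightarrow> ennreal" where "wt x = ennreal ((1 + x\<^sup>2) powr \<delta>)"

lemma wt_borel [measurable]: "wt \<in> borel_measurable borel"
  unfolding wt_def[abs_def] by simp

lemma nu_i: "finite_measure (\<nu> \<i>)" "sets (\<nu> \<i>) = sets boundary_borel" "emeasure (\<nu> \<i>) UNIV \<noteq> 0"
    "AE \<xi> in \<nu> \<i>. \<xi> \<in> limit_set Gamma_hat"
proof -
  show "finite_measure (\<nu> \<i>)" and sets: "sets (\<nu> \<i>) = sets boundary_borel"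
    and "AE \<xi> in \<nu> \<i>. \<xi> \<in> limit_set Gamma_hat"
    using ps unfolding patterson_sullivan_density_def by auto
  have "space (\<nu> \<i>) = UNIV"
    using sets_eq_imp_space_eq[OF sets] by simp
  then show "emeasure (\<nu> \<i>) UNIV \<noteq> 0"
    using ps unfolding patterson_sullivan_density_def by (metis \<i>_in_UHP)
qed

lemma nu_push:
  assumes "A \<in> Gamma_mat"
  shows "distr (\<nu> \<i>) boundary_borel (moebius_boundary A) = \<nu> (moebius A \<i>)"
proof -
  have "psl A \<in> Gamma_hat"
    using assms by (auto simp: Gamma_hat_eq)
  then have "distr (\<nu> \<i>) boundary_borel (psl_act_boundary (psl A)) = \<nu> (psl_act (psl A) \<i>)"
    using ps unfolding patterson_sullivan_density_def by auto
  then show ?thesis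
    by (simp add: psl_act_boundary_psl)
qed

lemma sets_rho [simp]: "sets rho = sets borel" and space_rho [simp]: "space rho = UNIV"
  by (simp_all add: rho_def)

lemma nn_integral_nu_i:
  assumes "f \<in> borel_measurable boundary_borel"
  shows "(\<integral>\<^sup>+\<xi>. f \<xi> \<partial>\<nu> \<i>) = (\<integral>\<^sup>+x. f (Some x) \<partial>rho) + f None * atom"
  unfolding rho_def atom_def by (rule nn_integral_boundary[OF nu_i(2) assms])

lemma measurable_rho_iff [simp]: "measurable rho K = measurable borel K"
  by (rule measurable_cong_sets) simp_all

text \<open>The inversion fixes i and hence preserves \<nu> at i. It carries the mass at infinity to
  0, which produces the atom term, and sends 0 out of the real line.\<close>

lemma rho_inversion:
  assumes [measurable]: "u \<in> borel_measurable borel"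
  shows "(\<integral>\<^sup>+x. u x \<partial>rho) = (\<integral>\<^sup>+x. (if x = 0 then 0 else u (- 1 / x)) \<partial>rho) + u 0 * atom"
proof -
  \<comment> \<open>Extension by 0 at infinity, so that on the left only the real line is
    integrated.\<close>
  let ?g = "case_option 0 u :: real option \<Rightarrow> ennreal"
  let ?m = "moebius_boundary inversion"
  have inv: "inversion \<in> Gamma_mat"
    using Gamma_mat.inversion[OF Gamma_mat.one] by simp
  have m_Some: "?m (Some x) = (if x = 0 then None else Some (- 1 / x))" for x
    by (simp add: inversion_def)
  have m_None: "?m None = Some 0"
    by (simp add: inversion_def)
  have g: "?g \<in> borel_measurable boundary_borel"
    by (rule measurable_boundaryI) auto
  have m: "?m \<in> boundary_borel \<rightarrow>\<^sub>M boundary_borel"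
  proof (rule measurable_boundaryI)
    show "(\<lambda>x. ?m (Some x)) \<in> borel \<rightarrow>\<^sub>M boundary_borel"
      unfolding m_Some by measurable
  qed simp
  have "distr (\<nu> \<i>) boundary_borel ?m = \<nu> \<i>"
    using nu_push[OF inv] by (simp add: moebius_inversion)
  then have "(\<integral>\<^sup>+\<xi>. ?g \<xi> \<partial>\<nu> \<i>) = (\<integral>\<^sup>+\<xi>. ?g \<xi> \<partial>distr (\<nu> \<i>) boundary_borel ?m)"
    by simp
  also have "\<dots> = (\<integral>\<^sup>+\<xi>. ?g (?m \<xi>) \<partial>\<nu> \<i>)"
    by (rule nn_integral_distr) (use m g nu_i(2) in \<open>simp_all cong: measurable_cong_sets\<close>)
  finally have "(\<integral>\<^sup>+\<xi>. ?g \<xi> \<partial>\<nu> \<i>) = (\<integral>\<^sup>+\<xi>. ?g (?m \<xi>) \<partial>\<nu> \<i>)" .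
  moreover have "(\<integral>\<^sup>+\<xi>. ?g \<xi> \<partial>\<nu> \<i>) = (\<integral>\<^sup>+x. u x \<partial>rho)"
    by (subst nn_integral_nu_i[OF g]) simp
  moreover have "(\<integral>\<^sup>+\<xi>. ?g (?m \<xi>) \<partial>\<nu> \<i>) = (\<integral>\<^sup>+x. ?g (?m (Some x)) \<partial>rho) + ?g (?m None) * atom"
    by (rule nn_integral_nu_i[OF measurable_compose[OF m g]])
  moreover have "(\<integral>\<^sup>+x. ?g (?m (Some x)) \<partial>rho) = (\<integral>\<^sup>+x. (if x = 0 then 0 else u (- 1 / x)) \<partial>rho)"
    unfolding m_Some by (intro nn_integral_cong) auto
  ultimately show ?thesis
    unfolding m_None by simp
qed

text \<open>Translation moves the base point from i to i + 4; the factor is the Radon-Nikodym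
  derivative that leads back to i.\<close>

lemma rho_shift:
  assumes [measurable]: "u \<in> borel_measurable borel"
  shows "(\<integral>\<^sup>+x. u (x + 4) \<partial>rho) = (\<integral>\<^sup>+x. ennreal (((1 + x\<^sup>2) / (1 + (x - 4)\<^sup>2)) powr \<delta>) * u x \<partial>rho)"
proof -
  let ?g = "case_option 0 u :: real option \<Rightarrow> ennreal"
  let ?m = "moebius_boundary (shear 4)"
  let ?z = "\<i> + 4 :: complex"
  let ?d = "\<lambda>\<xi>. ennreal (exp (\<delta> * busemann \<xi> \<i> ?z))"
  have mem: "shear 4 \<in> Gamma_mat"
    using Gamma_mat.shear[OF Gamma_mat.one, of 4] by simp
  have z: "?z \<in> UHP"
    by (simp add: UHP_def)
  have m_Some: "?m (Some x) = Some (x + 4)" for x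
    by (simp add: shear_def)
  have m_None: "?m None = None"
    by (simp add: shear_def)
  have d_Some: "?d (Some x) = ennreal (((1 + x\<^sup>2) / (1 + (x - 4)\<^sup>2)) powr \<delta>)" for x
  proof -
    have "(cmod (\<i> - of_real x))\<^sup>2 / Im \<i> = 1 + x\<^sup>2" "(cmod (?z - of_real x))\<^sup>2 / Im ?z = 1 + (x - 4)\<^sup>2"
      unfolding cmod_power2 by (simp_all add: power2_eq_square algebra_simps)
    then show ?thesis
      by (simp add: exp_busemann[OF \<i>_in_UHP z])
  qed
  have g: "?g \<in> borel_measurable boundary_borel"
    by (rule measurable_boundaryI) auto
  have m: "?m \<in> boundary_borel \<rightarrow>\<^sub>M boundary_borel"
  proof (rule measurable_boundaryI)
    show "(\<lambda>x. ?m (Some x)) \<in> borel \<rightarrow>\<^sub>M boundary_borel"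
      unfolding m_Some by measurable
  qed simp
  have d: "?d \<in> borel_measurable boundary_borel"
  proof (rule measurable_boundaryI)
    show "(\<lambda>x. ?d (Some x)) \<in> borel_measurable borel"
      unfolding d_Some by measurable
  qed simp
  have "(\<integral>\<^sup>+\<xi>. ?g \<xi> \<partial>\<nu> ?z) = (\<integral>\<^sup>+\<xi>. ?g \<xi> \<partial>distr (\<nu> \<i>) boundary_borel ?m)"
    using nu_push[OF mem] by (simp add: moebius_shear)
  also have "\<dots> = (\<integral>\<^sup>+\<xi>. ?g (?m \<xi>) \<partial>\<nu> \<i>)"
    by (rule nn_integral_distr) (use m g nu_i(2) in \<open>simp_all cong: measurable_cong_sets\<close>)
  also have "\<dots> = (\<integral>\<^sup>+x. ?g (?m (Some x)) \<partial>rho) + ?g (?m None) * atom"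
    by (rule nn_integral_nu_i[OF measurable_compose[OF m g]])
  also have "\<dots> = (\<integral>\<^sup>+x. u (x + 4) \<partial>rho)"
    unfolding m_Some m_None by simp
  finally have 1: "(\<integral>\<^sup>+\<xi>. ?g \<xi> \<partial>\<nu> ?z) = (\<integral>\<^sup>+x. u (x + 4) \<partial>rho)" .
  have "\<nu> ?z = density (\<nu> \<i>) ?d"
    using ps z unfolding patterson_sullivan_density_def by (metis \<i>_in_UHP)
  then have "(\<integral>\<^sup>+\<xi>. ?g \<xi> \<partial>\<nu> ?z) = (\<integral>\<^sup>+\<xi>. ?g \<xi> \<partial>density (\<nu> \<i>) ?d)"
    by simp
  also have "\<dots> = (\<integral>\<^sup>+\<xi>. ?d \<xi> * ?g \<xi> \<partial>\<nu> \<i>)"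
    by (rule nn_integral_density) (use d g nu_i(2) in \<open>simp_all cong: measurable_cong_sets\<close>)
  also have "\<dots> = (\<integral>\<^sup>+x. ?d (Some x) * ?g (Some x) \<partial>rho) + ?d None * ?g None * atom"
    by (rule nn_integral_nu_i) (use d g in measurable)
  also have "\<dots> = (\<integral>\<^sup>+x. ennreal (((1 + x\<^sup>2) / (1 + (x - 4)\<^sup>2)) powr \<delta>) * u x \<partial>rho)"
    unfolding d_Some by simp
  finally show ?thesis
    using 1 by simp
qed

lemma mu_eq: "mu = density rho wt"
proof -
  have "exp (\<delta> * busemann (Some x) \<i> (\<i> + complex_of_real x)) = (1 + x\<^sup>2) powr \<delta>" for x
  proof -
    have z: "\<i> + complex_of_real x \<in> UHP"
      by (simp add: UHP_def)
    have "(cmod (\<i> - of_real x))\<^sup>2 / Im \<i> = 1 + x\<^sup>2" "(cmod (\<i> + of_real x - of_real x))\<^sup>2 / Im (\<i> + of_real x) = 1"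
      unfolding cmod_power2 by (simp_all add: power2_eq_square algebra_simps)
    then show ?thesis
      by (simp add: exp_busemann[OF \<i>_in_UHP z])
  qed
  then show ?thesis
    by (simp add: mu_PS_def rho_def wt_def[abs_def])
qed

lemma sets_mu [simp]: "sets mu = sets borel" and space_mu [simp]: "space mu = UNIV"
  by (simp_all add: mu_eq)

lemma measurable_mu_iff [simp]: "measurable mu K = measurable borel K"
  by (rule measurable_cong_sets) simp_all

lemma nn_integral_mu:
  assumes "u \<in> borel_measurable borel"
  shows "(\<integral>\<^sup>+x. u x \<partial>mu) = (\<integral>\<^sup>+x. wt x * u x \<partial>rho)"
  unfolding mu_eq by (rule nn_integral_density) (use assms in auto)

text \<open>From wt (-1 / x) = wt x * |x| powr (- 2 * \<delta>) for nonzero x; the atom term keeps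
  coefficient 1 because wt 0 = 1. The value at 0 is separated since division by zero yields
  0.\<close>

lemma mu_inversion:
  assumes [measurable]: "u \<in> borel_measurable borel"
  shows "(\<integral>\<^sup>+x. u x \<partial>mu)
    = (\<integral>\<^sup>+x. (if x = 0 then 0 else ennreal (\<bar>x\<bar> powr (- 2 * \<delta>)) * u (- 1 / x)) \<partial>mu) + u 0 * atom"
proof -
  have "(\<integral>\<^sup>+x. u x \<partial>mu) = (\<integral>\<^sup>+x. wt x * u x \<partial>rho)"
    by (simp add: nn_integral_mu)
  also have "\<dots> = (\<integral>\<^sup>+x. (if x = 0 then 0 else wt (- 1 / x) * u (- 1 / x)) \<partial>rho) + wt 0 * u 0 * atom"
    by (rule rho_inversion) simp
  also have "wt 0 = 1"
    by (simp add: wt_def)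
  also have "(\<integral>\<^sup>+x. (if x = 0 then 0 else wt (- 1 / x) * u (- 1 / x)) \<partial>rho)
     = (\<integral>\<^sup>+x. wt x * (if x = 0 then 0 else ennreal (\<bar>x\<bar> powr (- 2 * \<delta>)) * u (- 1 / x)) \<partial>rho)"
  proof (intro nn_integral_cong)
    fix x :: real
    have "wt (- 1 / x) = wt x * ennreal (\<bar>x\<bar> powr (- 2 * \<delta>))" if "x \<noteq> 0"
    proof -
      have "1 + (- 1 / x)\<^sup>2 = (1 + x\<^sup>2) / \<bar>x\<bar>\<^sup>2"
        using that by (simp add: field_simps)
      then have "(1 + (- 1 / x)\<^sup>2) powr \<delta> = (1 + x\<^sup>2) powr \<delta> / (\<bar>x\<bar>\<^sup>2) powr \<delta>"
        by (simp only: powr_divide)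
      also have "(\<bar>x\<bar>\<^sup>2) powr \<delta> = \<bar>x\<bar> powr (2 * \<delta>)"
        using that powr_powr[of "\<bar>x\<bar>" 2 \<delta>] by (simp add: powr_numeral)
      finally show ?thesis
        by (simp add: wt_def powr_minus field_simps flip: ennreal_mult)
    qed
    then show "(if x = 0 then 0 else wt (- 1 / x) * u (- 1 / x))
        = wt x * (if x = 0 then 0 else ennreal (\<bar>x\<bar> powr (- 2 * \<delta>)) * u (- 1 / x))"
      by (simp add: mult.assoc)
  qed
  also have "\<dots> = (\<integral>\<^sup>+x. (if x = 0 then 0 else ennreal (\<bar>x\<bar> powr (- 2 * \<delta>)) * u (- 1 / x)) \<partial>mu)"
    by (rule nn_integral_mu[symmetric]) measurable
  finally show ?thesis
    by simp
qed

text \<open>The shifted weight wt (x - 4) cancels the denominator of the Busemann factor, leaving wt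
  x: the Euclidean weighting is what makes the measure periodic.\<close>

lemma mu_shift4:
  assumes [measurable]: "u \<in> borel_measurable borel"
  shows "(\<integral>\<^sup>+x. u (x + 4) \<partial>mu) = (\<integral>\<^sup>+x. u x \<partial>mu)"
proof -
  have "(\<integral>\<^sup>+x. u (x + 4) \<partial>mu) = (\<integral>\<^sup>+x. (\<lambda>y. wt (y - 4) * u y) (x + 4) \<partial>rho)"
    by (subst nn_integral_mu) simp_all
  also have "\<dots> = (\<integral>\<^sup>+x. ennreal (((1 + x\<^sup>2) / (1 + (x - 4)\<^sup>2)) powr \<delta>) * (wt (x - 4) * u x) \<partial>rho)"
    by (rule rho_shift) measurable
  also have "\<dots> = (\<integral>\<^sup>+x. wt x * u x \<partial>rho)"
  proof (intro nn_integral_cong)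
    fix x :: real
    have pos: "0 < 1 + x\<^sup>2" "0 < 1 + (x - 4)\<^sup>2"
      by (auto simp: add_pos_nonneg)
    have "((1 + x\<^sup>2) / (1 + (x - 4)\<^sup>2)) powr \<delta> * (1 + (x - 4)\<^sup>2) powr \<delta> = (1 + x\<^sup>2) powr \<delta>"
      using pos by (simp flip: powr_mult)
    then show "ennreal (((1 + x\<^sup>2) / (1 + (x - 4)\<^sup>2)) powr \<delta>) * (wt (x - 4) * u x) = wt x * u x"
      by (simp add: wt_def flip: ennreal_mult mult.assoc)
  qed
  also have "\<dots> = (\<integral>\<^sup>+x. u x \<partial>mu)"
    by (rule nn_integral_mu[symmetric]) measurable
  finally show ?thesis .
qed

lemma mu_shift:
  assumes u: "u \<in> borel_measurable borel" and k: "4 dvd k"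
  shows "(\<integral>\<^sup>+x. u (x + of_int k) \<partial>mu) = (\<integral>\<^sup>+x. u x \<partial>mu)"
proof -
  have "(\<integral>\<^sup>+x. u (x + of_int (4 * j)) \<partial>mu) = (\<integral>\<^sup>+x. u x \<partial>mu)" for j
  proof (induction j rule: int_induct[where k = 0])
    case (step1 i)
    have [measurable]: "(\<lambda>x. u (x + of_int (4 * i))) \<in> borel_measurable borel"
      using u by measurable
    have "(\<integral>\<^sup>+x. u (x + of_int (4 * (i + 1))) \<partial>mu) = (\<integral>\<^sup>+x. (\<lambda>x. u (x + of_int (4 * i))) (x + 4) \<partial>mu)"
      by (simp add: algebra_simps)
    also have "\<dots> = (\<integral>\<^sup>+x. u (x + of_int (4 * i)) \<partial>mu)"
      by (rule mu_shift4) measurable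
    finally show ?case
      using step1 by simp
  next
    case (step2 i)
    have [measurable]: "(\<lambda>x. u (x + of_int (4 * (i - 1)))) \<in> borel_measurable borel"
      using u by measurable
    have "(\<integral>\<^sup>+x. u (x + of_int (4 * (i - 1))) \<partial>mu) = (\<integral>\<^sup>+x. (\<lambda>x. u (x + of_int (4 * (i - 1)))) (x + 4) \<partial>mu)"
      by (rule mu_shift4[symmetric]) measurable
    also have "\<dots> = (\<integral>\<^sup>+x. u (x + of_int (4 * i)) \<partial>mu)"
      by (simp add: algebra_simps)
    finally show ?case
      using step2 by simp
  qed simp
  then show ?thesis
    using k by (auto elim!: dvdE)
qed

lemma AE_mu_limit_set: "AE x in mu. x \<in> real_limit_set Gamma_hat"
proof -
  have L: "real_limit_set Gamma_hat \<in> sets borel"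
    using closed_real_limit_set by (rule borel_closed)
  have the: "the \<in> borel_measurable (restrict_space (\<nu> \<i>) (range Some))"
    using the_measurable nu_i(2) by (simp cong: measurable_cong_sets sets_restrict_space_cong)
  have "AE \<xi> in restrict_space (\<nu> \<i>) (range Some). the \<xi> \<in> real_limit_set Gamma_hat"
  proof (subst AE_restrict_space_iff)
    show "range Some \<inter> space (\<nu> \<i>) \<in> sets (\<nu> \<i>)"
      using nu_i(2) by auto
    show "AE \<xi> in \<nu> \<i>. \<xi> \<in> range Some \<longrightarrow> the \<xi> \<in> real_limit_set Gamma_hat"
      using nu_i(4) by eventually_elim (auto simp: real_limit_set_def)
  qed
  then have "AE x in rho. x \<in> real_limit_set Gamma_hat"
    unfolding rho_def using L by (subst AE_distr_iff[OF the]) auto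
  then show ?thesis
    unfolding mu_eq by (subst AE_density) auto
qed

end

lemma abs_diff_round4_le: "\<bar>x - of_int (4 * round (x / 4))\<bar> \<le> (2::real)"
proof -
  have "\<bar>of_int (round (x / 4)) - x / 4\<bar> \<le> 1 / 2"
    by (rule of_int_round_abs_le)
  then show ?thesis
    unfolding abs_le_iff by simp
qed

text \<open>By the gap, x is within 1/3 of one multiple of 4 and farther than 2 from all others, so
  closed intervals sharing endpoints are not counted twice. If that multiple is 0, then -1 / x
  leaves [-2, 2]; otherwise |x| \<ge> 1 and it lies inside.\<close>

lemma sum_digits_indicator:
  assumes x: "x \<in> real_limit_set Gamma_hat"
  shows "(\<integral>\<^sup>+k. indicator {-2..2::real} (x - of_int k) \<partial>count_space digits)
     = (if x = 0 then 0 else indicator {-2..2} (- 1 / x) :: ennreal)"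
proof -
  define k0 where "k0 = 4 * round (x / 4)"
  have "\<bar>x - of_int k0\<bar> \<le> 2"
    unfolding k0_def by (rule abs_diff_round4_le)
  moreover have "x - of_int k0 \<in> real_limit_set Gamma_hat"
    using limit_set_shift[OF x, of "- k0"] by (simp add: k0_def)
  ultimately have k0: "\<bar>x - of_int k0\<bar> \<le> 1 / 3"
    by (intro limit_set_gap)
  have other: "indicator {-2..2::real} (x - of_int k) = (0::ennreal)" if "k \<in> digits" "k \<noteq> k0" for k
  proof -
    obtain j where j: "k = 4 * j"
      using \<open>k \<in> digits\<close> by (auto simp: digits_def)
    then have "4 \<le> \<bar>k - k0\<bar>"
      using \<open>k \<noteq> k0\<close> by (simp add: k0_def)
    then have "4 \<le> \<bar>real_of_int k - real_of_int k0\<bar>"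
      by linarith
    then have "2 < \<bar>x - of_int k\<bar>"
      using k0 by linarith
    then show ?thesis
      by (auto simp: indicator_def)
  qed
  show ?thesis
  proof (cases "k0 = 0")
    case True
    have "(\<integral>\<^sup>+k. indicator {-2..2::real} (x - of_int k) \<partial>count_space digits) = (\<integral>\<^sup>+k. 0 \<partial>count_space digits)"
      using other True by (intro nn_integral_cong) (auto simp: digits_def)
    moreover have "2 < \<bar>- 1 / x\<bar>" if "x \<noteq> 0"
      using k0 that by (simp add: True field_simps abs_if split: if_splits)
    then have "(if x = 0 then 0 else indicator {-2..2} (- 1 / x) :: ennreal) = 0"
      by (auto simp: indicator_def)
    ultimately show ?thesis
      by simp
  next
    case False
    then have "k0 \<in> digits"
      by (simp add: digits_def k0_def)
    then have "(\<integral>\<^sup>+k. indicator {-2..2::real} (x - of_int k) \<partial>count_space digits)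
        = (\<Sum>k\<in>{k0}. indicator {-2..2::real} (x - of_int k))"
      using other by (intro nn_integral_count_space') auto
    also have "\<dots> = 1"
    proof -
      have "x - of_int k0 \<in> {-2..2}"
        using k0 unfolding atLeastAtMost_iff by (intro conjI; linarith)
      then show ?thesis
        by (simp only: sum.insert finite.emptyI sum.empty empty_iff not_False_eq_True indicator_simps add_0_right)
    qed
    finally have 1: "(\<integral>\<^sup>+k. indicator {-2..2::real} (x - of_int k) \<partial>count_space digits) = 1" .
    have "4 \<le> \<bar>real_of_int k0\<bar>"
      using digits_abs_ge[OF \<open>k0 \<in> digits\<close>] by linarith
    then have "1 \<le> \<bar>x\<bar>"
      using k0 by linarith
    then have "x \<noteq> 0" "\<bar>- 1 / x\<bar> \<le> 1"
      by (auto simp: field_simps)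
    moreover have "- 1 / x \<in> {-2..2}"
      using \<open>\<bar>- 1 / x\<bar> \<le> 1\<close> unfolding atLeastAtMost_iff by (intro conjI; linarith)
    ultimately show ?thesis
      using 1 by (simp only: indicator_simps if_False)
  qed
qed

lemma transfer_of_real:
  "transfer s (- 1 :: 'a::real_normed_field) u (of_real x) = transfer s (- 1) (\<lambda>y. u (of_real y)) x"
proof -
  have "norm (of_int k + of_real x :: 'a) = \<bar>of_int k + x\<bar>" for k
    by (metis norm_of_real of_real_add of_real_of_int_eq)
  then show ?thesis
    by (simp add: transfer_def)
qed

text \<open>The bridge between the two sides of the argument: the atom identity involves the real
  operator, the Poincare series the complex one, and they agree at 0.\<close>

lemma transfer_pow_of_real:
  "(transfer s (- 1 :: 'a::real_normed_field) ^^ n) u (of_real x) = (transfer s (- 1) ^^ n) (\<lambda>y. u (of_real y)) x"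
proof (induction n arbitrary: x)
  case (Suc n)
  then show ?case
    by (simp add: transfer_of_real)
qed simp

lemma transfer_reflect:
  "transfer s e (\<lambda>y. u (- y)) x = transfer s e u (- x)"
proof -
  let ?f = "\<lambda>k. ennreal (norm (of_int k - x) powr (- 2 * s)) * u (e / (of_int k - x))"
  have "transfer s e u (- x) = (\<integral>\<^sup>+k. ?f k \<partial>count_space digits)"
    by (simp add: transfer_def)
  also have "\<dots> = (\<integral>\<^sup>+k. ?f (- k) \<partial>count_space digits)"
    by (rule nn_integral_bij_count_space[symmetric]) (auto simp: bij_betw_def inj_on_def image_iff intro!: bexI[of _ "- _"])
  also have "\<dots> = transfer s e (\<lambda>y. u (- y)) x"
  proof -
    have "of_int (- k) - x = - (of_int k + x)" for k
      by simp
    then show ?thesis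
      by (simp only: transfer_def norm_minus_cancel divide_minus_right)
  qed
  finally show ?thesis ..
qed

section \<open>The restricted measure and its conformality\<close>

context ps_density
begin

definition M :: "real measure" where "M = density mu (indicator {-2..2})"

lemma sets_M [simp]: "sets M = sets borel" and space_M [simp]: "space M = UNIV"
  by (simp_all add: M_def)

lemma measurable_M_iff [simp]: "measurable M K = measurable borel K"
  by (rule measurable_cong_sets) simp_all

lemma nn_integral_M:
  assumes "u \<in> borel_measurable borel"
  shows "(\<integral>\<^sup>+x. u x \<partial>M) = (\<integral>\<^sup>+x. indicator {-2..2} x * u x \<partial>mu)"
  unfolding M_def by (rule nn_integral_density) (use assms in auto)

lemma AE_M: "AE x in M. x \<in> real_limit_set Gamma_hat \<and> \<bar>x\<bar> \<le> 1 / 3"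
  unfolding M_def
proof (subst AE_density)
  show "AE x in mu. 0 < (indicator {-2..2} x :: ennreal) \<longrightarrow> x \<in> real_limit_set Gamma_hat \<and> \<bar>x\<bar> \<le> 1 / 3"
    using AE_mu_limit_set by eventually_elim (use limit_set_gap in \<open>auto simp: indicator_def abs_le_iff\<close>)
qed simp

lemma AE_M_ball: "AE x in M. \<bar>x\<bar> \<le> 1"
  using AE_M by eventually_elim auto

lemma emeasure_rho_UNIV: "emeasure (\<nu> \<i>) UNIV = emeasure rho UNIV + atom"
proof -
  have "space (\<nu> \<i>) = UNIV"
    using sets_eq_imp_space_eq[OF nu_i(2)] by simp
  then show ?thesis
    using nn_integral_nu_i[of "\<lambda>_. 1"] by simp
qed

lemma finite_rho: "emeasure rho UNIV < \<infinity>"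
proof -
  have "emeasure rho UNIV \<le> emeasure (\<nu> \<i>) UNIV"
    unfolding emeasure_rho_UNIV by simp
  also have "\<dots> < \<infinity>"
    using finite_measure.emeasure_finite[OF nu_i(1), of UNIV] by (simp add: top.not_eq_extremum)
  finally show ?thesis .
qed

lemma finite_M: "finite_measure M"
proof (rule finite_measureI)
  have "emeasure M (space M) = (\<integral>\<^sup>+x. 1 \<partial>M)"
    by simp
  also have "\<dots> = (\<integral>\<^sup>+x. wt x * indicator {-2..2} x \<partial>rho)"
    by (subst nn_integral_M, simp, subst nn_integral_mu) simp_all
  also have "\<dots> \<le> (\<integral>\<^sup>+x. ennreal (5 powr \<bar>\<delta>\<bar>) \<partial>rho)"
  proof (intro nn_integral_mono)
    fix x :: real
    \<comment> \<open>The sign of \<delta> is still unknown at this point, whence its absolute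
      value; 5 is 1 + 2^2.\<close>
    have "(1 + x\<^sup>2) powr \<delta> \<le> 5 powr \<bar>\<delta>\<bar>" if "\<bar>x\<bar> \<le> 2"
    proof -
      have "x\<^sup>2 \<le> 2\<^sup>2"
        using that power_mono[of "\<bar>x\<bar>" 2 2] by simp
      then have "(1 + x\<^sup>2) powr \<bar>\<delta>\<bar> \<le> 5 powr \<bar>\<delta>\<bar>"
        by (intro powr_mono2) auto
      moreover have "(1 + x\<^sup>2) powr \<delta> \<le> (1 + x\<^sup>2) powr \<bar>\<delta>\<bar>"
        by (intro powr_mono) auto
      ultimately show ?thesis
        by linarith
    qed
    then show "wt x * indicator {-2..2} x \<le> ennreal (5 powr \<bar>\<delta>\<bar>)"
      by (auto simp: wt_def indicator_def intro!: ennreal_leI)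
  qed
  also have "\<dots> < \<infinity>"
    using finite_rho by (simp add: ennreal_mult_less_top)
  finally show "emeasure M (space M) \<noteq> \<infinity>"
    by simp
qed

sublocale M: finite_measure M
  by (rule finite_M)

text \<open>
  By inversion, \<open>[-2, 2]\<close> corresponds to the complement of the interval around \<open>0\<close>, which up to a
  null set is the disjoint union of the translates of \<open>[-2, 2]\<close> by the digits.
\<close>

lemma M_transfer_atom:
  assumes u [measurable]: "u \<in> borel_measurable borel"
  shows "(\<integral>\<^sup>+x. u x \<partial>M) = u 0 * atom + (\<integral>\<^sup>+x. transfer \<delta> (- 1) u x \<partial>M)"
proof -
  let ?I = "indicator {-2..2::real} :: real \<Rightarrow> ennreal"
  let ?w = "\<lambda>x. ennreal (\<bar>x\<bar> powr (- 2 * \<delta>)) * u (- 1 / x)"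
  have "(\<integral>\<^sup>+x. u x \<partial>M) = (\<integral>\<^sup>+x. ?I x * u x \<partial>mu)"
    by (rule nn_integral_M[OF u])
  also have "\<dots> = (\<integral>\<^sup>+x. (if x = 0 then 0 else ennreal (\<bar>x\<bar> powr (- 2 * \<delta>)) * (?I (- 1 / x) * u (- 1 / x))) \<partial>mu)
      + ?I 0 * u 0 * atom"
    by (rule mu_inversion) measurable
  also have "?I 0 * u 0 * atom = u 0 * atom"
    by simp
  also have "(\<integral>\<^sup>+x. (if x = 0 then 0 else ennreal (\<bar>x\<bar> powr (- 2 * \<delta>)) * (?I (- 1 / x) * u (- 1 / x))) \<partial>mu)
      = (\<integral>\<^sup>+x. \<integral>\<^sup>+k. ?I (x - of_int k) * ?w x \<partial>count_space digits \<partial>mu)"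
  proof (rule nn_integral_cong_AE, use AE_mu_limit_set in eventually_elim)
    fix x assume x: "x \<in> real_limit_set Gamma_hat"
    have "(\<integral>\<^sup>+k. ?I (x - of_int k) * ?w x \<partial>count_space digits)
       = (\<integral>\<^sup>+k. ?I (x - of_int k) \<partial>count_space digits) * ?w x"
      by (rule nn_integral_multc) simp
    then show "(if x = 0 then 0 else ennreal (\<bar>x\<bar> powr (- 2 * \<delta>)) * (?I (- 1 / x) * u (- 1 / x)))
       = (\<integral>\<^sup>+k. ?I (x - of_int k) * ?w x \<partial>count_space digits)"
      by (simp add: sum_digits_indicator[OF x] mult_ac)
  qed
  also have "\<dots> = (\<integral>\<^sup>+k. \<integral>\<^sup>+x. ?I (x - of_int k) * ?w x \<partial>mu \<partial>count_space digits)"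
    by (rule nn_integral_count_space_nn_integral[OF countable_digits]) simp
  also have "\<dots> = (\<integral>\<^sup>+k. \<integral>\<^sup>+x. ?I x * ?w (x + of_int k) \<partial>mu \<partial>count_space digits)"
  proof (rule nn_integral_cong)
    fix k assume "k \<in> space (count_space digits)"
    then have k: "4 dvd k"
      by (simp add: digits_def)
    have "(\<integral>\<^sup>+x. (\<lambda>x. ?I (x - of_int k) * ?w x) (x + of_int k) \<partial>mu) = (\<integral>\<^sup>+x. ?I (x - of_int k) * ?w x \<partial>mu)"
      by (rule mu_shift[OF _ k]) measurable
    then show "(\<integral>\<^sup>+x. ?I (x - of_int k) * ?w x \<partial>mu) = (\<integral>\<^sup>+x. ?I x * ?w (x + of_int k) \<partial>mu)"
      by simp
  qed
  also have "\<dots> = (\<integral>\<^sup>+x. \<integral>\<^sup>+k. ?I x * ?w (x + of_int k) \<partial>count_space digits \<partial>mu)"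
    by (rule nn_integral_count_space_nn_integral[OF countable_digits, symmetric]) simp
  also have "\<dots> = (\<integral>\<^sup>+x. ?I x * transfer \<delta> (- 1) u x \<partial>mu)"
    by (intro nn_integral_cong) (simp add: transfer_def nn_integral_cmult add.commute)
  also have "\<dots> = (\<integral>\<^sup>+x. transfer \<delta> (- 1) u x \<partial>M)"
    by (rule nn_integral_M[symmetric]) (rule transfer_borel[OF u])
  finally show ?thesis
    by (simp add: add.commute)
qed

text \<open>If M vanished, the transfer identity for the constant 1 would remove the atom, and since
  the translates of [-2, 2] by multiples of 4 cover the line, \<open>mu\<close> and
  \<open>rho\<close> would vanish as well, leaving no mass to \<nu> at i.\<close>

lemma M_nonzero: "emeasure M UNIV \<noteq> 0"
proof
  assume 0: "emeasure M UNIV = 0"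
  have "0 = (\<integral>\<^sup>+x. 1 \<partial>M)"
    using 0 by simp
  also have "\<dots> = 1 * atom + (\<integral>\<^sup>+x. transfer \<delta> (- 1) (\<lambda>_. 1) x \<partial>M)"
    by (rule M_transfer_atom) simp
  finally have atom: "atom = 0"
    by simp
  have int0: "(\<integral>\<^sup>+x. indicator {-2..2} x \<partial>mu) = 0"
    using 0 nn_integral_M[of "\<lambda>_. 1"] by simp
  have "AE x in mu. x + of_int (4 * j) \<notin> {-2..2}" for j
  proof -
    have "(\<integral>\<^sup>+x. indicator {-2..2} (x + of_int (4 * j)) \<partial>mu) = 0"
      using mu_shift[of "indicator {-2..2}" "4 * j"] int0 by simp
    then have "AE x in mu. (indicator {-2..2} (x + of_int (4 * j)) :: ennreal) = 0"
      by (subst (asm) nn_integral_0_iff_AE) auto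
    then show ?thesis
      by eventually_elim (auto simp: indicator_def split: if_splits)
  qed
  then have "AE x in mu. \<forall>j::int. x + of_int (4 * j) \<notin> {-2..2}"
    by (simp add: AE_all_countable)
  then have "AE x in mu. False"
  proof eventually_elim
    fix x :: real assume x: "\<forall>j::int. x + of_int (4 * j) \<notin> {-2..2}"
    have "x + of_int (4 * (- round (x / 4))) \<in> {-2..2}"
      using abs_diff_round4_le[of x] by (simp add: abs_le_iff)
    with x show False
      by blast
  qed
  moreover have "0 < wt x" for x
  proof -
    have "0 < 1 + x\<^sup>2"
      by (simp add: add_pos_nonneg)
    then show ?thesis
      by (simp add: wt_def)
  qed
  ultimately have "AE x in rho. False"
    unfolding mu_eq by (subst (asm) AE_density) auto
  then have "emeasure rho UNIV = 0"
    using emeasure_eq_0_AE[of "\<lambda>_. True" rho] by simp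
  then show False
    using emeasure_rho_UNIV atom nu_i(3) by simp
qed

text \<open>For \<delta> \<le> 1/2 the sum of the weights over the digits diverges at every point of
  the ball, whereas its integral is bounded by the finite positive mass of M.\<close>

lemma delta_gt_half: "1 / 2 < \<delta>"
proof (rule ccontr)
  assume "\<not> 1 / 2 < \<delta>"
  then have d: "\<delta> \<le> 1 / 2"
    by simp
  \<comment> \<open>The Lipschitz bound needs a nonnegative exponent and \<delta> could still be
    negative, so divergence is spread at the exponent 1/2 and passed on by monotonicity in the
    exponent.\<close>
  have lip: "log_lip (2 * (1 / 2) / 3 + 0 / 9) (transfer (1 / 2) (- 1 :: real) (\<lambda>_. 1))"
    by (intro transfer_log_lip log_lip_const) auto
  have inf: "transfer \<delta> (- 1) (\<lambda>_. 1) x = \<infinity>" if x: "\<bar>x\<bar> \<le> 1" for x :: real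
  proof -
    have "\<infinity> = transfer (1 / 2) (- 1 :: real) (\<lambda>_. 1) 0"
      unfolding transfer_one_0 using sum_digits_powr_infinite[of "1 / 2"] by simp
    also have "\<dots> \<le> ennreal (exp ((2 * (1 / 2) / 3 + 0 / 9) * norm (0 - x))) * transfer (1 / 2) (- 1) (\<lambda>_. 1) x"
      using x by (intro log_lipD[OF lip]) auto
    finally have "transfer (1 / 2) (- 1) (\<lambda>_. 1) x = \<infinity>"
      by (auto simp: top_unique ennreal_mult_eq_top_iff)
    then show ?thesis
      using transfer_antimono[OF d, of x "-1" "\<lambda>_. 1"] x by (auto simp: top_unique)
  qed
  have "(\<integral>\<^sup>+x. \<infinity> \<partial>M) = (\<integral>\<^sup>+x. transfer \<delta> (- 1) (\<lambda>_. 1) x \<partial>M)"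
    using AE_M_ball by (intro nn_integral_cong_AE, eventually_elim) (simp add: inf)
  also have "\<dots> \<le> (\<integral>\<^sup>+x. 1 \<partial>M)"
    using M_transfer_atom[of "\<lambda>_. 1"] by simp
  finally show False
    using M_nonzero by (simp add: ennreal_top_mult top_unique)
qed

lemma atom_eq_0: "atom = 0"
proof (rule ccontr)
  assume "atom \<noteq> 0"
  let ?u = "\<lambda>n. (transfer \<delta> (- 1 :: real) ^^ n) (\<lambda>_. 1)"
  have step: "emeasure M UNIV = (\<Sum>j<n. ?u j 0) * atom + (\<integral>\<^sup>+x. ?u n x \<partial>M)" for n
  proof (induction n)
    case (Suc n)
    have "(\<integral>\<^sup>+x. ?u n x \<partial>M) = ?u n 0 * atom + (\<integral>\<^sup>+x. ?u (Suc n) x \<partial>M)"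
      using M_transfer_atom[OF transfer_pow_borel, of "\<lambda>_. 1" n \<delta> "-1"] by simp
    then show ?case
      by (simp add: Suc distrib_right add.assoc)
  qed simp
  have "(\<Sum>j<n. ?u j 0) * atom \<le> emeasure M UNIV" for n
    by (subst step[of n]) simp
  moreover have "(\<Sum>j. ?u j 0) * atom = (SUP n. (\<Sum>j<n. ?u j 0) * atom)"
    by (simp add: suminf_eq_SUP SUP_mult_right_ennreal)
  ultimately have "(\<Sum>j. ?u j 0) * atom \<le> emeasure M UNIV"
    by (auto intro: SUP_least)
  moreover have "(\<Sum>j. ?u j 0) = \<infinity>"
    using transfer_sum_infinite[OF delta_gt_half] transfer_pow_of_real[where 'a = complex and x = 0 and u = "\<lambda>_. 1"]
    by simp
  ultimately show False
    using \<open>atom \<noteq> 0\<close> by (simp add: ennreal_top_mult top_unique)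
qed

lemma conformal_M: "conformal \<delta> (- 1) M"
  unfolding conformal_def using M_transfer_atom atom_eq_0 by auto

text \<open>
  The Gauss map differs from the one coming from the group, \<open>x \<mapsto> - 1 / x - k\<close>, by the reflection
  \<open>x \<mapsto> - x\<close>. By uniqueness of the conformal measure, \<open>M\<close> is invariant under this reflection.
\<close>

lemma M_reflect: "distr M borel uminus = M"
proof (rule conformal_unique[where s = \<delta> and e = "-1"])
  have m: "uminus \<in> M \<rightarrow>\<^sub>M (borel :: real measure)"
    by simp
  show "finite_measure (distr M borel uminus)"
    by (rule M.finite_measure_distr[OF m])
  show "AE x in distr M borel uminus. \<bar>x\<bar> \<le> 1"
    using AE_M_ball by (subst AE_distr_iff[OF m]) auto
  show "measure (distr M borel uminus) UNIV = measure M UNIV"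
    by (subst measure_distr[OF m]) simp_all
  show "conformal \<delta> (- 1) (distr M borel uminus)"
    unfolding conformal_def
  proof
    fix u :: "real \<Rightarrow> ennreal" assume u [measurable]: "u \<in> borel_measurable borel"
    have "(\<integral>\<^sup>+x. u x \<partial>distr M borel uminus) = (\<integral>\<^sup>+x. u (- x) \<partial>M)"
      by (rule nn_integral_distr[OF m]) simp
    also have "\<dots> = (\<integral>\<^sup>+x. transfer \<delta> (- 1) (\<lambda>x. u (- x)) x \<partial>M)"
      by (rule conformalD[OF conformal_M]) simp
    also have "\<dots> = (\<integral>\<^sup>+x. transfer \<delta> (- 1) u (- x) \<partial>M)"
      by (simp add: transfer_reflect)
    also have "\<dots> = (\<integral>\<^sup>+x. transfer \<delta> (- 1) u x \<partial>distr M borel uminus)"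
      by (rule nn_integral_distr[OF m, symmetric]) (simp add: transfer_borel)
    finally show "(\<integral>\<^sup>+x. u x \<partial>distr M borel uminus) = (\<integral>\<^sup>+x. transfer \<delta> (- 1) u x \<partial>distr M borel uminus)" .
  qed
qed (use finite_M AE_M_ball conformal_M delta_gt_half in auto)

lemma conformal_M_plus: "conformal \<delta> 1 M"
  unfolding conformal_def
proof
  fix u :: "real \<Rightarrow> ennreal" assume u [measurable]: "u \<in> borel_measurable borel"
  have "(\<integral>\<^sup>+x. u x \<partial>M) = (\<integral>\<^sup>+x. u x \<partial>distr M borel uminus)"
    by (simp add: M_reflect)
  also have "\<dots> = (\<integral>\<^sup>+x. u (- x) \<partial>M)"
    by (rule nn_integral_distr) simp_all
  also have "\<dots> = (\<integral>\<^sup>+x. transfer \<delta> (- 1) (\<lambda>x. u (- x)) x \<partial>M)"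
    by (rule conformalD[OF conformal_M]) simp
  also have "\<dots> = (\<integral>\<^sup>+x. transfer \<delta> 1 u x \<partial>M)"
    by (simp add: transfer_def)
  finally show "(\<integral>\<^sup>+x. u x \<partial>M) = (\<integral>\<^sup>+x. transfer \<delta> 1 u x \<partial>M)" .
qed

end

section \<open>The Gauss map\<close>

text \<open>A total Borel function that agrees with \<open>gauss_map\<close> on the nonzero points
  of the limit set in [-2, 2], see \<open>gauss_map_eq\<close>. The digit removed is a multiple of 4
  nearest to 1 / x.\<close>

definition gauss_fun :: "real \<Rightarrow> real" where
  "gauss_fun x = 1 / x - of_int (4 * round (1 / x / 4))"

lemma gauss_fun_borel [measurable]: "gauss_fun \<in> borel_measurable borel"
  unfolding gauss_fun_def[abs_def] round_def by measurable

lemma gauss_fun_branch: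
  assumes k: "k \<in> digits" and y: "\<bar>y\<bar> < 2"
  shows "gauss_fun (1 / (of_int k + y)) = y"
proof -
  obtain j where j: "k = 4 * j"
    using k by (auto simp: digits_def)
  have "round ((of_int k + y) / 4) = j"
    by (rule round_unique) (use y in \<open>simp_all add: j field_simps abs_less_iff\<close>)
  then show ?thesis
    by (simp add: gauss_fun_def j)
qed

lemma cfrac_0_Cons: "cfrac 0 (a # as) = 1 / (of_int a + cfrac 0 as)"
  by (cases as) auto

lemma cfrac_0_bound:
  assumes "set as \<subseteq> digits"
  shows "\<bar>cfrac 0 as\<bar> \<le> 1 / 3"
  using assms
proof (induction as)
  case (Cons a as)
  have "norm (1 / (of_int a + cfrac 0 as)) \<le> 1 / 3"
    using Cons by (intro norm_branch_le) auto
  then show ?case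
    unfolding cfrac_0_Cons by simp
qed simp

text \<open>Both clauses of \<open>gauss_rel\<close> lead to one equation, from which rounding 1 / x
  recovers the digit and y; this yields uniqueness in the description defining
  \<open>gauss_map\<close>.\<close>

lemma gauss_rel_imp:
  assumes "gauss_rel x y"
  obtains a where "a \<in> digits" "\<bar>y\<bar> \<le> 1 / 3" "x = 1 / (of_int a + y)"
proof -
  consider (fin) a as where "set (a # as) \<subseteq> digits" "x = cfrac 0 (a # as)" "y = cfrac 0 as"
    | (inf) a where "range a \<subseteq> digits" "cfrac_converges a x" "cfrac_converges (\<lambda>n. a (Suc n)) y"
    using assms unfolding gauss_rel_def by blast
  then show thesis
  proof cases
    case fin
    then show thesis
      using cfrac_0_bound[of as] by (intro that[of a]) (simp_all only: cfrac_0_Cons, auto)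
  next
    case inf
    let ?y = "\<lambda>n. cfrac 0 (map (\<lambda>n. a (Suc n)) [0..<n])"
    have lim: "?y \<longlonglongrightarrow> y"
      using inf(3) by (simp add: cfrac_converges_def)
    have "\<bar>?y n\<bar> \<le> 1 / 3" for n
      using inf(1) by (intro cfrac_0_bound) auto
    then have y: "\<bar>y\<bar> \<le> 1 / 3"
      by (intro LIMSEQ_le_const2[OF tendsto_rabs[OF lim]]) auto
    have a0: "a 0 \<in> digits"
      using inf(1) by auto
    have "3 \<le> \<bar>of_int (a 0) + y\<bar>"
      using norm_digit_plus_ge(2)[OF a0, of y] y by auto
    then have "(\<lambda>n. 1 / (of_int (a 0) + ?y n)) \<longlonglongrightarrow> 1 / (of_int (a 0) + y)"
      by (intro tendsto_intros lim) auto
    moreover have "(\<lambda>n. cfrac 0 (map a [0..<Suc n])) \<longlonglongrightarrow> x"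
      using inf(2) unfolding cfrac_converges_def by (rule LIMSEQ_Suc)
    ultimately have "x = 1 / (of_int (a 0) + y)"
      unfolding map_upt_Suc cfrac_0_Cons by (intro LIMSEQ_unique)
    then show thesis
      using that a0 y by blast
  qed
qed

text \<open>Replacing the tail after n digits by 0 makes an error of at most 1, and each branch
  applied to it divides the error by 9.\<close>

lemma cfrac_convergents:
  assumes "\<And>n. a n \<in> digits" "\<And>n. \<bar>z n\<bar> \<le> 1" "\<And>n. z n = 1 / (of_int (a n) + z (Suc n))"
  shows "cfrac_converges a (z 0)"
proof -
  have bound: "\<bar>cfrac 0 (map a [0..<n]) - z 0\<bar> \<le> (1 / 9) ^ n" for n
    using assms
  proof (induction n arbitrary: a z)
    case 0
    show ?case
      using 0(2)[of 0] by simp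
  next
    case (Suc n)
    let ?c = "cfrac 0 (map (\<lambda>n. a (Suc n)) [0..<n])"
    have IH: "\<bar>?c - z (Suc 0)\<bar> \<le> (1 / 9) ^ n"
      by (rule Suc.IH[of "\<lambda>n. a (Suc n)" "\<lambda>n. z (Suc n)"]) (rule Suc.prems)+
    have "\<bar>?c\<bar> \<le> 1 / 3"
      using Suc.prems(1) by (intro cfrac_0_bound) auto
    then have "norm (1 / (of_int (a 0) + ?c) - 1 / (of_int (a 0) + z (Suc 0))) \<le> norm (?c - z (Suc 0)) / 9"
      using Suc.prems(1,2) by (intro branch_dist_le) auto
    also have "1 / (of_int (a 0) + z (Suc 0)) = z 0"
      by (rule Suc.prems(3)[symmetric])
    finally show ?case
      using IH unfolding map_upt_Suc cfrac_0_Cons by simp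
  qed
  have "(\<lambda>n. cfrac 0 (map a [0..<n]) - z 0) \<longlonglongrightarrow> 0"
    by (rule tendsto_rabs_zero_cancel, rule tendsto_sandwich[OF _ _ tendsto_const LIMSEQ_realpow_zero[of "1 / 9"]])
      (use bound in auto)
  then show ?thesis
    unfolding cfrac_converges_def by (simp add: LIM_zero_cancel)
qed

text \<open>The group provides -1 / x, and the reflection symmetry turns it into 1 / x. The digit is
  nonzero because |1 / x| \<ge> 3 while the remainder is at most 1/3 by the gap.\<close>

lemma gauss_fun_limit_set:
  assumes x: "x \<in> real_limit_set Gamma_hat" "\<bar>x\<bar> \<le> 2" "x \<noteq> 0"
  shows "gauss_fun x \<in> real_limit_set Gamma_hat" "\<bar>gauss_fun x\<bar> \<le> 1 / 3"
    and "4 * round (1 / x / 4) \<in> digits" "x = 1 / (of_int (4 * round (1 / x / 4)) + gauss_fun x)"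
proof -
  have "- (- 1 / x) \<in> real_limit_set Gamma_hat"
    by (intro limit_set_uminus limit_set_inversion x)
  then have "- (- 1 / x) + of_int (- (4 * round (1 / x / 4))) \<in> real_limit_set Gamma_hat"
    by (rule limit_set_shift) simp
  then show L: "gauss_fun x \<in> real_limit_set Gamma_hat"
    by (simp add: gauss_fun_def)
  have "\<bar>gauss_fun x\<bar> \<le> 2"
    unfolding gauss_fun_def by (rule abs_diff_round4_le)
  with L show le: "\<bar>gauss_fun x\<bar> \<le> 1 / 3"
    by (rule limit_set_gap)
  have "\<bar>x\<bar> \<le> 1 / 3"
    using limit_set_gap x by blast
  then have "3 \<le> \<bar>1 / x\<bar>"
    using x(3) by (simp add: field_simps)
  then have "of_int (4 * round (1 / x / 4)) \<noteq> (0::real)"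
    using le unfolding gauss_fun_def by linarith
  then show "4 * round (1 / x / 4) \<in> digits"
    by (simp add: digits_def)
  show "x = 1 / (of_int (4 * round (1 / x / 4)) + gauss_fun x)"
    by (simp add: gauss_fun_def)
qed

lemma finite_expansion:
  assumes "x \<in> real_limit_set Gamma_hat" "\<bar>x\<bar> \<le> 2" "(gauss_fun ^^ n) x = 0"
  shows "\<exists>as. set as \<subseteq> digits \<and> x = cfrac 0 as"
  using assms
proof (induction n arbitrary: x)
  case 0
  then show ?case
    by (intro exI[of _ "[]"]) auto
next
  case (Suc n)
  show ?case
  proof (cases "x = 0")
    case True
    then show ?thesis
      by (intro exI[of _ "[]"]) auto
  next
    case False
    note g = gauss_fun_limit_set[OF Suc.prems(1,2) False]
    have "\<exists>as. set as \<subseteq> digits \<and> gauss_fun x = cfrac 0 as"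
      using Suc.prems(3) g(2) by (intro Suc.IH g(1)) (auto simp: funpow_swap1)
    then obtain as where as: "set as \<subseteq> digits" "gauss_fun x = cfrac 0 as"
      by blast
    have "x = cfrac 0 (4 * round (1 / x / 4) # as)"
      unfolding cfrac_0_Cons as(2)[symmetric] by (rule g(4))
    then show ?thesis
      using as(1) g(3) by (intro exI[of _ "4 * round (1 / x / 4) # as"]) auto
  qed
qed

text \<open>The two clauses of \<open>gauss_rel\<close> correspond to the orbit of x under
  \<open>gauss_fun\<close> reaching 0 or not.\<close>

lemma gauss_rel_gauss_fun:
  assumes x: "x \<in> real_limit_set Gamma_hat" "\<bar>x\<bar> \<le> 2" "x \<noteq> 0"
  shows "gauss_rel x (gauss_fun x)"
proof (cases "\<exists>n. (gauss_fun ^^ n) x = 0")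
  case True
  then obtain n where n: "(gauss_fun ^^ n) x = 0"
    by blast
  then obtain m where "n = Suc m"
    using x(3) by (cases n) auto
  then have "(gauss_fun ^^ m) (gauss_fun x) = 0"
    using n by (simp add: funpow_swap1)
  moreover note g = gauss_fun_limit_set[OF x]
  ultimately obtain as where as: "set as \<subseteq> digits" "gauss_fun x = cfrac 0 as"
    using finite_expansion[of "gauss_fun x" m] by auto
  have "x = cfrac 0 (4 * round (1 / x / 4) # as)"
    unfolding cfrac_0_Cons as(2)[symmetric] by (rule g(4))
  then show ?thesis
    unfolding gauss_rel_def using as g(3)
    by (intro disjI1 exI[of _ "4 * round (1 / x / 4)"] exI[of _ as]) auto
next
  case False
  define z where "z n = (gauss_fun ^^ n) x" for n
  define a where "a n = 4 * round (1 / z n / 4)" for n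
  have nz: "z n \<noteq> 0" for n
    using False by (simp add: z_def)
  have zS: "z (Suc n) = gauss_fun (z n)" for n
    by (simp add: z_def)
  have L: "z n \<in> real_limit_set Gamma_hat \<and> \<bar>z n\<bar> \<le> 1 / 3" for n
  proof (induction n)
    case 0
    then show ?case
      using x limit_set_gap by (simp add: z_def)
  next
    case (Suc n)
    then show ?case
      using gauss_fun_limit_set(1,2)[of "z n"] nz[of n] by (auto simp: zS)
  qed
  have z2: "\<bar>z n\<bar> \<le> 2" for n
    using L[of n] by linarith
  have a: "a n \<in> digits" and z: "z n = 1 / (of_int (a n) + z (Suc n))" for n
    unfolding a_def zS using gauss_fun_limit_set(3,4)[of "z n"] L z2 nz by blast+
  have z1: "\<bar>z n\<bar> \<le> 1" for n
    using L[of n] by linarith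
  have "cfrac_converges a (z 0)"
    by (rule cfrac_convergents) (fact a z1 z)+
  moreover have "cfrac_converges (\<lambda>n. a (Suc n)) (z (Suc 0))"
    by (rule cfrac_convergents[where z = "\<lambda>n. z (Suc n)"]) (fact a z1 z)+
  ultimately show ?thesis
    unfolding gauss_rel_def using a by (intro disjI2 exI[of _ a]) (auto simp: z_def)
qed

lemma gauss_map_eq:
  assumes "x \<in> real_limit_set Gamma_hat" "\<bar>x\<bar> \<le> 2" "x \<noteq> 0"
  shows "gauss_map x = gauss_fun x"
  unfolding gauss_map_def
proof (rule the_equality)
  show "gauss_rel x (gauss_fun x)"
    by (rule gauss_rel_gauss_fun[OF assms])
next
  fix y assume "gauss_rel x y"
  then obtain a where "a \<in> digits" "\<bar>y\<bar> \<le> 1 / 3" "x = 1 / (of_int a + y)"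
    by (rule gauss_rel_imp)
  then show "y = gauss_fun x"
    using gauss_fun_branch[of a y] by auto
qed

section \<open>The invariant density\<close>

context ps_density
begin

text \<open>The density, up to normalisation, of the Gauss measure with respect to M. The quotient
  form is that of \<open>m0_unnormalized\<close>.\<close>

definition h :: "real \<Rightarrow> ennreal" where
  "h y = (\<integral>\<^sup>+x. 1 / ennreal (\<bar>x * y - 1\<bar> powr (2 * \<delta>)) \<partial>M)"

lemma h_borel [measurable]: "h \<in> borel_measurable borel"
proof -
  have "(\<lambda>p. 1 / ennreal (\<bar>snd p * fst p - 1\<bar> powr (2 * \<delta>))) \<in> borel_measurable (borel \<Otimes>\<^sub>M M)"
    using measurable_fst[of "borel :: real measure" M] measurable_snd[of "borel :: real measure" M]
    by (simp cong: measurable_cong_sets)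
  then show ?thesis
    unfolding h_def[abs_def] by (intro M.borel_measurable_nn_integral) (simp add: split_beta')
qed

lemma kernel_pos:
  fixes x y :: real
  assumes "\<bar>x\<bar> \<le> 1 / 3" "\<bar>y\<bar> \<le> 1"
  shows "2 / 3 \<le> \<bar>x * y - 1\<bar>" "\<bar>x * y - 1\<bar> \<le> 4 / 3"
proof -
  have "\<bar>x * y\<bar> \<le> 1 / 3 * 1"
    unfolding abs_mult using assms by (intro mult_mono) auto
  then show "2 / 3 \<le> \<bar>x * y - 1\<bar>" "\<bar>x * y - 1\<bar> \<le> 4 / 3"
    by linarith+
qed

text \<open>The two forms of the kernel differ only where x * y = 1, with values infinity and 0; the
  gap keeps M away from such x.\<close>

lemma h_eq:
  assumes y: "\<bar>y\<bar> \<le> 1"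
  shows "h y = (\<integral>\<^sup>+x. ennreal (\<bar>x * y - 1\<bar> powr (- 2 * \<delta>)) \<partial>M)"
  unfolding h_def
proof (rule nn_integral_cong_AE, use AE_M in eventually_elim)
  fix x assume "x \<in> real_limit_set Gamma_hat \<and> \<bar>x\<bar> \<le> 1 / 3"
  then have "0 < \<bar>x * y - 1\<bar>"
    using kernel_pos(1)[of x y] y by linarith
  then have pos: "0 < \<bar>x * y - 1\<bar> powr (2 * \<delta>)"
    by simp
  have "1 / ennreal (\<bar>x * y - 1\<bar> powr (2 * \<delta>)) = ennreal (1 / \<bar>x * y - 1\<bar> powr (2 * \<delta>))"
    using divide_ennreal[OF zero_le_one pos] by simp
  then show "1 / ennreal (\<bar>x * y - 1\<bar> powr (2 * \<delta>)) = ennreal (\<bar>x * y - 1\<bar> powr (- 2 * \<delta>))"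
    by (simp add: powr_minus_divide)
qed

lemma h_bounds:
  assumes y: "\<bar>y\<bar> \<le> 1"
  shows "0 < h y" "h y \<le> ennreal ((2 / 3) powr (- 2 * \<delta>)) * emeasure M UNIV"
proof -
  have "h y \<le> (\<integral>\<^sup>+x. ennreal ((2 / 3) powr (- 2 * \<delta>)) \<partial>M)"
    unfolding h_eq[OF y]
  proof (rule nn_integral_mono_AE, use AE_M in eventually_elim)
    fix x assume "x \<in> real_limit_set Gamma_hat \<and> \<bar>x\<bar> \<le> 1 / 3"
    then show "ennreal (\<bar>x * y - 1\<bar> powr (- 2 * \<delta>)) \<le> ennreal ((2 / 3) powr (- 2 * \<delta>))"
      using kernel_pos(1)[of x y] y delta_gt_half by (intro ennreal_leI powr_mono2') auto
  qed
  then show "h y \<le> ennreal ((2 / 3) powr (- 2 * \<delta>)) * emeasure M UNIV"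
    by simp
  have "0 < ennreal ((4 / 3) powr (- 2 * \<delta>)) * emeasure M UNIV"
    using M_nonzero by (simp add: ennreal_zero_less_mult_iff zero_less_iff_neq_zero)
  also have "\<dots> = (\<integral>\<^sup>+x. ennreal ((4 / 3) powr (- 2 * \<delta>)) \<partial>M)"
    by simp
  also have "\<dots> \<le> h y"
    unfolding h_eq[OF y]
  proof (rule nn_integral_mono_AE, use AE_M in eventually_elim)
    fix x assume "x \<in> real_limit_set Gamma_hat \<and> \<bar>x\<bar> \<le> 1 / 3"
    then show "ennreal ((4 / 3) powr (- 2 * \<delta>)) \<le> ennreal (\<bar>x * y - 1\<bar> powr (- 2 * \<delta>))"
      using kernel_pos[of x y] y delta_gt_half by (intro ennreal_leI powr_mono2') auto
  qed
  finally show "0 < h y" .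
qed

text \<open>With a = k + y, the identity a * (x / a - 1) = x - a. The result depends only on x - y -
  k, so exchanging x and y amounts to replacing k by -k.\<close>

lemma kernel_branch:
  fixes x y :: real
  assumes k: "k \<in> digits" and y: "\<bar>y\<bar> \<le> 1"
  shows "ennreal (\<bar>of_int k + y\<bar> powr (- 2 * \<delta>)) * ennreal (\<bar>x * (1 / (of_int k + y)) - 1\<bar> powr (- 2 * \<delta>))
     = ennreal (\<bar>x - y - of_int k\<bar> powr (- 2 * \<delta>))"
proof -
  define a where "a = of_int k + y"
  have "3 \<le> \<bar>a\<bar>"
    using norm_digit_plus_ge(2)[OF k, of y] y by (simp add: a_def)
  then have "a * (x * (1 / a) - 1) = x - a"
    by (simp add: right_diff_distrib)
  then have "\<bar>a\<bar> * \<bar>x * (1 / a) - 1\<bar> = \<bar>x - a\<bar>"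
    by (simp only: abs_mult[symmetric])
  then have "\<bar>of_int k + y\<bar> * \<bar>x * (1 / (of_int k + y)) - 1\<bar> = \<bar>x - y - of_int k\<bar>"
    by (simp only: a_def diff_diff_eq add.commute[of _ y])
  then show ?thesis
    by (simp flip: ennreal_mult powr_mult)
qed

text \<open>
  Both sides equal \<open>\<Sum>k. \<integral> \<bar>x - y - k\<bar> powr (- 2 * \<delta>) dM(x)\<close>: the left one by definition, the right one
  by conformality in the variable \<open>x\<close> and the substitution of \<open>- k\<close> for \<open>k\<close>.
\<close>

lemma transfer_h:
  assumes y: "\<bar>y\<bar> \<le> 1"
  shows "transfer \<delta> 1 h y = h y"
proof -
  let ?D = "\<lambda>x k. ennreal (\<bar>x - y - of_int k\<bar> powr (- 2 * \<delta>))"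
  have "transfer \<delta> 1 h y = (\<integral>\<^sup>+k. \<integral>\<^sup>+x. ?D x k \<partial>M \<partial>count_space digits)"
    unfolding transfer_def
  proof (rule nn_integral_cong)
    fix k assume "k \<in> space (count_space digits)"
    then have k: "k \<in> digits"
      by simp
    have "norm (1 / (of_int k + y)) \<le> 1 / 3"
      using y by (intro norm_branch_le k) auto
    then have "\<bar>1 / (of_int k + y)\<bar> \<le> 1"
      unfolding real_norm_def by linarith
    then have "ennreal (norm (of_int k + y) powr (- 2 * \<delta>)) * h (1 / (of_int k + y))
      = (\<integral>\<^sup>+x. ennreal (\<bar>of_int k + y\<bar> powr (- 2 * \<delta>)) * ennreal (\<bar>x * (1 / (of_int k + y)) - 1\<bar> powr (- 2 * \<delta>)) \<partial>M)"
      by (subst nn_integral_cmult) (simp_all add: h_eq)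
    also have "\<dots> = (\<integral>\<^sup>+x. ?D x k \<partial>M)"
      by (simp only: kernel_branch[OF k y])
    finally show "ennreal (norm (of_int k + y) powr (- 2 * \<delta>)) * h (1 / (of_int k + y)) = (\<integral>\<^sup>+x. ?D x k \<partial>M)" .
  qed
  also have "\<dots> = (\<integral>\<^sup>+k. \<integral>\<^sup>+x. ?D x (- k) \<partial>M \<partial>count_space digits)"
    by (rule nn_integral_bij_count_space[symmetric])
      (auto simp: bij_betw_def inj_on_def image_iff intro!: bexI[of _ "- _"])
  also have "\<dots> = (\<integral>\<^sup>+x. \<integral>\<^sup>+k. ?D x (- k) \<partial>count_space digits \<partial>M)"
    by (rule nn_integral_count_space_nn_integral[OF countable_digits, symmetric]) simp
  also have "\<dots> = (\<integral>\<^sup>+x. transfer \<delta> 1 (\<lambda>x. ennreal (\<bar>x * y - 1\<bar> powr (- 2 * \<delta>))) x \<partial>M)"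
  proof (rule nn_integral_cong_AE, use AE_M_ball in eventually_elim)
    fix x :: real assume x: "\<bar>x\<bar> \<le> 1"
    have "?D x (- k) = ennreal (norm (of_int k + x) powr (- 2 * \<delta>)) * ennreal (\<bar>1 / (of_int k + x) * y - 1\<bar> powr (- 2 * \<delta>))"
      if k: "k \<in> digits" for k
    proof -
      have "\<bar>x - y - of_int (- k)\<bar> = \<bar>y - x - of_int k\<bar>"
        by simp
      then show ?thesis
        using kernel_branch[OF k x, of y] by (simp only: real_norm_def mult.commute[of y])
    qed
    then show "(\<integral>\<^sup>+k. ?D x (- k) \<partial>count_space digits)
       = transfer \<delta> 1 (\<lambda>x. ennreal (\<bar>x * y - 1\<bar> powr (- 2 * \<delta>))) x"
      unfolding transfer_def by (intro nn_integral_cong) auto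
  qed
  also have "\<dots> = (\<integral>\<^sup>+x. ennreal (\<bar>x * y - 1\<bar> powr (- 2 * \<delta>)) \<partial>M)"
    by (rule conformalD[OF conformal_M_plus, symmetric]) measurable
  finally show ?thesis
    by (simp only: h_eq[OF y])
qed

text \<open>No branch takes the value 0, so a conformal measure cannot charge it: mass at 0 could
  only have come from infinity.\<close>

lemma AE_M_nonzero: "AE x in M. x \<noteq> 0"
proof -
  have "(\<integral>\<^sup>+x. indicator {0::real} x \<partial>M) = (\<integral>\<^sup>+x. transfer \<delta> 1 (indicator {0}) x \<partial>M)"
    by (rule conformalD[OF conformal_M_plus]) simp
  also have "\<dots> = (\<integral>\<^sup>+x. 0 \<partial>M)"
  proof (rule nn_integral_cong_AE, use AE_M_ball in eventually_elim)
    fix x :: real assume x: "\<bar>x\<bar> \<le> 1"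
    have "of_int k + x \<noteq> 0" if "k \<in> digits" for k
      using norm_digit_plus_ge(2)[OF that, of x] x by auto
    then have "transfer \<delta> 1 (indicator {0}) x = (\<integral>\<^sup>+k. 0 \<partial>count_space digits)"
      unfolding transfer_def by (intro nn_integral_cong) (auto simp: indicator_def)
    then show "transfer \<delta> 1 (indicator {0}) x = 0"
      by simp
  qed
  finally have "emeasure M {0} = 0"
    by simp
  then show ?thesis
    by (intro AE_I[of _ _ "{0}"]) auto
qed

section \<open>The Gauss measure: normalisation, invariance, ergodicity\<close>

abbreviation L0 :: "real set" where
  "L0 \<equiv> real_limit_set Gamma_hat \<inter> {-2<..<2}"

abbreviation Ls :: "real set" where
  "Ls \<equiv> real_limit_set Gamma_hat \<inter> ({-2<..<2} - {0})"

lemma L0_sets [measurable]: "real_limit_set Gamma_hat \<in> sets borel"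
  using closed_real_limit_set by (rule borel_closed)

lemma AE_M_Ls: "AE x in M. x \<in> Ls"
  using AE_M AE_M_nonzero by eventually_elim auto

lemma sets_m0u: "sets (m0_unnormalized Gamma_hat \<nu>) = sets (restrict_space borel L0)"
  unfolding m0_unnormalized_def sets_density by (rule sets_restrict_space_cong) simp

lemma space_m0u: "space (m0_unnormalized Gamma_hat \<nu>) = L0"
  using sets_eq_imp_space_eq[OF sets_m0u] by (simp add: space_restrict_space)

lemma emeasure_m0u:
  assumes E: "E \<in> sets borel" "E \<subseteq> L0"
  shows "emeasure (m0_unnormalized Gamma_hat \<nu>) E = (\<integral>\<^sup>+y. h y * indicator E y \<partial>M)"
proof -
  have [measurable]: "E \<in> sets borel"
    by (rule E(1))
  have h: "(\<integral>\<^sup>+x\<in>{-2..2}. 1 / ennreal (\<bar>x * y - 1\<bar> powr (2 * \<delta>)) \<partial>mu) = h y" for y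
    unfolding h_def by (subst nn_integral_M) (simp_all add: mult.commute)
  have "emeasure (m0_unnormalized Gamma_hat \<nu>) E = (\<integral>\<^sup>+y. h y * indicator E y \<partial>restrict_space mu L0)"
    unfolding m0_unnormalized_def h using E
    by (intro emeasure_density) (auto simp: sets_restrict_space_iff intro!: measurable_restrict_space1)
  also have "\<dots> = (\<integral>\<^sup>+y. h y * indicator E y * indicator L0 y \<partial>mu)"
    by (subst nn_integral_restrict_space) auto
  also have "\<dots> = (\<integral>\<^sup>+y. indicator {-2..2} y * (h y * indicator E y) \<partial>mu)"
    using E(2) by (intro nn_integral_cong) (auto simp: indicator_def)
  also have "\<dots> = (\<integral>\<^sup>+y. h y * indicator E y \<partial>M)"
    by (rule nn_integral_M[symmetric]) measurable
  finally show ?thesis .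
qed

abbreviation Z :: ennreal where
  "Z \<equiv> emeasure (m0_unnormalized Gamma_hat \<nu>) (space (m0_unnormalized Gamma_hat \<nu>))"

lemma Z_eq: "Z = (\<integral>\<^sup>+y. h y \<partial>M)"
proof -
  have "Z = (\<integral>\<^sup>+y. h y * indicator L0 y \<partial>M)"
    unfolding space_m0u by (rule emeasure_m0u) auto
  also have "\<dots> = (\<integral>\<^sup>+y. h y \<partial>M)"
    using AE_M_Ls by (intro nn_integral_cong_AE, eventually_elim) (auto simp: indicator_def)
  finally show ?thesis .
qed

lemma Z_pos: "Z \<noteq> 0"
proof
  assume "Z = 0"
  then have "AE y in M. h y = 0"
    unfolding Z_eq by (subst (asm) nn_integral_0_iff_AE) auto
  then have "AE y in M. False"
    using AE_M_ball by eventually_elim (use h_bounds(1) in \<open>auto simp: less_le\<close>)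
  then have "emeasure M UNIV = 0"
    using emeasure_eq_0_AE[of "\<lambda>_. True" M] by simp
  then show False
    using M_nonzero by simp
qed

lemma Z_finite: "Z \<noteq> \<infinity>"
proof -
  let ?b = "ennreal ((2 / 3) powr (- 2 * \<delta>)) * emeasure M UNIV"
  have "Z \<le> (\<integral>\<^sup>+y. ?b \<partial>M)"
    unfolding Z_eq using AE_M_ball by (intro nn_integral_mono_AE, eventually_elim) (rule h_bounds(2))
  also have "\<dots> < \<infinity>"
    by (simp add: ennreal_mult_less_top M.emeasure_eq_measure)
  finally show ?thesis
    by simp
qed

lemma prob_space_m0: "prob_space (m0 Gamma_hat \<nu>)"
proof (rule prob_spaceI)
  have "emeasure (m0 Gamma_hat \<nu>) (space (m0 Gamma_hat \<nu>)) = 1 / Z * Z"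
    by (simp add: m0_def space_scale_measure)
  also have "\<dots> = Z / Z"
    by (simp add: ennreal_times_divide mult.commute)
  also have "\<dots> = 1"
    using Z_pos Z_finite by (intro ennreal_divide_self) (auto simp: top.not_eq_extremum)
  finally show "emeasure (m0 Gamma_hat \<nu>) (space (m0 Gamma_hat \<nu>)) = 1" .
qed

abbreviation ms :: "real measure" where "ms \<equiv> m0_star Gamma_hat \<nu>"

lemma space_ms: "space ms = Ls"
  by (auto simp: m0_star_def m0_def space_restrict_space space_scale_measure space_m0u)

lemma sets_ms_iff: "E \<in> sets ms \<longleftrightarrow> E \<in> sets borel \<and> E \<subseteq> Ls"
proof -
  have "sets ms = sets (restrict_space (restrict_space borel L0) ({-2<..<2} - {0}))"
    unfolding m0_star_def m0_def by (intro sets_restrict_space_cong) (simp add: sets_m0u)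
  also have "\<dots> = sets (restrict_space borel Ls)"
    by (subst restrict_restrict_space) (auto simp: sets_restrict_space_iff intro!: arg_cong[where f = "\<lambda>S. sets (restrict_space borel S)"])
  finally show ?thesis
    by (simp add: sets_restrict_space_iff conj_commute)
qed

lemma emeasure_ms:
  assumes E: "E \<in> sets ms"
  shows "emeasure ms E = 1 / Z * (\<integral>\<^sup>+y. h y * indicator E y \<partial>M)"
proof -
  have E': "E \<in> sets borel" "E \<subseteq> Ls"
    using E by (auto simp: sets_ms_iff)
  have "({-2<..<2} - {0}) \<inter> L0 \<in> sets (restrict_space borel L0)"
    by (subst sets_restrict_space_iff) auto
  then have "emeasure ms E = emeasure (m0 Gamma_hat \<nu>) E"
    unfolding m0_star_def using E'(2)
    by (intro emeasure_restrict_space) (auto simp: m0_def space_scale_measure space_m0u sets_m0u)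
  also have "\<dots> = 1 / Z * emeasure (m0_unnormalized Gamma_hat \<nu>) E"
    by (simp add: m0_def)
  also have "emeasure (m0_unnormalized Gamma_hat \<nu>) E = (\<integral>\<^sup>+y. h y * indicator E y \<partial>M)"
    using E' by (intro emeasure_m0u) auto
  finally show ?thesis .
qed

text \<open>The density h is positive on the ball and Z is finite, so both measures have the same
  null sets and ergodicity can be settled for the conformal measure.\<close>

lemma null_sets_ms_iff:
  assumes E: "E \<in> sets ms"
  shows "E \<in> null_sets ms \<longleftrightarrow> emeasure M E = 0"
proof -
  have [measurable]: "E \<in> sets borel"
    using E by (auto simp: sets_ms_iff)
  have "E \<in> null_sets ms \<longleftrightarrow> (\<integral>\<^sup>+y. h y * indicator E y \<partial>M) = 0"
    using E Z_finite by (auto simp: null_sets_def emeasure_ms ennreal_divide_eq_0_iff)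
  also have "\<dots> \<longleftrightarrow> (AE y in M. h y * indicator E y = 0)"
    by (rule nn_integral_0_iff_AE) simp
  also have "\<dots> \<longleftrightarrow> (AE y in M. y \<notin> E)"
  proof
    assume "AE y in M. h y * indicator E y = 0"
    then show "AE y in M. y \<notin> E"
      using AE_M_ball
    proof eventually_elim
      fix y assume "h y * indicator E y = 0" "\<bar>y\<bar> \<le> 1"
      then show "y \<notin> E"
        using h_bounds(1)[of y] by (auto simp: indicator_def)
    qed
  next
    assume "AE y in M. y \<notin> E"
    then show "AE y in M. h y * indicator E y = 0"
      by eventually_elim auto
  qed
  also have "\<dots> \<longleftrightarrow> emeasure M E = 0"
    using AE_iff_measurable[of E M "\<lambda>y. y \<notin> E"] by auto
  finally show ?thesis .
qed

lemma gauss_preimage: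
  "gauss_map -` E \<inter> space ms = gauss_fun -` E \<inter> Ls"
  unfolding space_ms using gauss_map_eq by auto

lemma gauss_preimage_sets:
  assumes "E \<in> sets borel"
  shows "gauss_map -` E \<inter> space ms \<in> sets ms"
proof -
  have "gauss_fun -` E \<in> sets borel"
    using measurable_sets[OF gauss_fun_borel assms] by simp
  then show ?thesis
    unfolding gauss_preimage sets_ms_iff by auto
qed

text \<open>Along every inverse branch the indicator of the preimage of E is the indicator of E at
  the base point. It therefore comes out of the transfer operator, which fixes h.\<close>

lemma invariant_ms: "invariant_measure ms gauss_map"
  unfolding invariant_measure_def
proof (intro ballI conjI)
  fix E assume E: "E \<in> sets ms"
  then have E' [measurable]: "E \<in> sets borel"
    by (auto simp: sets_ms_iff)
  show pre: "gauss_map -` E \<inter> space ms \<in> sets ms"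
    by (rule gauss_preimage_sets[OF E'])
  have "(\<integral>\<^sup>+y. h y * indicator (gauss_map -` E \<inter> space ms) y \<partial>M) = (\<integral>\<^sup>+y. h y * indicator E (gauss_fun y) \<partial>M)"
    unfolding gauss_preimage using AE_M_Ls by (intro nn_integral_cong_AE, eventually_elim) (auto simp: indicator_def)
  also have "\<dots> = (\<integral>\<^sup>+y. transfer \<delta> 1 (\<lambda>y. h y * indicator E (gauss_fun y)) y \<partial>M)"
    by (rule conformalD[OF conformal_M_plus]) measurable
  also have "\<dots> = (\<integral>\<^sup>+y. h y * indicator E y \<partial>M)"
  proof (rule nn_integral_cong_AE, use AE_M_ball in eventually_elim)
    fix y :: real assume y: "\<bar>y\<bar> \<le> 1"
    have "transfer \<delta> 1 (\<lambda>y. h y * indicator E (gauss_fun y)) y = transfer \<delta> 1 (\<lambda>z. indicator E y * h z) y"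
      unfolding transfer_def
      using y by (intro nn_integral_cong) (simp add: gauss_fun_branch mult_ac)
    also have "\<dots> = indicator E y * transfer \<delta> 1 h y"
      by (rule transfer_cmult)
    finally show "transfer \<delta> 1 (\<lambda>y. h y * indicator E (gauss_fun y)) y = h y * indicator E y"
      by (simp add: transfer_h[OF y] mult.commute)
  qed
  finally show "emeasure ms (gauss_map -` E \<inter> space ms) = emeasure ms E"
    by (simp add: emeasure_ms[OF pre] emeasure_ms[OF E])
qed

text \<open>Invariance modulo null sets has to be turned into invariance along all inverse branches
  at once. The set N of disagreement is null, and since all weights are positive, conformality makes
  its preimage under every branch null.\<close>

lemma ergodic_ms: "ergodic_measure ms gauss_map"
  unfolding ergodic_measure_def
proof (intro ballI impI)
  fix E assume E: "E \<in> sets ms" and null: "sym_diff (gauss_map -` E \<inter> space ms) E \<in> null_sets ms"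
  have E' [measurable]: "E \<in> sets borel" and EL: "E \<subseteq> Ls"
    using E by (auto simp: sets_ms_iff)
  let ?D = "sym_diff (gauss_map -` E \<inter> space ms) E"
  define N where "N = {x. (gauss_fun x \<in> E) \<noteq> (x \<in> E)}"
  have N [measurable]: "N \<in> sets borel"
    unfolding N_def by measurable
  have D: "?D \<in> sets ms"
    using null by auto
  then have "emeasure M ?D = 0"
    using null by (simp only: null_sets_ms_iff)
  then have "?D \<in> null_sets M"
    using D by (auto simp: sets_ms_iff)
  then have "AE x in M. x \<notin> ?D"
    by (rule AE_not_in)
  then have "AE x in M. (indicator N x :: ennreal) = 0"
    using AE_M_Ls by eventually_elim (auto simp: gauss_preimage N_def indicator_def)
  then have "(\<integral>\<^sup>+x. indicator N x \<partial>M) = 0"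
    by (subst nn_integral_0_iff_AE) auto
  then have "(\<integral>\<^sup>+x. transfer \<delta> 1 (indicator N) x \<partial>M) = 0"
    using conformalD[OF conformal_M_plus, of "indicator N"] by simp
  then have "AE x in M. transfer \<delta> 1 (indicator N) x = 0"
    by (subst (asm) nn_integral_0_iff_AE) (auto intro: transfer_borel)
  then have "AE x in M. \<forall>k\<in>digits. 1 / (of_int k + x) \<in> E \<longleftrightarrow> x \<in> E"
    using AE_M_ball
  proof eventually_elim
    fix x :: real assume 0: "transfer \<delta> 1 (indicator N) x = 0" and x: "\<bar>x\<bar> \<le> 1"
    show "\<forall>k\<in>digits. 1 / (of_int k + x) \<in> E \<longleftrightarrow> x \<in> E"
    proof
      fix k assume k: "k \<in> digits"
      have "ennreal (norm (of_int k + x) powr (- 2 * \<delta>)) * indicator N (1 / (of_int k + x)) = 0"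
        using 0 k unfolding transfer_def by (subst (asm) nn_integral_0_iff_AE) (auto simp: AE_count_space)
      moreover have "3 \<le> norm (of_int k + x)"
        using norm_digit_plus_ge(2)[OF k, of x] x by simp
      ultimately have "1 / (of_int k + x) \<notin> N"
        by (auto simp: indicator_def split: if_splits)
      then show "1 / (of_int k + x) \<in> E \<longleftrightarrow> x \<in> E"
        using gauss_fun_branch[OF k, of x] x by (simp add: N_def)
    qed
  qed
  then have "emeasure M E = 0 \<or> emeasure M (- E) = 0"
    using delta_gt_half
    by (intro conformal_ergodic[OF finite_M sets_M AE_M_ball conformal_M_plus]) auto
  then show "E \<in> null_sets ms \<or> space ms - E \<in> null_sets ms"
  proof
    assume "emeasure M E = 0"
    then show ?thesis
      using null_sets_ms_iff[OF E] by simp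
  next
    assume 0: "emeasure M (- E) = 0"
    have "emeasure M (space ms - E) \<le> emeasure M (- E)"
      by (intro emeasure_mono) auto
    then have "emeasure M (space ms - E) = 0"
      using 0 by simp
    then show ?thesis
      using null_sets_ms_iff[of "space ms - E"] E by auto
  qed
qed

end

theorem theorem9p2:
  fixes \<nu> :: "complex \<Rightarrow> real option measure"
  assumes "patterson_sullivan_density Gamma_hat \<nu>"
  shows "prob_space (m0 Gamma_hat \<nu>) \<and>
    invariant_measure (m0_star Gamma_hat \<nu>) gauss_map \<and>
    ergodic_measure (m0_star Gamma_hat \<nu>) gauss_map"
proof -
  interpret ps_density \<nu>
    by unfold_locales (rule assms)
  show ?thesis
    by (intro conjI prob_space_m0 invariant_ms ergodic_ms)
qed

end
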